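(* Let $G$ be a locally compact and second countable group. Then $\mathcal{U}_0(G)$, the family of closed sets of extended uniqueness of $G$, is a coanalytic subset of $\mathcal{F}(G)$.
   Context: Topological groups are assumed Hausdorff. **Sets of extended uniqueness.** $M(G)$ is the Banach algebra (under convolution) of complex Borel measures on $G$; for a closed set $E\subseteq G$, $M(E)\subseteq M(G)$ is the set of measures with support contained in $E$. $L^p(G)$ is taken with respect to Haar measure; $s\mapsto\lambda_s$ is the left regular representation of $G$ on $L^2(G)$, and for $\mu\in M(G)$ the operator $\lambda(\mu)$ on $L^2(G)$ is $\lambda(\mu)\xi(g)=\int_G\xi(s^{-1}g)\,d\mu(s)$; $L^1(G)$ is identified with a closed ideal of $M(G)$. The reduced group $C^*$-algebra is $C_r^*(G)=\overline{\{\lambda(f): f\in L^1(G)\}}^{\|\cdot\|}$. A closed set $E\subseteq G$ is a set of extended uniqueness if $\lambda(M(E))\cap C_r^*(G)=\{0\}$. $\mathcal{U}_0(G)$ denotes the family of closed sets of extended uniqueness of $G$. **Descriptive set theory.** $\mathcal{F}(G)$ is the set of closed subsets of $G$. It carries the Effros Borel structure, i.e. the $\sigma$-algebra generated by the sets $\{F: F\cap U\neq\emptyset\}$, $U\subseteq G$ open. For $G$ locally compact second countable this is induced by the Fell topology on $\mathcal{F}(G)$, which is compact metrizable (hence Polish) and has as basis the sets $\{F: F\cap K=\emptyset, F\cap U_1\neq\emptyset,\dots,F\cap U_n\neq\emptyset\}$ with $K\subseteq G$ compact and $U_i\subseteq G$ open. For a Polish space $X$, a subset is analytic if it is the projection to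 $X$ of a Borel subset of $X\times Y$ for some Polish space $Y$; it is coanalytic if its complement is analytic. *)

theory Defs
  imports "HOL-Analysis.Analysis"
begin

section \<open>Topological groups with a Haar measure\<close>

text \<open>
  Groups are written additively, because \<open>topological_group_add\<close> is the library's class of
  topological groups; it does \<^emph>\<open>not\<close> assume commutativity. So \<open>s + t\<close>, \<open>- s\<close>, \<open>0\<close> stand for
  \<open>st\<close>, \<open>s\<inverse>\<close>, \<open>e\<close>.

  A left Haar measure is part of the structure. It exists on every locally compact
  group and is unique up to a positive scalar, so this fixes a normalization only, on
  which nothing below depends. On a second countable locally compact Hausdorff group regularity is
  automatic for Borel measures that are finite on compact sets.
\<close>

class haar_group = topological_group_add +
  fixes haar :: "'a measure"
  assumes sets_haar: "sets haar = sets borel"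
    and emeasure_haar_compact: "compact K \<Longrightarrow> emeasure haar K < \<infinity>"
    and haar_nonzero: "emeasure haar UNIV \<noteq> 0"
    and haar_left_invariant: "A \<in> sets borel \<Longrightarrow> emeasure haar ((\<lambda>x. s + x) ` A) = emeasure haar A"

section \<open>The space $L^2(G)$\<close>

definition square_integrable :: "('a::haar_group \<Rightarrow> complex) \<Rightarrow> bool" where
  "square_integrable f \<longleftrightarrow>
     f \<in> borel_measurable borel \<and> integrable haar (\<lambda>x. (cmod (f x))\<^sup>2)"

definition L2_eq :: "('a::haar_group \<Rightarrow> complex) \<Rightarrow> ('a \<Rightarrow> complex) \<Rightarrow> bool" where
  "L2_eq f g \<longleftrightarrow> square_integrable f \<and> square_integrable g \<and> (AE x in haar. f x = g x)"

lemma borel_measurable_haar: "borel_measurable (haar :: 'a::haar_group measure) = borel_measurable borel"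
  by (rule measurable_cong_sets) (simp_all add: sets_haar)

lemma square_integrable_zero: "square_integrable (\<lambda>_. 0)"
  by (simp add: square_integrable_def)

lemma square_integrable_inner:
  assumes "square_integrable f" "square_integrable g"
  shows "integrable haar (\<lambda>x. f x \<bullet> g x)"
proof (rule Bochner_Integration.integrable_bound)
  show "integrable haar (\<lambda>x. (cmod (f x))\<^sup>2 + (cmod (g x))\<^sup>2)"
    using assms by (auto simp: square_integrable_def)
  show "(\<lambda>x. f x \<bullet> g x) \<in> borel_measurable haar"
    using assms by (auto simp: square_integrable_def borel_measurable_haar)
  have "norm (f x \<bullet> g x) \<le> (cmod (f x))\<^sup>2 + (cmod (g x))\<^sup>2" for x
  proof -
    have "norm (f x \<bullet> g x) \<le> cmod (f x) * cmod (g x)"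
      by (simp add: Cauchy_Schwarz_ineq2)
    moreover have "2 * (cmod (f x) * cmod (g x)) \<le> (cmod (f x))\<^sup>2 + (cmod (g x))\<^sup>2"
      using sum_squares_bound[of "cmod (f x)" "cmod (g x)"] by (simp add: mult.assoc)
    moreover have "0 \<le> cmod (f x) * cmod (g x)" by simp
    ultimately show ?thesis by linarith
  qed
  then show "AE x in haar. norm (f x \<bullet> g x) \<le> norm ((cmod (f x))\<^sup>2 + (cmod (g x))\<^sup>2)"
    by simp
qed

lemma square_integrable_add:
  assumes "square_integrable f" "square_integrable g"
  shows "square_integrable (\<lambda>x. f x + g x)"
proof -
  have "(cmod (f x + g x))\<^sup>2 = (cmod (f x))\<^sup>2 + 2 * (f x \<bullet> g x) + (cmod (g x))\<^sup>2" for x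
    by (simp add: power2_norm_eq_inner inner_add_left inner_add_right inner_commute)
  moreover have "integrable haar (\<lambda>x. (cmod (f x))\<^sup>2 + 2 * (f x \<bullet> g x) + (cmod (g x))\<^sup>2)"
    using assms square_integrable_inner[OF assms] by (auto simp: square_integrable_def)
  ultimately show ?thesis
    using assms by (auto simp: square_integrable_def)
qed

lemma square_integrable_scaleR:
  "square_integrable f \<Longrightarrow> square_integrable (\<lambda>x. c *\<^sub>R f x)"
  by (auto simp: square_integrable_def power_mult_distrib)

lemma square_integrable_uminus:
  "square_integrable f \<Longrightarrow> square_integrable (\<lambda>x. - f x)"
  by (auto simp: square_integrable_def)

lemma square_integrable_diff:
  "square_integrable f \<Longrightarrow> square_integrable g \<Longrightarrow> square_integrable (\<lambda>x. f x - g x)"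
  using square_integrable_add[OF _ square_integrable_uminus] by fastforce

quotient_type (overloaded) 'a L2 = "'a::haar_group \<Rightarrow> complex" / partial: L2_eq
  morphisms rep_L2 abs_L2
proof (rule part_equivpI)
  show "\<exists>f :: 'a \<Rightarrow> complex. L2_eq f f"
    by (rule exI[of _ "\<lambda>_. 0"]) (simp add: L2_eq_def square_integrable_zero)
  show "symp (L2_eq :: ('a \<Rightarrow> complex) \<Rightarrow> _)"
    by (rule sympI) (auto simp: L2_eq_def elim: eventually_mono)
  show "transp (L2_eq :: ('a \<Rightarrow> complex) \<Rightarrow> _)"
    by (rule transpI) (auto simp: L2_eq_def elim: eventually_elim2)
qed

instantiation L2 :: (haar_group) real_vector
begin

lift_definition zero_L2 :: "'a L2" is "\<lambda>_. 0"
  by (simp add: L2_eq_def square_integrable_zero)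

lift_definition plus_L2 :: "'a L2 \<Rightarrow> 'a L2 \<Rightarrow> 'a L2" is "\<lambda>f g x. f x + g x"
  by (auto simp: L2_eq_def intro: square_integrable_add elim: eventually_elim2)

lift_definition minus_L2 :: "'a L2 \<Rightarrow> 'a L2 \<Rightarrow> 'a L2" is "\<lambda>f g x. f x - g x"
  by (auto simp: L2_eq_def intro: square_integrable_diff elim: eventually_elim2)

lift_definition uminus_L2 :: "'a L2 \<Rightarrow> 'a L2" is "\<lambda>f x. - f x"
  by (auto simp: L2_eq_def intro: square_integrable_uminus elim: eventually_mono)

lift_definition scaleR_L2 :: "real \<Rightarrow> 'a L2 \<Rightarrow> 'a L2" is "\<lambda>c f x. c *\<^sub>R f x"
  by (auto simp: L2_eq_def intro: square_integrable_scaleR elim: eventually_mono)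

instance
proof
  fix f g h :: "'a L2" and a b :: real
  show "f + g + h = f + (g + h)"
    by transfer (auto simp: L2_eq_def add.assoc intro!: square_integrable_add)
  show "f + g = g + f"
    by transfer (auto simp: L2_eq_def add.commute intro!: square_integrable_add)
  show "0 + f = f"
    by transfer (auto simp: L2_eq_def)
  show "- f + f = 0"
    by transfer (auto simp: L2_eq_def square_integrable_zero)
  show "f - g = f + - g"
    by transfer (auto simp: L2_eq_def intro!: square_integrable_diff)
  show "a *\<^sub>R (f + g) = a *\<^sub>R f + a *\<^sub>R g"
    by transfer (auto simp: L2_eq_def scaleR_add_right
        intro!: square_integrable_add square_integrable_scaleR)
  show "(a + b) *\<^sub>R f = a *\<^sub>R f + b *\<^sub>R f"
    by transfer (auto simp: L2_eq_def scaleR_add_left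
        intro!: square_integrable_add square_integrable_scaleR)
  show "a *\<^sub>R b *\<^sub>R f = (a * b) *\<^sub>R f"
    by transfer (auto simp: L2_eq_def intro: square_integrable_scaleR)
  show "1 *\<^sub>R f = f"
    by transfer (auto simp: L2_eq_def)
qed

end

text \<open>
  The real inner product below is the real part of the complex one (\<open>z \<bullet> w = Re (z * cnj w)\<close> on
  \<^typ>\<open>complex\<close>) and induces the usual norm of $L^2(G)$.
\<close>

instantiation L2 :: (haar_group) real_inner
begin

lift_definition inner_L2 :: "'a L2 \<Rightarrow> 'a L2 \<Rightarrow> real" is "\<lambda>f g. LINT x|haar. f x \<bullet> g x"
  by (rule integral_cong_AE)
    (auto simp: L2_eq_def borel_measurable_haar square_integrable_def elim: eventually_elim2)

lift_definition norm_L2 :: "'a L2 \<Rightarrow> real" is "\<lambda>f. sqrt (LINT x|haar. (cmod (f x))\<^sup>2)"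
  by (rule arg_cong[where f = sqrt], rule integral_cong_AE)
    (auto simp: L2_eq_def borel_measurable_haar square_integrable_def elim: eventually_mono)

definition sgn_L2 :: "'a L2 \<Rightarrow> 'a L2" where "sgn_L2 f = f /\<^sub>R norm f"
definition dist_L2 :: "'a L2 \<Rightarrow> 'a L2 \<Rightarrow> real" where "dist_L2 f g = norm (f - g)"
definition uniformity_L2 :: "('a L2 \<times> 'a L2) filter" where
  "uniformity_L2 = (INF e\<in>{0<..}. principal {(x, y). dist x y < e})"
definition open_L2 :: "'a L2 set \<Rightarrow> bool" where
  "open_L2 U \<longleftrightarrow> (\<forall>x\<in>U. \<forall>\<^sub>F (x', y) in uniformity. x' = x \<longrightarrow> y \<in> U)"

instance
proof
  fix f g h :: "'a L2" and a :: real
  show "dist f g = norm (f - g)" by (rule dist_L2_def)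
  show "sgn f = f /\<^sub>R norm f" by (rule sgn_L2_def)
  show "(uniformity :: ('a L2 \<times> 'a L2) filter) = (INF e\<in>{0<..}. principal {(x, y). dist x y < e})"
    by (rule uniformity_L2_def)
  show "open U \<longleftrightarrow> (\<forall>x\<in>U. \<forall>\<^sub>F (x', y) in uniformity. x' = x \<longrightarrow> y \<in> U)" for U :: "'a L2 set"
    by (rule open_L2_def)
  show "f \<bullet> g = g \<bullet> f"
    by transfer (simp add: inner_commute)
  show "(f + g) \<bullet> h = f \<bullet> h + g \<bullet> h"
    by transfer (auto simp: L2_eq_def inner_add_left square_integrable_inner)
  show "(a *\<^sub>R f) \<bullet> g = a * (f \<bullet> g)"
    by transfer simp
  show "0 \<le> f \<bullet> f"
    by transfer simp
  show "f \<bullet> f = 0 \<longleftrightarrow> f = 0"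
  proof transfer
    fix f :: "'a \<Rightarrow> complex" assume "L2_eq f f"
    then have f: "square_integrable f" by (simp add: L2_eq_def)
    have "(LINT x|haar. f x \<bullet> f x) = 0 \<longleftrightarrow> (AE x in haar. f x \<bullet> f x = 0)"
      using square_integrable_inner[OF f f] by (subst integral_nonneg_eq_0_iff_AE) auto
    then show "(LINT x|haar. f x \<bullet> f x) = 0 \<longleftrightarrow> L2_eq f (\<lambda>_. 0)"
      using f by (simp add: L2_eq_def square_integrable_zero)
  qed
  show "norm f = sqrt (f \<bullet> f)"
    by transfer (simp add: power2_norm_eq_inner)
qed

end

section \<open>The measure algebra $M(G)$\<close>

text \<open>
  A complex Borel measure is a countably additive function on the Borel sets; it is set to \<open>0\<close> off
  the Borel sets so that equality of functions is equality of measures.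
\<close>

definition complex_measures :: "('a::topological_space set \<Rightarrow> complex) set" where
  "complex_measures = {\<mu>.
     (\<forall>A :: nat \<Rightarrow> 'a set. range A \<subseteq> sets borel \<longrightarrow> disjoint_family A \<longrightarrow>
        (\<lambda>n. \<mu> (A n)) sums \<mu> (\<Union>n. A n)) \<and>
     (\<forall>A. A \<notin> sets borel \<longrightarrow> \<mu> A = 0)}"

text \<open>The complement of the largest open set all of whose Borel subsets are \<open>\<mu>\<close>-null.\<close>

definition measure_support :: "('a::topological_space set \<Rightarrow> complex) \<Rightarrow> 'a set" where
  "measure_support \<mu> = - \<Union>{U. open U \<and> (\<forall>A\<in>sets borel. A \<subseteq> U \<longrightarrow> \<mu> A = 0)}"

definition measures_on :: "'a::topological_space set \<Rightarrow> ('a set \<Rightarrow> complex) set" where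
  "measures_on E = {\<mu> \<in> complex_measures. measure_support \<mu> \<subseteq> E}"

text \<open>
  The positive part $\nu^+(A) = \sup\{\nu(B) : B \subseteq A\}$ in the Jordan decomposition of a
  finite signed measure; \<open>ennreal\<close> sends negative numbers to \<open>0 = \<nu> {}\<close>.
\<close>

definition pos_part :: "('a::topological_space set \<Rightarrow> real) \<Rightarrow> 'a measure" where
  "pos_part \<nu> = measure_of UNIV (sets borel)
     (\<lambda>A. SUP B\<in>{B \<in> sets borel. B \<subseteq> A}. ennreal (\<nu> B))"

definition complex_integral ::
  "('a::topological_space set \<Rightarrow> complex) \<Rightarrow> ('a \<Rightarrow> complex) \<Rightarrow> complex" where
  "complex_integral \<mu> f =
     ((LINT x|pos_part (\<lambda>A. Re (\<mu> A)). f x) - (LINT x|pos_part (\<lambda>A. - Re (\<mu> A)). f x))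
     + \<i> * ((LINT x|pos_part (\<lambda>A. Im (\<mu> A)). f x) - (LINT x|pos_part (\<lambda>A. - Im (\<mu> A)). f x))"

definition L1_measure :: "('a::haar_group \<Rightarrow> complex) \<Rightarrow> 'a set \<Rightarrow> complex" where
  "L1_measure f A = (if A \<in> sets borel then (LINT x:A|haar. f x) else 0)"

section \<open>The reduced group C*-algebra and sets of extended uniqueness\<close>

text \<open>
  The operator \<open>\<lambda>(\<mu>)\<close>. For \<open>\<mu>\<close> a complex measure the map below does not depend on the
  representative of \<open>\<xi>\<close> and is linear and bounded (by the total variation of \<open>\<mu>\<close>), so that
  \<^const>\<open>Blinfun\<close> merely changes its type. The type \<open>'a L2 \<Rightarrow>\<^sub>L 'a L2\<close> consists of the
  bounded real-linear operators; its norm is the operator norm, and as the complex-linear operators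
  are closed in it, norm closures of sets of complex-linear operators are the usual ones.
\<close>

definition lambda_op :: "('a::haar_group set \<Rightarrow> complex) \<Rightarrow> 'a L2 \<Rightarrow>\<^sub>L 'a L2" where
  "lambda_op \<mu> =
     Blinfun (\<lambda>\<xi>. abs_L2 (\<lambda>g. complex_integral \<mu> (\<lambda>s. rep_L2 \<xi> (- s + g))))"

definition reduced_group_algebra :: "('a::haar_group L2 \<Rightarrow>\<^sub>L 'a L2) set" where
  "reduced_group_algebra = closure {lambda_op (L1_measure f) | f. f \<in> borel_measurable borel \<and> integrable haar f}"

definition extended_uniqueness :: "'a::haar_group set \<Rightarrow> bool" where
  "extended_uniqueness E \<longleftrightarrow>
     closed E \<and> lambda_op ` measures_on E \<inter> reduced_group_algebra = {0}"

definition U0 :: "'a::haar_group set set" where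
  "U0 = {E. extended_uniqueness E}"

section \<open>The hyperspace of closed sets and coanalytic sets\<close>

text \<open>
  The sets \<open>{F. F \<inter> K = {}}\<close> are closed under finite intersections (unite the compact sets), so this
  subbase generates the usual base of the Fell topology. For second countable locally compact
  Hausdorff spaces its Borel sets form the Effros Borel structure.
\<close>

definition fell_topology :: "'a::topological_space set topology" where
  "fell_topology = topology_generated_by
     ({{F. closed F \<and> F \<inter> K = {}} | K. compact K} \<union>
      {{F. closed F \<and> F \<inter> U \<noteq> {}} | U. open U})"

lemma topspace_fell_topology: "topspace fell_topology = {F. closed F}"
proof -
  have "{F :: 'a set. closed F} \<in> {{F. closed F \<and> F \<inter> K = {}} | K. compact K}"
    by (intro CollectI exI[of _ "{}"]) simp
  then show ?thesis
    unfolding fell_topology_def topology_generated_by_topspace by blast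
qed

definition borel_sets_of :: "'x topology \<Rightarrow> 'x set set" where
  "borel_sets_of X = sigma_sets (topspace X) {U. openin X U}"

definition Polish_space :: "'x topology \<Rightarrow> bool" where
  "Polish_space X \<longleftrightarrow> completely_metrizable_space X \<and> separable_space X"

text \<open>
  The auxiliary space \<open>Y\<close> is an arbitrary Polish topology on an arbitrary subset of the type
  \<^typ>\<open>nat \<Rightarrow> real\<close>. Since Polish spaces have at most continuum many points, each of them is
  homeomorphic to such a \<open>Y\<close>; HOL cannot quantify over the type of points of \<open>Y\<close> itself.
\<close>

definition analytic_in :: "'x topology \<Rightarrow> 'x set \<Rightarrow> bool" where
  "analytic_in X A \<longleftrightarrow>
     (\<exists>(Y :: (nat \<Rightarrow> real) topology) B. Polish_space Y \<and>
        B \<in> borel_sets_of (prod_topology X Y) \<and> A = fst ` B)"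

definition coanalytic_in :: "'x topology \<Rightarrow> 'x set \<Rightarrow> bool" where
  "coanalytic_in X A \<longleftrightarrow> A \<subseteq> topspace X \<and> analytic_in X (topspace X - A)"

end

theory Submission
  imports Defs "HOL-Probability.Giry_Monad"
begin

text \<open>
  A closed set \<open>E\<close> is not of extended uniqueness iff some complex measure \<open>\<mu>\<close> supported on \<open>E\<close> has
  a nonzero operator \<open>\<lambda>(\<mu>)\<close> in the reduced group algebra. Up to a positive factor, \<open>\<mu>\<close> is a
  combination of four subprobability measures, and each of these is coded by its values on a
  countable algebra generated by compact sets whose unions exhaust the open sets; the sequences
  that arise in this way form a Borel set, and the coded measure depends measurably on the sequence.
  For a code of \<open>\<mu>\<close> all conditions are Borel. The support condition says that \<open>\<mu>\<close> is null on every
  generator disjoint from \<open>E\<close>. The operator \<open>\<lambda>(\<mu>)\<close> is determined by its coefficients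
  \<open>\<integral> \<langle>\<lambda>\<^sub>s \<xi>, \<eta>\<rangle> d\<mu>(s)\<close>, so separability of $L^2(G)$ and of the reduced group algebra
  turns membership in the latter into countably many inequalities between coefficients. Hence the
  complement of \<open>U0\<close> is the projection of a Borel set.
\<close>

section \<open>Jordan decomposition of finite signed measures\<close>

text \<open>Membership in the norm closure \<open>reduced_group_algebra\<close> is not a condition
  on finitely many values of a measure. It becomes countable because the distance to an operator is
  tested by coefficients over a dense sequence of vectors, and coefficients are integrals against
  the coded measures. Compactness of the generators serves three ends. Missing a compact set is an
  open condition in the Fell topology, so the support condition is Borel jointly in the closed set
  and the code; compact inner approximation is what a coded set function needs in order to be a
  measure; and compact sets have finite Haar measure, which gives sigma-finiteness and the dense
  families. Codes are real sequences because \<open>analytic_in\<close> takes its auxiliary space on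
  \<open>nat \<Rightarrow> real\<close>. Mass at most 1 lets the measurability results for the Giry
  monad apply; rescaling is harmless because the reduced algebra is a linear subspace. Coefficients
  depend only on differences of the four parts, so the parts of a code may be arbitrary and need not
  be mutually singular.\<close>

text \<open>\<open>ennreal\<close> clips negative summands to 0, so cancellation can only lower the
  left side.\<close>

lemma ennreal_sum_le: "ennreal (\<Sum>i\<in>I. f i) \<le> (\<Sum>i\<in>I. ennreal (f i))"
proof (induction I rule: infinite_finite_induct)
  case (insert x I)
  have "ennreal (f x + sum f I) \<le> ennreal (f x) + ennreal (sum f I)"
    by (cases "f x \<ge> 0"; cases "sum f I \<ge> 0")
      (auto simp: ennreal_plus[symmetric] ennreal_neg simp del: ennreal_plus intro!: ennreal_leI)
  with insert show ?case by (auto intro: order_trans add_left_mono)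
qed auto

text \<open>Only real-valued countable additivity is required; that the values are bounded, and
  hence that \<open>pos_part\<close> is finite, is proved in \<open>bounded\<close>.\<close>

locale finite_signed_measure =
  fixes \<nu> :: "'a::topological_space set \<Rightarrow> real"
  assumes countable_sums: "\<And>A :: nat \<Rightarrow> 'a set. range A \<subseteq> sets borel \<Longrightarrow> disjoint_family A \<Longrightarrow>
    (\<lambda>n. \<nu> (A n)) sums \<nu> (\<Union>n. A n)"
begin

lemma empty [simp]: "\<nu> {} = 0"
proof -
  have "(\<lambda>n::nat. \<nu> {}) sums \<nu> {}"
    using countable_sums[of "\<lambda>_. {}"] by (auto simp: disjoint_family_on_def)
  then show ?thesis
    using sums_summable summable_const_iff by blast
qed

lemma Un:
  assumes "A \<in> sets borel" "B \<in> sets borel" "A \<inter> B = {}"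
  shows "\<nu> (A \<union> B) = \<nu> A + \<nu> B"
proof -
  have "(\<lambda>n. \<nu> (binaryset A B n)) sums \<nu> (\<Union>n. binaryset A B n)"
    using assms by (intro countable_sums)
      (auto simp: range_binaryset_eq disjoint_family_on_def binaryset_def)
  then have "(\<lambda>n. \<nu> (binaryset A B n)) sums \<nu> (A \<union> B)"
    by (simp add: UN_binaryset_eq)
  with binaryset_sums[of \<nu> A B] show ?thesis
    using sums_unique2 by fastforce
qed

lemma Diff:
  assumes "A \<in> sets borel" "B \<in> sets borel" "B \<subseteq> A"
  shows "\<nu> (A - B) = \<nu> A - \<nu> B"
proof -
  have "(A - B) \<inter> B = {}" "(A - B) \<union> B = A" using assms by auto
  with Un[of "A - B" B] assms show ?thesis by simp
qed

definition unbounded_on :: "'a set \<Rightarrow> bool" where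
  "unbounded_on A \<longleftrightarrow> (\<forall>C. \<exists>B\<in>sets borel. B \<subseteq> A \<and> \<bar>\<nu> B\<bar> > C)"

lemma unbounded_on_Un:
  assumes "unbounded_on (A \<union> B)" "A \<in> sets borel" "B \<in> sets borel" "A \<inter> B = {}"
  shows "unbounded_on A \<or> unbounded_on B"
proof (rule ccontr)
  assume "\<not> ?thesis"
  then obtain C D where C: "\<And>S. S \<in> sets borel \<Longrightarrow> S \<subseteq> A \<Longrightarrow> \<bar>\<nu> S\<bar> \<le> C"
    and D: "\<And>S. S \<in> sets borel \<Longrightarrow> S \<subseteq> B \<Longrightarrow> \<bar>\<nu> S\<bar> \<le> D"
    unfolding unbounded_on_def by (meson not_less)
  obtain S where S: "S \<in> sets borel" "S \<subseteq> A \<union> B" "\<bar>\<nu> S\<bar> > C + D"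
    using assms(1) unfolding unbounded_on_def by blast
  have "\<nu> S = \<nu> (S \<inter> A) + \<nu> (S \<inter> B)"
  proof -
    have "S = (S \<inter> A) \<union> (S \<inter> B)" using S by blast
    moreover have "(S \<inter> A) \<inter> (S \<inter> B) = {}" using assms(4) by blast
    ultimately show ?thesis
      using Un[of "S \<inter> A" "S \<inter> B"] S(1) assms(2,3) by (metis sets.Int)
  qed
  moreover have "\<bar>\<nu> (S \<inter> A)\<bar> \<le> C" "\<bar>\<nu> (S \<inter> B)\<bar> \<le> D"
    using S assms by (auto intro!: C D)
  ultimately show False using S(3) by linarith
qed

text \<open>A subset whose mass exceeds that of \<open>A\<close> by more than 1 in absolute value
  leaves a complement of mass at least 1 as well. One of the two halves is still unbounded; that one
  is kept and the other split off.\<close>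

lemma unbounded_on_split:
  assumes "unbounded_on A" "A \<in> sets borel"
  shows "\<exists>B\<in>sets borel. B \<subseteq> A \<and> unbounded_on B \<and> \<bar>\<nu> (A - B)\<bar> \<ge> 1"
proof -
  obtain B where B: "B \<in> sets borel" "B \<subseteq> A" "\<bar>\<nu> B\<bar> > \<bar>\<nu> A\<bar> + 1"
    using assms unfolding unbounded_on_def by blast
  have 1: "\<bar>\<nu> (A - B)\<bar> \<ge> 1"
    using Diff[OF assms(2) B(1,2)] B(3) by linarith
  have 2: "A - (A - B) = B" "B \<union> (A - B) = A" using B(2) by auto
  have "unbounded_on B \<or> unbounded_on (A - B)"
    using unbounded_on_Un[of B "A - B"] B(1) assms unfolding 2 by simp
  then show ?thesis
  proof
    assume "unbounded_on B"
    with 1 B show ?thesis by blast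
  next
    assume "unbounded_on (A - B)"
    moreover have "\<bar>\<nu> (A - (A - B))\<bar> \<ge> 1" unfolding 2 using B(3) by linarith
    ultimately show ?thesis using assms(2) B(1) by (intro bexI[of _ "A - B"]) auto
  qed
qed

text \<open>Otherwise splitting repeatedly yields disjoint sets of mass at least 1 in absolute value.\<close>

lemma bounded: "\<exists>C. \<forall>B\<in>sets borel. \<bar>\<nu> B\<bar> \<le> C"
proof (rule ccontr)
  assume "\<not> ?thesis"
  then have "unbounded_on UNIV"
    by (auto simp: unbounded_on_def not_le)
  then have "\<exists>A. A \<in> sets borel \<and> unbounded_on A"
    by (intro exI[of _ UNIV]) simp
  then have "\<exists>A. \<forall>n. (A n \<in> sets borel \<and> unbounded_on (A n)) \<and>
      (A (Suc n) \<subseteq> A n \<and> \<bar>\<nu> (A n - A (Suc n))\<bar> \<ge> 1)"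
    by (rule dependent_nat_choice[where P = "\<lambda>_ A. A \<in> sets borel \<and> unbounded_on A"
        and Q = "\<lambda>_ A B. B \<subseteq> A \<and> \<bar>\<nu> (A - B)\<bar> \<ge> 1"]) (use unbounded_on_split in blast)
  then obtain A where A: "\<And>n::nat. A n \<in> sets borel \<and> unbounded_on (A n)"
      "\<And>n. A (Suc n) \<subseteq> A n \<and> \<bar>\<nu> (A n - A (Suc n))\<bar> \<ge> 1"
    by blast
  define E where "E n = A n - A (Suc n)" for n
  have "decseq A" using A(2) by (intro decseq_SucI) blast
  then have mono: "A n \<subseteq> A m" if "m \<le> n" for m n
    using that by (rule decseqD)
  have "disjoint_family E"
    unfolding disjoint_family_on_def
  proof (intro ballI impI)
    fix m n :: nat assume "m \<noteq> n"
    then consider "Suc m \<le> n" | "Suc n \<le> m" by linarith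
    then show "E m \<inter> E n = {}"
      using mono[of "Suc m" n] mono[of "Suc n" m] by cases (auto simp: E_def)
  qed
  moreover have "range E \<subseteq> sets borel" using A(1) unfolding E_def by blast
  ultimately have "(\<lambda>n. \<nu> (E n)) \<longlonglongrightarrow> 0"
    using countable_sums sums_summable summable_LIMSEQ_zero by blast
  then have "\<forall>\<^sub>F n in sequentially. \<bar>\<nu> (E n)\<bar> < 1"
    by (simp add: tendsto_iff dist_real_def)
  then obtain n where "\<bar>\<nu> (E n)\<bar> < 1"
    unfolding eventually_sequentially by blast
  then show False
    using A(2)[of n] by (simp add: E_def)
qed

text \<open>The set function inside \<open>pos_part\<close>. It is shown to be a measure directly
  from the supremum, without a Hahn decomposition.\<close>

definition upper :: "'a set \<Rightarrow> ennreal" where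
  "upper A = (SUP B\<in>{B \<in> sets borel. B \<subseteq> A}. ennreal (\<nu> B))"

lemma upper_ge: "B \<in> sets borel \<Longrightarrow> B \<subseteq> A \<Longrightarrow> ennreal (\<nu> B) \<le> upper A"
  unfolding upper_def by (rule SUP_upper) auto

lemma upper_le: "(\<And>B. B \<in> sets borel \<Longrightarrow> B \<subseteq> A \<Longrightarrow> ennreal (\<nu> B) \<le> c) \<Longrightarrow> upper A \<le> c"
  unfolding upper_def by (rule SUP_least) auto

lemma upper_mono: "A \<subseteq> B \<Longrightarrow> upper A \<le> upper B"
  by (rule upper_le) (auto intro: upper_ge)

lemma upper_empty [simp]: "upper {} = 0"
  using upper_le[of "{}" 0] by (auto simp: bot_unique)

lemma upper_finite: "upper A < \<infinity>"
proof -
  obtain C where "\<And>B. B \<in> sets borel \<Longrightarrow> \<bar>\<nu> B\<bar> \<le> C" using bounded by blast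
  then have "upper A \<le> ennreal C"
    by (intro upper_le ennreal_leI) fastforce
  then show ?thesis
    using le_less_trans[OF _ ennreal_less_top] by (simp add: infinity_ennreal_def)
qed

lemma upper_Un_ge:
  assumes "A \<in> sets borel" "B \<in> sets borel" "A \<inter> B = {}"
  shows "upper A + upper B \<le> upper (A \<union> B)"
proof -
  have *: "ennreal (\<nu> S) + ennreal (\<nu> T) \<le> upper (A \<union> B)"
    if S: "S \<in> sets borel" "S \<subseteq> A" and T: "T \<in> sets borel" "T \<subseteq> B" for S T
  proof -
    \<comment> \<open>\<open>ennreal\<close> is additive only on nonnegative reals. If one value is
      negative, it is clipped to 0 and the other set alone is a competitor.\<close>
    consider "\<nu> S < 0" | "\<nu> T < 0" | "\<nu> S \<ge> 0" "\<nu> T \<ge> 0" by linarith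
    then show ?thesis
    proof cases
      case 1 then show ?thesis using upper_ge[of T "A \<union> B"] T by (auto simp: ennreal_neg)
    next
      case 2 then show ?thesis using upper_ge[of S "A \<union> B"] S by (auto simp: ennreal_neg)
    next
      case 3
      then have "ennreal (\<nu> S) + ennreal (\<nu> T) = ennreal (\<nu> (S \<union> T))"
        using Un[of S T] S T assms by (subst Un) (auto simp: ennreal_plus)
      also have "\<dots> \<le> upper (A \<union> B)" using S T by (intro upper_ge) auto
      finally show ?thesis .
    qed
  qed
  have ne: "{S \<in> sets borel. S \<subseteq> A} \<noteq> {}" "{S \<in> sets borel. S \<subseteq> B} \<noteq> {}" by auto
  have "ennreal (\<nu> S) + upper B \<le> upper (A \<union> B)" if S: "S \<in> sets borel" "S \<subseteq> A" for S
    unfolding upper_def[of B] ennreal_SUP_add_right[OF ne(2)]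
    by (rule SUP_least) (use * S in auto)
  then show ?thesis
    unfolding upper_def[of A] ennreal_SUP_add_left[OF ne(1), symmetric]
    by (intro SUP_least) auto
qed

text \<open>Superadditivity on finite unions gives one inequality. For the other, a competitor
  \<open>B\<close> is cut along the \<open>A i\<close>, and \<open>ennreal_sum_le\<close> compares
  its signed partial sums with the clipped ones.\<close>

lemma measure_space_upper: "measure_space UNIV (sets borel) upper"
  unfolding measure_space_def
proof (intro conjI)
  show "sigma_algebra UNIV (sets (borel :: 'a measure))"
    using sets.sigma_algebra_axioms[of "borel :: 'a measure"] by simp
  show "positive (sets borel) upper" by (simp add: positive_def)
  show "countably_additive (sets borel) upper"
  proof (rule countably_additiveI)
    fix A :: "nat \<Rightarrow> 'a set"
    assume A: "range A \<subseteq> sets borel" "disjoint_family A" "(\<Union>i. A i) \<in> sets borel"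
    show "(\<Sum>i. upper (A i)) = upper (\<Union>i. A i)"
    proof (rule antisym)
      have "(\<Sum>i<n. upper (A i)) \<le> upper (\<Union>i<n. A i)" for n
      proof (induction n)
        case (Suc n)
        have "A i \<inter> A n = {}" if "i < n" for i
          using disjoint_family_onD[OF A(2), of i n] that by simp
        then have "(\<Union>i<n. A i) \<inter> A n = {}" by blast
        then have "upper (\<Union>i<n. A i) + upper (A n) \<le> upper ((\<Union>i<n. A i) \<union> A n)"
          using A(1) by (intro upper_Un_ge) auto
        moreover have "(\<Union>i<Suc n. A i) = (\<Union>i<n. A i) \<union> A n"
          by (auto simp: less_Suc_eq)
        moreover have "(\<Sum>i<Suc n. upper (A i)) \<le> upper (\<Union>i<n. A i) + upper (A n)"
          using Suc by (simp add: add_right_mono)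
        ultimately show ?case by (metis order_trans)
      qed simp
      also have "upper (\<Union>i<n. A i) \<le> upper (\<Union>i. A i)" for n by (rule upper_mono) auto
      finally show "(\<Sum>i. upper (A i)) \<le> upper (\<Union>i. A i)"
        by (intro suminf_le_const) auto
    next
      show "upper (\<Union>i. A i) \<le> (\<Sum>i. upper (A i))"
      proof (rule upper_le)
        fix B assume B: "B \<in> sets borel" "B \<subseteq> (\<Union>i. A i)"
        have "(\<lambda>n. \<nu> (B \<inter> A n)) sums \<nu> (\<Union>n. B \<inter> A n)"
          using A B by (intro countable_sums) (auto simp: disjoint_family_on_def)
        moreover have "(\<Union>n. B \<inter> A n) = B" using B by auto
        ultimately have "(\<lambda>n. ennreal (\<Sum>i<n. \<nu> (B \<inter> A i))) \<longlonglongrightarrow> ennreal (\<nu> B)"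
          by (simp add: sums_def tendsto_ennrealI)
        moreover have "ennreal (\<Sum>i<n. \<nu> (B \<inter> A i)) \<le> (\<Sum>i. upper (A i))" for n
        proof -
          have "ennreal (\<Sum>i<n. \<nu> (B \<inter> A i)) \<le> (\<Sum>i<n. ennreal (\<nu> (B \<inter> A i)))"
            by (rule ennreal_sum_le)
          also have "\<dots> \<le> (\<Sum>i<n. upper (A i))"
            using A B by (intro sum_mono upper_ge) auto
          also have "\<dots> \<le> (\<Sum>i. upper (A i))"
            by (rule sum_le_suminf) auto
          finally show ?thesis .
        qed
        ultimately show "ennreal (\<nu> B) \<le> (\<Sum>i. upper (A i))"
          by (intro LIMSEQ_le_const2) auto
      qed
    qed
  qed
qed

lemma emeasure_pos_part: "A \<in> sets borel \<Longrightarrow> emeasure (pos_part \<nu>) A = upper A"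
  unfolding pos_part_def
  using measure_space_upper
  by (subst emeasure_measure_of_sigma)
    (auto simp: measure_space_def upper_def[abs_def])

end

lemma sets_pos_part [simp, measurable_cong]: "sets (pos_part \<nu>) = sets borel"
  using sets.sigma_sets_eq[of "borel :: 'a measure"] unfolding pos_part_def
  by (subst sets_measure_of) auto

lemma space_pos_part [simp]: "space (pos_part \<nu>) = UNIV"
  using sets_eq_imp_space_eq[OF sets_pos_part] by simp

context finite_signed_measure
begin

lemma finite_measure_pos_part: "finite_measure (pos_part \<nu>)"
  using upper_finite[of UNIV] by (intro finite_measureI) (simp add: emeasure_pos_part)

text \<open>For a competitor \<open>B\<close>, \<nu>(B) = \<nu>(A) - \<nu>(A - B) is at most
  \<nu>(A) plus the negative part of \<open>A\<close>. The supremum over \<open>B\<close> gives one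
  inequality, and the same argument for - \<nu> the other.\<close>

lemma measure_pos_part_minus:
  assumes A: "A \<in> sets borel" and "finite_signed_measure (\<lambda>B. - \<nu> B)"
  shows "\<nu> A = measure (pos_part \<nu>) A - measure (pos_part (\<lambda>B. - \<nu> B)) A"
proof -
  interpret neg: finite_signed_measure "\<lambda>B. - \<nu> B" by fact
  interpret p: finite_measure "pos_part \<nu>" by (rule finite_measure_pos_part)
  interpret n: finite_measure "pos_part (\<lambda>B. - \<nu> B)" by (rule neg.finite_measure_pos_part)
  have p: "\<nu> B \<le> measure (pos_part \<nu>) A" if "B \<in> sets borel" "B \<subseteq> A" for B
    using upper_ge[OF that] A by (simp add: emeasure_pos_part[symmetric] p.emeasure_eq_measure)
  have n: "- \<nu> B \<le> measure (pos_part (\<lambda>B. - \<nu> B)) A" if "B \<in> sets borel" "B \<subseteq> A" for B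
    using neg.upper_ge[OF that] A by (simp add: neg.emeasure_pos_part[symmetric] n.emeasure_eq_measure)
  have "upper A \<le> ennreal (\<nu> A + measure (pos_part (\<lambda>B. - \<nu> B)) A)"
    using n[of "A - _"] A by (intro upper_le ennreal_leI) (force simp: Diff)
  moreover have "0 \<le> \<nu> A + measure (pos_part (\<lambda>B. - \<nu> B)) A" using n[of A] A by simp
  ultimately have 1: "measure (pos_part \<nu>) A \<le> \<nu> A + measure (pos_part (\<lambda>B. - \<nu> B)) A"
    using A by (simp add: emeasure_pos_part[symmetric] p.emeasure_eq_measure)
  have "neg.upper A \<le> ennreal (- \<nu> A + measure (pos_part \<nu>) A)"
    using p[of "A - _"] A by (intro neg.upper_le ennreal_leI) (force simp: Diff)
  moreover have "0 \<le> - \<nu> A + measure (pos_part \<nu>) A" using p[of A] A by simp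
  ultimately have 2: "measure (pos_part (\<lambda>B. - \<nu> B)) A \<le> - \<nu> A + measure (pos_part \<nu>) A"
    using A by (simp add: neg.emeasure_pos_part[symmetric] n.emeasure_eq_measure)
  from 1 2 show ?thesis by linarith
qed

end

lemma finite_signed_measure_uminus:
  "finite_signed_measure \<nu> \<Longrightarrow> finite_signed_measure (\<lambda>A. - \<nu> A)"
  unfolding finite_signed_measure_def by (auto intro: sums_minus)

lemma finite_signed_measure_Re: "\<mu> \<in> complex_measures \<Longrightarrow> finite_signed_measure (\<lambda>A. Re (\<mu> A))"
  by (auto simp: finite_signed_measure_def complex_measures_def intro: sums_Re)

lemma finite_signed_measure_Im: "\<mu> \<in> complex_measures \<Longrightarrow> finite_signed_measure (\<lambda>A. Im (\<mu> A))"
  by (auto simp: finite_signed_measure_def complex_measures_def intro: sums_Im)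

lemma pos_part_null:
  assumes "finite_signed_measure \<nu>" "U \<in> sets borel" "\<And>B. B \<in> sets borel \<Longrightarrow> B \<subseteq> U \<Longrightarrow> \<nu> B = 0"
  shows "emeasure (pos_part \<nu>) U = 0"
proof -
  interpret finite_signed_measure \<nu> by fact
  have "upper U \<le> 0" using assms(3) by (intro upper_le) auto
  then show ?thesis using assms by (simp add: emeasure_pos_part)
qed

text \<open>The four parts of a complex measure may be chosen freely, as long as they recombine to it.\<close>

definition complex_combination ::
    "'a measure \<Rightarrow> 'a measure \<Rightarrow> 'a measure \<Rightarrow> 'a measure \<Rightarrow> 'a::topological_space set \<Rightarrow> complex" where
  "complex_combination m0 m1 m2 m3 A = (if A \<in> sets borel
     then Complex (measure m0 A - measure m1 A) (measure m2 A - measure m3 A) else 0)"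

definition finite_borel :: "'a::topological_space measure \<Rightarrow> bool" where
  "finite_borel m \<longleftrightarrow> finite_measure m \<and> sets m = sets borel"

lemma finite_borel_sets: "finite_borel m \<Longrightarrow> sets m = sets borel"
  by (simp add: finite_borel_def)

lemma finite_borel_space: "finite_borel m \<Longrightarrow> space m = UNIV"
  using sets_eq_imp_space_eq[of m borel] by (simp add: finite_borel_def)

lemma complex_combination_measure:
  assumes "finite_borel m0" "finite_borel m1" "finite_borel m2" "finite_borel m3"
  shows "complex_combination m0 m1 m2 m3 \<in> complex_measures"
proof -
  have s: "(\<lambda>n. measure m (A n)) sums measure m (\<Union>n. A n)"
    if "finite_borel m" "range A \<subseteq> sets borel" "disjoint_family A" for m and A :: "nat \<Rightarrow> 'a set"
    using that finite_measure.finite_measure_UNION[of m A] by (auto simp: finite_borel_def)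
  show ?thesis
    unfolding complex_measures_def
  proof (intro CollectI conjI allI impI)
    fix A :: "nat \<Rightarrow> 'a set" assume A: "range A \<subseteq> sets borel" "disjoint_family A"
    then have "A n \<in> sets borel" for n by auto
    moreover from this have "(\<Union>n. A n) \<in> sets borel" by auto
    ultimately show "(\<lambda>n. complex_combination m0 m1 m2 m3 (A n)) sums
        complex_combination m0 m1 m2 m3 (\<Union>n. A n)"
      using assms A by (auto simp: complex_combination_def sums_complex_iff intro!: sums_diff s)
  qed (simp add: complex_combination_def)
qed

lemma complex_combination_pos_part:
  assumes "\<mu> \<in> complex_measures"
  shows "complex_combination (pos_part (\<lambda>A. Re (\<mu> A))) (pos_part (\<lambda>A. - Re (\<mu> A)))
    (pos_part (\<lambda>A. Im (\<mu> A))) (pos_part (\<lambda>A. - Im (\<mu> A))) = \<mu>"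
proof
  fix A
  show "complex_combination (pos_part (\<lambda>A. Re (\<mu> A))) (pos_part (\<lambda>A. - Re (\<mu> A)))
    (pos_part (\<lambda>A. Im (\<mu> A))) (pos_part (\<lambda>A. - Im (\<mu> A))) A = \<mu> A"
    using assms finite_signed_measure.measure_pos_part_minus[OF finite_signed_measure_Re[OF assms] _
        finite_signed_measure_uminus[OF finite_signed_measure_Re[OF assms]], of A]
      finite_signed_measure.measure_pos_part_minus[OF finite_signed_measure_Im[OF assms] _
        finite_signed_measure_uminus[OF finite_signed_measure_Im[OF assms]], of A]
    by (auto simp: complex_combination_def complex_eq_iff complex_measures_def)
qed

lemma finite_borel_pos_part: "finite_signed_measure \<nu> \<Longrightarrow> finite_borel (pos_part \<nu>)"
  by (simp add: finite_borel_def finite_signed_measure.finite_measure_pos_part)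

section \<open>Convolution operators and their coefficients\<close>

text \<open>The Jordan parts of a combination need not be the measures it was built from; only the
  differences agree. Simple functions reduce the claim to those differences, and boundedness of
  \<phi> permits dominated convergence for finite measures.\<close>

lemma integral_complex_combination_unique:
  fixes \<phi> :: "'a::topological_space \<Rightarrow> real"
  assumes fin: "finite_borel a" "finite_borel b" "finite_borel c" "finite_borel d"
    and eq: "\<And>A. A \<in> sets borel \<Longrightarrow> measure a A - measure b A = measure c A - measure d A"
    and \<phi>: "\<phi> \<in> borel_measurable borel" "\<And>x. \<bar>\<phi> x\<bar> \<le> C"
  shows "(LINT x|a. \<phi> x) - (LINT x|b. \<phi> x) = (LINT x|c. \<phi> x) - (LINT x|d. \<phi> x)"
proof -
  \<comment> \<open>The approximants are bounded by twice the distance of \<phi> from 0, whence the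
    dominating constant \<open>2 * C\<close>.\<close>
  obtain F where F: "\<And>i. simple_function borel (F i)" "\<And>x. (\<lambda>i. F i x) \<longlonglongrightarrow> \<phi> x"
      "\<And>i x. \<bar>F i x\<bar> \<le> 2 * \<bar>\<phi> x\<bar>"
    using borel_measurable_implies_sequence_metric[OF \<phi>(1), of 0] by (auto simp: dist_real_def)
  have bound: "\<bar>F i x\<bar> \<le> 2 * C" for i x
    using F(3)[of i x] \<phi>(2)[of x] by linarith
  have lim: "(\<lambda>i. LINT x|m. F i x) \<longlonglongrightarrow> (LINT x|m. \<phi> x)" if "finite_borel m" for m
  proof -
    interpret finite_measure m using that by (simp add: finite_borel_def)
    have [measurable_cong]: "sets m = sets borel" using that by (simp add: finite_borel_def)
    have [measurable]: "F i \<in> borel_measurable borel" for i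
      using F(1) by (rule borel_measurable_simple_function)
    show ?thesis
      by (rule integral_dominated_convergence[where w = "\<lambda>_. 2 * C"])
        (use F \<phi> bound in \<open>auto simp: integrable_const\<close>)
  qed
  have simple: "(LINT x|m. F i x) = (\<Sum>y\<in>range (F i). y * measure m (F i -` {y}))"
    if m: "finite_borel m" for m i
  proof -
    interpret finite_measure m using m by (simp add: finite_borel_def)
    have s: "sets m = sets borel" and "space m = UNIV"
      using m sets_eq_imp_space_eq[of m borel] by (auto simp: finite_borel_def)
    have fin: "finite (range (F i))" and B: "F i -` {y} \<in> sets m" for y
      using simple_functionD[OF F(1)[of i]] by (simp_all add: s)
    have "F i = (\<lambda>x. \<Sum>y\<in>range (F i). y * indicator (F i -` {y}) x)"
      using fin by (intro ext) (simp add: indicator_def if_distrib[of "(*) _"] sum.delta')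
    then have "(LINT x|m. F i x) = (LINT x|m. (\<Sum>y\<in>range (F i). y * indicator (F i -` {y}) x))"
      by (rule arg_cong)
    also have "\<dots> = (\<Sum>y\<in>range (F i). y * measure m (F i -` {y}))"
      using B by (subst Bochner_Integration.integral_sum) (auto simp: emeasure_finite less_top[symmetric])
    finally show ?thesis .
  qed
  have B: "F i -` {y} \<in> sets borel" for i y
    using F(1)[of i] simple_functionD(2)[of borel "F i" "{y}"] by simp
  have "(LINT x|a. F i x) - (LINT x|b. F i x) = (LINT x|c. F i x) - (LINT x|d. F i x)" for i
    using fin eq[OF B] by (simp add: simple sum_subtractf[symmetric] right_diff_distrib[symmetric])
  moreover have "(\<lambda>i. (LINT x|a. F i x) - (LINT x|b. F i x)) \<longlonglongrightarrow> (LINT x|a. \<phi> x) - (LINT x|b. \<phi> x)"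
    "(\<lambda>i. (LINT x|c. F i x) - (LINT x|d. F i x)) \<longlonglongrightarrow> (LINT x|c. \<phi> x) - (LINT x|d. \<phi> x)"
    using fin by (auto intro!: tendsto_diff lim)
  ultimately show ?thesis
    using LIMSEQ_unique by auto
qed

section \<open>Left translation and multiplication by i on L2\<close>

declare sets_haar [measurable_cong, simp]

lemma space_haar [simp]: "space (haar :: 'a::haar_group measure) = UNIV"
  using sets_eq_imp_space_eq[OF sets_haar] by simp

lemma borel_measurable_plus_left [measurable]:
  "(\<lambda>g. s + g) \<in> borel \<rightarrow>\<^sub>M (borel :: 'a::topological_group_add measure)"
  by (intro borel_measurable_continuous_onI continuous_intros)

lemma distr_haar: "distr haar borel (\<lambda>g. s + g) = (haar :: 'a::haar_group measure)"
proof (rule measure_eqI)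
  fix A assume "A \<in> sets (distr haar borel (\<lambda>g. s + g :: 'a))"
  then have A: "A \<in> sets borel" by simp
  have "(\<lambda>g. s + g) -` A = (\<lambda>g. - s + g) ` A"
    by (force simp: image_iff add.assoc[symmetric])
  moreover have "emeasure haar ((\<lambda>g. - s + g) ` A) = emeasure haar A"
    using haar_left_invariant[OF A] .
  ultimately show "emeasure (distr haar borel (\<lambda>g. s + g)) A = emeasure haar A"
    using A by (subst emeasure_distr) auto
qed simp

lemma nn_integral_haar_translate:
  fixes f :: "'a::haar_group \<Rightarrow> ennreal"
  assumes "f \<in> borel_measurable borel"
  shows "(\<integral>\<^sup>+g. f (s + g) \<partial>haar) = (\<integral>\<^sup>+g. f g \<partial>haar)"
  using nn_integral_distr[of "\<lambda>g. s + g" haar borel f] assms by (simp add: distr_haar)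

lemma AE_haar_translate:
  assumes "AE g in haar. P g" shows "AE g in haar. P (s + g :: 'a::haar_group)"
proof (rule AE_distrD[of "\<lambda>g. s + g" haar borel P])
  show "(\<lambda>g. s + g) \<in> haar \<rightarrow>\<^sub>M (borel :: 'a measure)" by simp
  show "AE g in distr haar borel (\<lambda>g. s + g). P g" unfolding distr_haar by (rule assms)
qed

lemma square_integrable_iff_nn:
  "square_integrable f \<longleftrightarrow> f \<in> borel_measurable borel \<and> (\<integral>\<^sup>+x. ennreal ((cmod (f x))\<^sup>2) \<partial>haar) < \<infinity>"
  by (auto simp: square_integrable_def integrable_iff_bounded)

lemma square_integrable_translate:
  fixes f :: "'a::haar_group \<Rightarrow> complex"
  assumes "square_integrable f" shows "square_integrable (\<lambda>g. f (s + g))"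
proof -
  have [measurable]: "f \<in> borel_measurable borel"
    using assms by (simp add: square_integrable_def)
  show ?thesis
    using assms nn_integral_haar_translate[of "\<lambda>x. ennreal ((cmod (f x))\<^sup>2)" s]
    by (simp add: square_integrable_iff_nn)
qed

text \<open>The operator \<lambda>_s of the left regular representation. It respects almost
  everywhere equality because Haar null sets stay null under left translation.\<close>

lift_definition translate :: "'a::haar_group \<Rightarrow> 'a L2 \<Rightarrow> 'a L2" is "\<lambda>s f g. f (- s + g)"
proof -
  fix s :: 'a and f g :: "'a \<Rightarrow> complex"
  assume *: "L2_eq f g"
  then have "AE x in haar. f (- s + x) = g (- s + x)"
    using AE_haar_translate[of "\<lambda>x. f x = g x" "- s"] by (simp add: L2_eq_def)
  with * show "L2_eq (\<lambda>x. f (- s + x)) (\<lambda>x. g (- s + x))"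
    by (simp add: L2_eq_def square_integrable_translate)
qed

lemma translate_add: "translate s (\<xi> + \<eta>) = translate s \<xi> + translate s \<eta>"
  by transfer (auto simp: L2_eq_def intro!: square_integrable_translate square_integrable_add)

lemma translate_scaleR: "translate s (c *\<^sub>R \<xi>) = c *\<^sub>R translate s \<xi>"
  by transfer (auto simp: L2_eq_def intro!: square_integrable_translate square_integrable_scaleR)

lemma norm_translate [simp]: "norm (translate s \<xi>) = norm \<xi>"
proof transfer
  fix s :: 'a and f :: "'a \<Rightarrow> complex"
  assume "L2_eq f f"
  then have [measurable]: "f \<in> borel_measurable borel"
    by (simp add: L2_eq_def square_integrable_def)
  have "(LINT x|haar. (cmod (f x))\<^sup>2) = (LINT x|distr haar borel (\<lambda>g. - s + g). (cmod (f x))\<^sup>2)"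
    by (simp add: distr_haar)
  also have "\<dots> = (LINT x|haar. (cmod (f (- s + x)))\<^sup>2)"
    by (rule integral_distr) auto
  finally show "sqrt (LINT x|haar. (cmod (f (- s + x)))\<^sup>2) = sqrt (LINT x|haar. (cmod (f x))\<^sup>2)"
    by simp
qed

text \<open>\<open>inner\<close> is only the real part of the Hermitian product. Replacing \<eta> by
  \<open>mult_i \<eta>\<close> in the second argument yields the imaginary part, so complex
  coefficients can be treated as pairs of real ones.\<close>

lift_definition mult_i :: "'a::haar_group L2 \<Rightarrow> 'a L2" is "\<lambda>f x. \<i> * f x"
  by (auto simp: L2_eq_def square_integrable_def norm_mult elim: eventually_mono)

lemma square_integrable_mult_i: "square_integrable f \<Longrightarrow> square_integrable (\<lambda>x. \<i> * f x)"
  by (auto simp: square_integrable_def norm_mult)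

text \<open>Multiplication by i is skew-adjoint; the minus sign in the coefficient formulas for
  \<lambda>(\<mu>) comes from here.\<close>

lemma inner_mult_i: "inner (mult_i \<xi>) \<eta> = - inner \<xi> (mult_i \<eta>)"
proof transfer
  fix f g :: "'a \<Rightarrow> complex"
  have "inner (\<i> * f x) (g x) = - inner (f x) (\<i> * g x)" for x by (simp add: inner_complex_def)
  then show "(LINT x|haar. inner (\<i> * f x) (g x)) = - (LINT x|haar. inner (f x) (\<i> * g x))"
    by simp
qed

lemma norm_mult_i [simp]: "norm (mult_i \<xi>) = norm \<xi>"
  by transfer (simp add: norm_mult)

lemma mult_i_add: "mult_i (\<xi> + \<eta>) = mult_i \<xi> + mult_i \<eta>"
  by transfer (auto simp: L2_eq_def distrib_left intro!: square_integrable_mult_i square_integrable_add)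

lemma mult_i_scaleR: "mult_i (c *\<^sub>R \<xi>) = c *\<^sub>R mult_i \<xi>"
  by transfer (auto simp: L2_eq_def intro!: square_integrable_mult_i square_integrable_scaleR)

lemma bounded_linear_mult_i: "bounded_linear (mult_i :: 'a::haar_group L2 \<Rightarrow> 'a L2)"
  by (rule bounded_linear_intro[where K = 1]) (auto simp: mult_i_add mult_i_scaleR)

lemma square_integrable_rep: "square_integrable (rep_L2 \<xi>)"
  using Quotient_rep_reflp[OF Quotient_L2, of \<xi>] by (simp add: L2_eq_def)

lemma rep_measurable [measurable]: "rep_L2 \<xi> \<in> borel_measurable borel"
  using square_integrable_rep[of \<xi>] by (simp add: square_integrable_def)

lemma abs_rep: "abs_L2 (rep_L2 \<xi>) = \<xi>"
  by (rule Quotient_abs_rep[OF Quotient_L2])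

lemma L2_eq_refl: "square_integrable f \<Longrightarrow> L2_eq f f"
  by (simp add: L2_eq_def)

lemma inner_abs:
  "square_integrable f \<Longrightarrow> square_integrable g \<Longrightarrow> inner (abs_L2 f) (abs_L2 g) = (LINT x|haar. inner (f x) (g x))"
  by (simp add: inner_L2.abs_eq L2_eq_refl)

text \<open>The real part of the matrix coefficient of \<lambda>_s at \<xi> and \<eta>; the
  imaginary part is \<open>coefficient \<xi> (mult_i \<eta>) s\<close>.\<close>

definition coefficient :: "'a::haar_group L2 \<Rightarrow> 'a L2 \<Rightarrow> 'a \<Rightarrow> real" where
  "coefficient \<xi> \<eta> s = inner (translate s \<xi>) \<eta>"

lemma coefficient_eq: "coefficient \<xi> \<eta> s = (LINT g|haar. inner (rep_L2 \<xi> (- s + g)) (rep_L2 \<eta> g))"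
proof -
  have "translate s \<xi> = abs_L2 (\<lambda>g. rep_L2 \<xi> (- s + g))"
    by (subst abs_rep[of \<xi>, symmetric])
      (rule translate.abs_eq[OF L2_eq_refl[OF square_integrable_rep]])
  then show ?thesis
    unfolding coefficient_def
    by (subst abs_rep[of \<eta>, symmetric])
      (simp add: inner_abs square_integrable_rep square_integrable_translate)
qed

lemma abs_coefficient_le: "\<bar>coefficient \<xi> \<eta> s\<bar> \<le> norm \<xi> * norm \<eta>"
  unfolding coefficient_def using Cauchy_Schwarz_ineq2[of "translate s \<xi>" \<eta>] by simp

text \<open>Second countability identifies the product of the Borel sigma-algebras with the Borel
  sets of the product, so the continuous map (s, g) to -s + g is jointly measurable in the sense
  that Fubini requires.\<close>

lemma borel_measurable_minus_plus [measurable (raw)]: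
  fixes f g :: "'b \<Rightarrow> 'a::{topological_group_add, second_countable_topology}"
  assumes [measurable]: "f \<in> borel_measurable M" "g \<in> borel_measurable M"
  shows "(\<lambda>x. - f x + g x) \<in> borel_measurable M"
proof -
  have "(\<lambda>p :: 'a \<times> 'a. - fst p + snd p) \<in> borel \<Otimes>\<^sub>M borel \<rightarrow>\<^sub>M borel"
    unfolding borel_prod by (intro borel_measurable_continuous_onI continuous_intros)
  then have "(\<lambda>p :: 'a \<times> 'a. - fst p + snd p) \<circ> (\<lambda>x. (f x, g x)) \<in> borel_measurable M"
    by (rule measurable_comp[rotated]) measurable
  then show ?thesis by (simp add: o_def)
qed

section \<open>Convolution by a finite positive measure\<close>

definition convolve :: "'a::haar_group measure \<Rightarrow> 'a L2 \<Rightarrow> 'a \<Rightarrow> complex" where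
  "convolve m \<xi> g = (LINT s|m. rep_L2 \<xi> (- s + g))"

definition convolve_op :: "'a::haar_group measure \<Rightarrow> 'a L2 \<Rightarrow> 'a L2" where
  "convolve_op m \<xi> = abs_L2 (convolve m \<xi>)"

text \<open>Sigma-finiteness of Haar measure, needed for Fubini, is carried as a hypothesis;
  \<open>sigma_finite_haar\<close> derives it later from compact generators.\<close>

context
  fixes m :: "'a::{haar_group, second_countable_topology} measure"
  assumes haar: "sigma_finite_measure (haar :: 'a measure)"
    and m: "finite_borel m"
begin

interpretation haar: sigma_finite_measure "haar :: 'a measure" by (rule haar)
interpretation m: finite_measure m using m by (simp add: finite_borel_def)
interpretation mh: pair_sigma_finite m "haar :: 'a measure"
  by (intro pair_sigma_finite.intro haar m.sigma_finite_measure_axioms)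

lemmas [measurable_cong, simp] = finite_borel_sets[OF m]
lemmas [simp] = finite_borel_space[OF m]

lemma emeasure_UNIV_less_top: "emeasure m UNIV < top"
  using m.emeasure_finite[of UNIV] by (simp only: less_top infinity_ennreal_def)

text \<open>\<open>coefficient_eq\<close> makes s the parameter of a Haar integral of a jointly
  measurable function, so measurability comes from Fubini theory rather than from strong continuity
  of the representation.\<close>

lemma coefficient_measurable [measurable]: "coefficient \<xi> \<eta> \<in> borel_measurable (borel :: 'a measure)"
proof -
  have "(\<lambda>s. LINT g|haar. inner (rep_L2 \<xi> (- fst (s, g) + snd (s, g))) (rep_L2 \<eta> (snd (s, g))))
      \<in> borel_measurable (borel :: 'a measure)"
    by (rule haar.borel_measurable_lebesgue_integral) measurable
  then show ?thesis by (simp add: coefficient_eq[abs_def])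
qed

text \<open>By left invariance the inner Haar integral is the squared norm of \<xi> for every s, so
  integrating over the finite measure m keeps it finite. Tonelli gives the other order.\<close>

lemma nn_integral_translates:
  "(\<integral>\<^sup>+g. \<integral>\<^sup>+s. ennreal ((cmod (rep_L2 \<xi> (- s + g)))\<^sup>2) \<partial>m \<partial>haar) < \<infinity>"
  "(\<integral>\<^sup>+s. \<integral>\<^sup>+g. ennreal ((cmod (rep_L2 \<xi> (- s + g)))\<^sup>2) \<partial>haar \<partial>m) < \<infinity>"
proof -
  define f where "f p = ennreal ((cmod (rep_L2 \<xi> (- fst p + snd p)))\<^sup>2)" for p :: "'a \<times> 'a"
  have [measurable]: "f \<in> borel_measurable (m \<Otimes>\<^sub>M haar)" unfolding f_def by measurable
  have "(\<integral>\<^sup>+s. \<integral>\<^sup>+g. f (s, g) \<partial>haar \<partial>m) = (\<integral>\<^sup>+s. (\<integral>\<^sup>+g. ennreal ((cmod (rep_L2 \<xi> g))\<^sup>2) \<partial>haar) \<partial>m)"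
    unfolding f_def fst_conv snd_conv by (intro nn_integral_cong nn_integral_haar_translate) measurable
  also have "\<dots> < \<infinity>"
    using square_integrable_rep[of \<xi>] emeasure_UNIV_less_top
    by (auto simp: square_integrable_iff_nn ennreal_mult_less_top less_top)
  finally show 1: "(\<integral>\<^sup>+s. \<integral>\<^sup>+g. ennreal ((cmod (rep_L2 \<xi> (- s + g)))\<^sup>2) \<partial>haar \<partial>m) < \<infinity>"
    by (simp add: f_def)
  have "(\<integral>\<^sup>+g. \<integral>\<^sup>+s. f (s, g) \<partial>m \<partial>haar) = (\<integral>\<^sup>+s. \<integral>\<^sup>+g. f (s, g) \<partial>haar \<partial>m)"
    by (rule mh.Fubini') simp
  with 1 show "(\<integral>\<^sup>+g. \<integral>\<^sup>+s. ennreal ((cmod (rep_L2 \<xi> (- s + g)))\<^sup>2) \<partial>m \<partial>haar) < \<infinity>"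
    by (simp add: f_def)
qed

lemma Cauchy_Schwarz_translates:
  "(\<integral>\<^sup>+s. ennreal (cmod (rep_L2 \<xi> (- s + g))) \<partial>m)\<^sup>2
    \<le> (\<integral>\<^sup>+s. ennreal ((cmod (rep_L2 \<xi> (- s + g)))\<^sup>2) \<partial>m) * emeasure m UNIV"
proof -
  have [measurable]: "(\<lambda>s. rep_L2 \<xi> (- s + g)) \<in> borel_measurable m" by measurable
  show ?thesis
    using Cauchy_Schwarz_nn_integral[of "\<lambda>s. ennreal (cmod (rep_L2 \<xi> (- s + g)))" m "\<lambda>_. 1"]
    by (simp add: ennreal_power)
qed

lemma AE_integrable_translates: "AE g in haar. integrable m (\<lambda>s. rep_L2 \<xi> (- s + g))"
proof -
  have "AE g in haar. (\<integral>\<^sup>+s. ennreal ((cmod (rep_L2 \<xi> (- s + g)))\<^sup>2) \<partial>m) \<noteq> \<infinity>"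
    using nn_integral_translates(1)[of \<xi>] by (intro nn_integral_PInf_AE) auto
  then show ?thesis
  proof (rule eventually_mono)
    fix g assume *: "(\<integral>\<^sup>+s. ennreal ((cmod (rep_L2 \<xi> (- s + g)))\<^sup>2) \<partial>m) \<noteq> \<infinity>"
    have "(\<integral>\<^sup>+s. ennreal (cmod (rep_L2 \<xi> (- s + g))) \<partial>m)\<^sup>2 < \<infinity>"
      using * emeasure_UNIV_less_top
      by (intro le_less_trans[OF Cauchy_Schwarz_translates]) (auto simp: ennreal_mult_less_top less_top)
    then show "integrable m (\<lambda>s. rep_L2 \<xi> (- s + g))"
      by (simp add: integrable_iff_bounded power_less_top_ennreal)
  qed
qed

lemma square_integrable_convolve: "square_integrable (convolve m \<xi>)"
  unfolding square_integrable_iff_nn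
proof
  have "(\<lambda>g. LINT s|m. rep_L2 \<xi> (- fst (s, g) + snd (s, g))) \<in> borel_measurable (borel :: 'a measure)"
    by (rule m.borel_measurable_lebesgue_integral) measurable
  then show "convolve m \<xi> \<in> borel_measurable borel"
    by (simp add: convolve_def[abs_def])
  have "ennreal ((cmod (convolve m \<xi> g))\<^sup>2)
    \<le> (\<integral>\<^sup>+s. ennreal ((cmod (rep_L2 \<xi> (- s + g)))\<^sup>2) \<partial>m) * emeasure m UNIV" for g
  proof (cases "integrable m (\<lambda>s. rep_L2 \<xi> (- s + g))")
    case True
    then have "ennreal (cmod (convolve m \<xi> g)) \<le> (\<integral>\<^sup>+s. ennreal (cmod (rep_L2 \<xi> (- s + g))) \<partial>m)"
      unfolding convolve_def by (rule integral_norm_bound_ennreal)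
    then have "(ennreal (cmod (convolve m \<xi> g)))\<^sup>2 \<le> (\<integral>\<^sup>+s. ennreal (cmod (rep_L2 \<xi> (- s + g))) \<partial>m)\<^sup>2"
      by (rule power_mono) simp
    with Cauchy_Schwarz_translates[of \<xi> g] show ?thesis
      by (simp add: ennreal_power)
  next
    \<comment> \<open>A Bochner integral of a non-integrable function is 0 by default, so the
      pointwise bound holds for every g and not just almost everywhere.\<close>
    case False
    then show ?thesis by (simp add: convolve_def not_integrable_integral_eq)
  qed
  then have "(\<integral>\<^sup>+g. ennreal ((cmod (convolve m \<xi> g))\<^sup>2) \<partial>haar) \<le>
      (\<integral>\<^sup>+g. (\<integral>\<^sup>+s. ennreal ((cmod (rep_L2 \<xi> (- s + g)))\<^sup>2) \<partial>m) * emeasure m UNIV \<partial>haar)"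
    by (rule nn_integral_mono)
  also have "\<dots> = (\<integral>\<^sup>+g. (\<integral>\<^sup>+s. ennreal ((cmod (rep_L2 \<xi> (- s + g)))\<^sup>2) \<partial>m) \<partial>haar) * emeasure m UNIV"
    by (rule nn_integral_multc) measurable
  also have "\<dots> < \<infinity>"
    using nn_integral_translates(1)[of \<xi>] emeasure_UNIV_less_top
    by (auto simp: ennreal_mult_less_top less_top)
  finally show "(\<integral>\<^sup>+g. ennreal ((cmod (convolve m \<xi> g))\<^sup>2) \<partial>haar) < \<infinity>" .
qed

text \<open>Fubini moves the Haar integral inside. The product integrand is dominated by the sum of
  the two squares, and each square has finite integral over the product because m is finite.\<close>

lemma inner_convolve_op: "inner (convolve_op m \<xi>) \<eta> = (LINT s|m. coefficient \<xi> \<eta> s)"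
proof -
  define F where "F s g = inner (rep_L2 \<xi> (- s + g)) (rep_L2 \<eta> g)" for s g
  have [measurable]: "(\<lambda>p. F (fst p) (snd p)) \<in> borel_measurable (m \<Otimes>\<^sub>M haar)"
    unfolding F_def by measurable
  have [measurable]: "(\<lambda>p. F (snd p) (fst p)) \<in> borel_measurable (haar \<Otimes>\<^sub>M m)"
    unfolding F_def by measurable
  have "(\<integral>\<^sup>+p. ennreal (norm (F (fst p) (snd p))) \<partial>(m \<Otimes>\<^sub>M haar)) =
      (\<integral>\<^sup>+s. \<integral>\<^sup>+g. ennreal \<bar>F s g\<bar> \<partial>haar \<partial>m)"
    by (subst haar.nn_integral_fst[symmetric]) auto
  also have "\<dots> \<le> (\<integral>\<^sup>+s. \<integral>\<^sup>+g. ennreal ((cmod (rep_L2 \<xi> (- s + g)))\<^sup>2) +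
      ennreal ((cmod (rep_L2 \<eta> g))\<^sup>2) \<partial>haar \<partial>m)"
  proof (intro nn_integral_mono)
    fix s g
    have "\<bar>F s g\<bar> \<le> cmod (rep_L2 \<xi> (- s + g)) * cmod (rep_L2 \<eta> g)"
      unfolding F_def by (rule Cauchy_Schwarz_ineq2)
    moreover have "2 * (cmod (rep_L2 \<xi> (- s + g)) * cmod (rep_L2 \<eta> g)) \<le>
        (cmod (rep_L2 \<xi> (- s + g)))\<^sup>2 + (cmod (rep_L2 \<eta> g))\<^sup>2"
      using sum_squares_bound[of "cmod (rep_L2 \<xi> (- s + g))" "cmod (rep_L2 \<eta> g)"]
      by (simp add: mult.assoc)
    moreover have "0 \<le> cmod (rep_L2 \<xi> (- s + g)) * cmod (rep_L2 \<eta> g)" by simp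
    ultimately have "\<bar>F s g\<bar> \<le> (cmod (rep_L2 \<xi> (- s + g)))\<^sup>2 + (cmod (rep_L2 \<eta> g))\<^sup>2"
      by linarith
    then show "ennreal \<bar>F s g\<bar> \<le> ennreal ((cmod (rep_L2 \<xi> (- s + g)))\<^sup>2) + ennreal ((cmod (rep_L2 \<eta> g))\<^sup>2)"
      by (simp only: ennreal_plus[symmetric] zero_le_power2 ennreal_leI)
  qed
  also have "\<dots> = (\<integral>\<^sup>+s. (\<integral>\<^sup>+g. ennreal ((cmod (rep_L2 \<xi> (- s + g)))\<^sup>2) \<partial>haar) +
      (\<integral>\<^sup>+g. ennreal ((cmod (rep_L2 \<eta> g))\<^sup>2) \<partial>haar) \<partial>m)"
    by (intro nn_integral_cong nn_integral_add) measurable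
  also have "\<dots> = (\<integral>\<^sup>+s. (\<integral>\<^sup>+g. ennreal ((cmod (rep_L2 \<xi> (- s + g)))\<^sup>2) \<partial>haar) \<partial>m) +
      (\<integral>\<^sup>+s. (\<integral>\<^sup>+g. ennreal ((cmod (rep_L2 \<eta> g))\<^sup>2) \<partial>haar) \<partial>m)"
    by (intro nn_integral_add) measurable
  also have "\<dots> < \<infinity>"
    using nn_integral_translates(2)[of \<xi>] square_integrable_rep[of \<eta>] emeasure_UNIV_less_top
    by (auto simp: square_integrable_iff_nn ennreal_mult_less_top less_top)
  finally have int: "integrable (m \<Otimes>\<^sub>M haar) (\<lambda>(s, g). F s g)"
    by (simp add: integrable_iff_bounded case_prod_beta')
  have "inner (convolve_op m \<xi>) \<eta> = (LINT g|haar. inner (convolve m \<xi> g) (rep_L2 \<eta> g))"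
    unfolding convolve_op_def
    by (subst abs_rep[of \<eta>, symmetric])
      (simp add: inner_abs square_integrable_convolve square_integrable_rep)
  also have "\<dots> = (LINT g|haar. LINT s|m. F s g)"
  proof (rule integral_cong_AE)
    show "(\<lambda>g. inner (convolve m \<xi> g) (rep_L2 \<eta> g)) \<in> borel_measurable haar"
      using square_integrable_convolve[of \<xi>] by (auto simp: square_integrable_def)
    show "(\<lambda>g. LINT s|m. F s g) \<in> borel_measurable haar"
      by (rule m.borel_measurable_lebesgue_integral) (simp add: case_prod_beta' measurable_pair_swap_iff[of _ m])
    \<comment> \<open>Moving \<open>inner\<close> under the integral over m needs integrability in
      s, which is known for almost every g.\<close>
    show "AE g in haar. inner (convolve m \<xi> g) (rep_L2 \<eta> g) = (LINT s|m. F s g)"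
      using AE_integrable_translates[of \<xi>]
      by (rule eventually_mono) (simp add: F_def convolve_def integral_inner_left)
  qed
  also have "\<dots> = (LINT s|m. LINT g|haar. F s g)"
    by (rule mh.Fubini_integral[OF int])
  finally show ?thesis by (simp add: F_def coefficient_eq)
qed

lemma integrable_coefficient: "integrable m (coefficient \<xi> \<eta>)"
  by (rule m.integrable_const_bound[where B = "norm \<xi> * norm \<eta>"]) (auto simp: abs_coefficient_le)

lemma abs_integral_coefficient_le:
  "\<bar>LINT s|m. coefficient \<xi> \<eta> s\<bar> \<le> measure m UNIV * (norm \<xi> * norm \<eta>)"
proof -
  have "\<bar>LINT s|m. coefficient \<xi> \<eta> s\<bar> \<le> (LINT s|m. norm \<xi> * norm \<eta>)"
    by (rule order_trans[OF integral_abs_bound integral_mono])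
      (auto simp: abs_coefficient_le integrable_coefficient)
  then show ?thesis by simp
qed

text \<open>
  Linearity and boundedness are read off the coefficients, which are bilinear and bounded by
  \<open>norm \<xi> * norm \<eta>\<close>; thus null sets only have to be controlled for one translate at a time.
\<close>

lemma bounded_linear_convolve_op: "bounded_linear (convolve_op m)"
proof (rule bounded_linear_intro)
  fix \<xi> \<eta> :: "'a L2" and c :: real
  show "convolve_op m (\<xi> + \<eta>) = convolve_op m \<xi> + convolve_op m \<eta>"
  proof (rule vector_eq_ldot[THEN iffD1], rule allI)
    fix \<zeta>
    have "inner (convolve_op m (\<xi> + \<eta>)) \<zeta> = inner (convolve_op m \<xi> + convolve_op m \<eta>) \<zeta>"
      unfolding inner_add_left inner_convolve_op
      by (subst Bochner_Integration.integral_add[symmetric])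
        (auto simp: integrable_coefficient coefficient_def[abs_def] translate_add inner_add_left
          intro!: integrable_coefficient[unfolded coefficient_def[abs_def]])
    then show "inner \<zeta> (convolve_op m (\<xi> + \<eta>)) = inner \<zeta> (convolve_op m \<xi> + convolve_op m \<eta>)"
      by (simp add: inner_commute)
  qed
  show "convolve_op m (c *\<^sub>R \<xi>) = c *\<^sub>R convolve_op m \<xi>"
  proof (rule vector_eq_ldot[THEN iffD1], rule allI)
    fix \<zeta>
    have "inner (convolve_op m (c *\<^sub>R \<xi>)) \<zeta> = inner (c *\<^sub>R convolve_op m \<xi>) \<zeta>"
      by (simp add: inner_convolve_op coefficient_def translate_scaleR)
    then show "inner \<zeta> (convolve_op m (c *\<^sub>R \<xi>)) = inner \<zeta> (c *\<^sub>R convolve_op m \<xi>)"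
      by (simp add: inner_commute)
  qed
  show "norm (convolve_op m \<xi>) \<le> norm \<xi> * measure m UNIV"
  proof (cases "convolve_op m \<xi> = 0")
    case False
    have "norm (convolve_op m \<xi>) * norm (convolve_op m \<xi>) = (LINT s|m. coefficient \<xi> (convolve_op m \<xi>) s)"
      by (simp add: inner_convolve_op[symmetric] norm_eq_sqrt_inner)
    also have "\<dots> \<le> measure m UNIV * (norm \<xi> * norm (convolve_op m \<xi>))"
      using abs_integral_coefficient_le[of \<xi> "convolve_op m \<xi>"] by linarith
    finally show ?thesis using False by (simp add: ac_simps)
  qed simp
qed

end

section \<open>The operators of complex measures\<close>

text \<open>Testing with \<open>y = T x\<close> recovers the norm; the bilinear form is what the
  coefficient formulas control.\<close>

lemma norm_blinfun_le_inner:
  fixes T :: "'b::real_normed_vector \<Rightarrow>\<^sub>L 'c::real_inner"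
  assumes "0 \<le> K" "\<And>x y. \<bar>inner (T x) y\<bar> \<le> K * norm x * norm y"
  shows "norm T \<le> K"
proof (rule norm_blinfun_bound[OF assms(1)])
  fix x
  show "norm (T x) \<le> K * norm x"
  proof (cases "T x = 0")
    case False
    have "norm (T x) * norm (T x) \<le> K * norm x * norm (T x)"
      using assms(2)[of x "T x"] by (simp add: dot_square_norm power2_eq_square)
    then show ?thesis using False by simp
  qed (use assms in auto)
qed

lemma blinfun_eqI_inner:
  fixes S T :: "'b::real_normed_vector \<Rightarrow>\<^sub>L 'c::real_inner"
  assumes "\<And>x y. inner (S x) y = inner (T x) y"
  shows "S = T"
  by (rule blinfun_eqI) (metis assms vector_eq_rdot)

definition L1_op :: "('a::haar_group \<Rightarrow> complex) \<Rightarrow> 'a L2 \<Rightarrow>\<^sub>L 'a L2" where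
  "L1_op f = lambda_op (L1_measure f)"

lemma integrable_indicator_max:
  fixes h :: "'a::haar_group \<Rightarrow> real"
  assumes h: "integrable haar h" and [measurable]: "A \<in> sets borel"
  shows "integrable haar (\<lambda>x. indicator A x * max 0 (h x))"
proof -
  have [measurable]: "h \<in> borel_measurable borel"
    using borel_measurable_integrable[OF h] by (simp add: borel_measurable_haar)
  have "(\<lambda>x. indicator A x * max 0 (h x)) \<in> borel_measurable haar" by measurable
  then show ?thesis
    by (rule Bochner_Integration.integrable_bound[OF h]) (auto simp: indicator_def)
qed

context
  assumes haar: "sigma_finite_measure (haar :: 'a::{haar_group, second_countable_topology} measure)"
begin

interpretation haar: sigma_finite_measure "haar :: 'a measure" by (rule haar)

text \<open>\<open>Blinfun\<close> can be undone only on bounded linear maps; the four convolution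
  operators of the Jordan parts supply this for \<lambda>(\<mu>).\<close>

lemma lambda_op_apply:
  fixes \<xi> :: "'a L2"
  assumes \<mu>: "\<mu> \<in> complex_measures"
  shows "blinfun_apply (lambda_op \<mu>) \<xi> =
    (convolve_op (pos_part (\<lambda>A. Re (\<mu> A))) \<xi> - convolve_op (pos_part (\<lambda>A. - Re (\<mu> A))) \<xi>) +
    mult_i (convolve_op (pos_part (\<lambda>A. Im (\<mu> A))) \<xi> - convolve_op (pos_part (\<lambda>A. - Im (\<mu> A))) \<xi>)"
    (is "_ = ?T \<xi>")
proof -
  note fin = finite_signed_measure_Re[OF \<mu>] finite_signed_measure_Im[OF \<mu>]
  note fb = fin[THEN finite_borel_pos_part] fin[THEN finite_signed_measure_uminus, THEN finite_borel_pos_part]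
  note si = fb[THEN square_integrable_convolve[OF haar]]
  have "abs_L2 (\<lambda>g. complex_integral \<mu> (\<lambda>s. rep_L2 \<xi> (- s + g))) = ?T \<xi>" for \<xi>
    unfolding convolve_op_def complex_integral_def convolve_def[symmetric] using si[of \<xi>]
    by (simp add: plus_L2.abs_eq minus_L2.abs_eq mult_i.abs_eq L2_eq_refl square_integrable_diff
        square_integrable_mult_i)
  moreover have "bounded_linear ?T"
    by (intro bounded_linear_add bounded_linear_sub bounded_linear_compose[OF bounded_linear_mult_i]
        bounded_linear_convolve_op haar fb)
  ultimately show ?thesis
    by (simp add: lambda_op_def bounded_linear_Blinfun_apply)
qed

lemma inner_lambda_op_pos_part:
  fixes \<xi> \<eta> :: "'a L2"
  assumes \<mu>: "\<mu> \<in> complex_measures"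
  shows "inner (lambda_op \<mu> \<xi>) \<eta> =
    ((LINT s|pos_part (\<lambda>A. Re (\<mu> A)). coefficient \<xi> \<eta> s)
      - (LINT s|pos_part (\<lambda>A. - Re (\<mu> A)). coefficient \<xi> \<eta> s))
    - ((LINT s|pos_part (\<lambda>A. Im (\<mu> A)). coefficient \<xi> (mult_i \<eta>) s)
      - (LINT s|pos_part (\<lambda>A. - Im (\<mu> A)). coefficient \<xi> (mult_i \<eta>) s))"
proof -
  note fin = finite_signed_measure_Re[OF \<mu>] finite_signed_measure_Im[OF \<mu>]
  note fb = fin[THEN finite_borel_pos_part] fin[THEN finite_signed_measure_uminus, THEN finite_borel_pos_part]
  show ?thesis
    unfolding lambda_op_apply[OF \<mu>] inner_add_left inner_diff_left inner_mult_i
      fb[THEN inner_convolve_op[OF haar]] by simp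
qed

text \<open>\<open>lambda_op\<close> is defined through Jordan parts, but coefficients see only the
  differences of the parts. The formula therefore holds for any four measures that combine to \<mu>,
  which is what a code delivers.\<close>

lemma inner_lambda_op:
  fixes \<xi> \<eta> :: "'a L2"
  assumes fin: "finite_borel m0" "finite_borel m1" "finite_borel m2" "finite_borel m3"
  shows "inner (lambda_op (complex_combination m0 m1 m2 m3) \<xi>) \<eta> =
    ((LINT s|m0. coefficient \<xi> \<eta> s) - (LINT s|m1. coefficient \<xi> \<eta> s))
    - ((LINT s|m2. coefficient \<xi> (mult_i \<eta>) s) - (LINT s|m3. coefficient \<xi> (mult_i \<eta>) s))"
proof -
  define \<mu> where "\<mu> = complex_combination m0 m1 m2 m3"
  have \<mu>: "\<mu> \<in> complex_measures"
    unfolding \<mu>_def using fin by (rule complex_combination_measure)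
  note s = finite_signed_measure_Re[OF \<mu>] finite_signed_measure_Im[OF \<mu>]
  note fb = s[THEN finite_borel_pos_part] s[THEN finite_signed_measure_uminus, THEN finite_borel_pos_part]
  have Re: "measure (pos_part (\<lambda>A. Re (\<mu> A))) A - measure (pos_part (\<lambda>A. - Re (\<mu> A))) A
      = measure m0 A - measure m1 A"
    and Im: "measure (pos_part (\<lambda>A. Im (\<mu> A))) A - measure (pos_part (\<lambda>A. - Im (\<mu> A))) A
      = measure m2 A - measure m3 A" if "A \<in> sets borel" for A
    using fun_cong[OF complex_combination_pos_part[OF \<mu>], of A] that
    by (simp_all add: \<mu>_def complex_combination_def)
  note cm = coefficient_measurable[OF haar fin(1)]
  show ?thesis
    unfolding \<mu>_def[symmetric] inner_lambda_op_pos_part[OF \<mu>]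
    using integral_complex_combination_unique[OF fb(1,3) fin(1,2) Re cm abs_coefficient_le, of \<xi> \<eta>]
      integral_complex_combination_unique[OF fb(2,4) fin(3,4) Im cm abs_coefficient_le, of \<xi> "mult_i \<eta>"]
    by simp
qed

section \<open>Operators of integrable functions\<close>

lemma L1_positive_density:
  fixes h :: "'a \<Rightarrow> real"
  assumes h: "integrable haar h"
  defines "m \<equiv> density haar (\<lambda>x. ennreal (max 0 (h x)))"
  shows "finite_borel m"
    and "A \<in> sets borel \<Longrightarrow> measure m A = (LINT x|haar. indicator A x * max 0 (h x))"
    and "\<phi> \<in> borel_measurable borel \<Longrightarrow> (LINT x|m. \<phi> x) = (LINT x|haar. max 0 (h x) * (\<phi> x :: real))"
proof -
  have [measurable]: "h \<in> borel_measurable haar"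
    using h by (rule borel_measurable_integrable)
  note int = integrable_indicator_max[OF h]
  have em: "emeasure m A = ennreal (LINT x|haar. indicator A x * max 0 (h x))" if A: "A \<in> sets borel" for A
  proof -
    have "emeasure m A = (\<integral>\<^sup>+x. ennreal (max 0 (h x)) * indicator A x \<partial>haar)"
      unfolding m_def using A by (intro emeasure_density) auto
    also have "\<dots> = (\<integral>\<^sup>+x. ennreal (indicator A x * max 0 (h x)) \<partial>haar)"
      by (intro nn_integral_cong) (auto simp: indicator_def)
    also have "\<dots> = ennreal (LINT x|haar. indicator A x * max 0 (h x))"
      using int[OF A] by (intro nn_integral_eq_integral) (auto simp: indicator_def)
    finally show ?thesis .
  qed
  then show "A \<in> sets borel \<Longrightarrow> measure m A = (LINT x|haar. indicator A x * max 0 (h x))"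
    by (simp add: measure_def indicator_def)
  show "finite_borel m"
    unfolding finite_borel_def
  proof
    show "finite_measure m" using em[of UNIV] by (intro finite_measureI) (simp add: m_def)
    show "sets m = sets borel" by (simp add: m_def)
  qed
  assume "\<phi> \<in> borel_measurable borel"
  moreover have "(\<lambda>x. max 0 (h x)) \<in> borel_measurable haar" by measurable
  ultimately show "(LINT x|m. \<phi> x) = (LINT x|haar. max 0 (h x) * (\<phi> x :: real))"
    unfolding m_def by (subst integral_density) (simp_all add: borel_measurable_haar)
qed

lemma L1_measure_eq_combination:
  fixes f :: "'a \<Rightarrow> complex"
  assumes f: "integrable haar f"
  shows "L1_measure f = complex_combination
    (density haar (\<lambda>x. ennreal (max 0 (Re (f x))))) (density haar (\<lambda>x. ennreal (max 0 (- Re (f x)))))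
    (density haar (\<lambda>x. ennreal (max 0 (Im (f x))))) (density haar (\<lambda>x. ennreal (max 0 (- Im (f x)))))"
proof
  fix A
  have *: "(LINT x|haar. indicator A x * max 0 (h x)) - (LINT x|haar. indicator A x * max 0 (- h x)) =
      (LINT x|haar. indicator A x * h x)" if h: "integrable haar h" and A: "A \<in> sets borel"
    for h :: "'a \<Rightarrow> real"
  proof -
    have "integrable haar (\<lambda>x. indicator A x * max 0 (h x))" "integrable haar (\<lambda>x. indicator A x * max 0 (- h x))"
      using h A by (simp_all add: integrable_indicator_max)
    then have "(LINT x|haar. indicator A x * max 0 (h x)) - (LINT x|haar. indicator A x * max 0 (- h x)) =
        (LINT x|haar. indicator A x * max 0 (h x) - indicator A x * max 0 (- h x))"
      by simp
    also have "\<dots> = (LINT x|haar. indicator A x * h x)"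
      by (rule Bochner_Integration.integral_cong) (auto simp: indicator_def)
    finally show ?thesis .
  qed
  show "L1_measure f A = complex_combination
    (density haar (\<lambda>x. ennreal (max 0 (Re (f x))))) (density haar (\<lambda>x. ennreal (max 0 (- Re (f x)))))
    (density haar (\<lambda>x. ennreal (max 0 (Im (f x))))) (density haar (\<lambda>x. ennreal (max 0 (- Im (f x))))) A"
  proof (cases "A \<in> sets borel")
    case True
    have int: "integrable haar (\<lambda>x. indicator A x *\<^sub>R f x)"
      using f True by (intro integrable_mult_indicator) auto
    have "Re (LINT x|haar. indicator A x *\<^sub>R f x) = (LINT x|haar. indicator A x * Re (f x))"
      "Im (LINT x|haar. indicator A x *\<^sub>R f x) = (LINT x|haar. indicator A x * Im (f x))"
      using int by (simp_all add: integral_Re[symmetric] integral_Im[symmetric])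
    moreover have fin: "integrable haar (\<lambda>x. Re (f x))" "integrable haar (\<lambda>x. Im (f x))"
       "integrable haar (\<lambda>x. - Re (f x))" "integrable haar (\<lambda>x. - Im (f x))"
      using f by auto
    ultimately show ?thesis
      unfolding complex_combination_def fin[THEN L1_positive_density(2), OF True]
        *[OF fin(1) True] *[OF fin(2) True]
      using True by (simp add: L1_measure_def set_lebesgue_integral_def complex_eq_iff)
  qed (simp add: L1_measure_def complex_combination_def)
qed

text \<open>The right side is the real part of the integral of f(s) times the complex matrix
  coefficient of \<lambda>_s.\<close>

lemma inner_L1_op:
  fixes f :: "'a \<Rightarrow> complex"
  assumes f: "integrable haar f"
  shows "inner (L1_op f \<xi>) \<eta> =
    (LINT s|haar. Re (f s) * coefficient \<xi> \<eta> s - Im (f s) * coefficient \<xi> (mult_i \<eta>) s)"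
proof -
  have fin: "integrable haar (\<lambda>x. Re (f x))" "integrable haar (\<lambda>x. Im (f x))"
      "integrable haar (\<lambda>x. - Re (f x))" "integrable haar (\<lambda>x. - Im (f x))"
    using f by auto
  note fb = fin[THEN L1_positive_density(1)]
  have cm: "coefficient \<xi> \<eta> \<in> borel_measurable borel" for \<xi> \<eta> :: "'a L2"
    by (rule coefficient_measurable[OF haar fb(1)])
  then have [measurable]: "coefficient \<xi> \<eta> \<in> borel_measurable haar" for \<xi> \<eta> :: "'a L2"
    by (simp add: borel_measurable_haar)
  have int: "integrable haar (\<lambda>s. h s * coefficient \<xi> \<eta> s)"
    if "integrable haar h" for h :: "'a \<Rightarrow> real" and \<xi> \<eta> :: "'a L2"
  proof -
    have [measurable]: "h \<in> borel_measurable haar"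
      using that by (rule borel_measurable_integrable)
    show ?thesis
    proof (rule Bochner_Integration.integrable_bound)
      show "integrable haar (\<lambda>s. h s * (norm \<xi> * norm \<eta>))" using that by simp
      show "AE s in haar. norm (h s * coefficient \<xi> \<eta> s) \<le> norm (h s * (norm \<xi> * norm \<eta>))"
        by (intro AE_I2) (simp add: abs_mult mult_left_mono abs_coefficient_le)
      show "(\<lambda>s. h s * coefficient \<xi> \<eta> s) \<in> borel_measurable haar"
        by measurable
    qed
  qed
  have *: "(LINT s|haar. max 0 (h s) * coefficient \<xi> \<eta> s) - (LINT s|haar. max 0 (- h s) * coefficient \<xi> \<eta> s)
      = (LINT s|haar. h s * coefficient \<xi> \<eta> s)" if "integrable haar h" for h and \<xi> \<eta> :: "'a L2"
  proof -
    have "integrable haar (\<lambda>s. max 0 (h s))" "integrable haar (\<lambda>s. max 0 (- h s))"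
      using that by simp_all
    then have "(LINT s|haar. max 0 (h s) * coefficient \<xi> \<eta> s) - (LINT s|haar. max 0 (- h s) * coefficient \<xi> \<eta> s)
      = (LINT s|haar. max 0 (h s) * coefficient \<xi> \<eta> s - max 0 (- h s) * coefficient \<xi> \<eta> s)"
      by (intro Bochner_Integration.integral_diff[symmetric] int)
    also have "\<dots> = (LINT s|haar. h s * coefficient \<xi> \<eta> s)"
      by (rule Bochner_Integration.integral_cong) (auto simp: max_def)
    finally show ?thesis .
  qed
  show ?thesis
    \<comment> \<open>\<open>fin\<close> lists the densities as Re, Im, -Re, -Im, hence the order 1,
      3, 2, 4 of the parts.\<close>
    unfolding L1_op_def L1_measure_eq_combination[OF f] inner_lambda_op[OF fb(1,3,2,4)]
      fin[THEN L1_positive_density(3), OF cm] *[OF fin(1)] *[OF fin(2)]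
    using int[OF fin(1)] int[OF fin(2)] by (simp add: Bochner_Integration.integral_diff)
qed

text \<open>The factor 2 comes from estimating the real and imaginary terms separately. It is crude
  but sufficient: the bound serves to turn L1 approximation of functions into norm approximation of
  operators.\<close>

lemma integrable_L1_op_kernel:
  fixes f :: "'a \<Rightarrow> complex"
  assumes f: "integrable haar f"
  shows "integrable haar (\<lambda>s. Re (f s) * coefficient \<xi> \<eta> s - Im (f s) * coefficient \<xi> (mult_i \<eta>) s)"
    and "\<bar>inner (L1_op f \<xi>) \<eta>\<bar> \<le> 2 * (LINT s|haar. cmod (f s)) * norm \<xi> * norm \<eta>"
proof -
  have [measurable]: "f \<in> borel_measurable haar"
    using f by (rule borel_measurable_integrable)
  have [measurable]: "coefficient \<xi> \<eta> \<in> borel_measurable haar" for \<xi> \<eta> :: "'a L2"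
    using coefficient_measurable[OF haar L1_positive_density(1)[of "\<lambda>x. Re (f x)"]] f
    by (simp add: borel_measurable_haar)
  have bound: "\<bar>Re (f s) * coefficient \<xi> \<eta> s - Im (f s) * coefficient \<xi> (mult_i \<eta>) s\<bar>
      \<le> 2 * cmod (f s) * norm \<xi> * norm \<eta>" for s
  proof -
    have "\<bar>Re (f s) * coefficient \<xi> \<eta> s\<bar> \<le> cmod (f s) * (norm \<xi> * norm \<eta>)"
      unfolding abs_mult by (intro mult_mono abs_Re_le_cmod abs_coefficient_le) auto
    moreover have "\<bar>Im (f s) * coefficient \<xi> (mult_i \<eta>) s\<bar> \<le> cmod (f s) * (norm \<xi> * norm \<eta>)"
      unfolding abs_mult using abs_coefficient_le[of \<xi> "mult_i \<eta>" s]
      by (intro mult_mono abs_Im_le_cmod) auto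
    ultimately show ?thesis by (simp add: algebra_simps)
  qed
  have int: "integrable haar (\<lambda>s. 2 * cmod (f s) * norm \<xi> * norm \<eta>)"
    using f by simp
  show 1: "integrable haar (\<lambda>s. Re (f s) * coefficient \<xi> \<eta> s - Im (f s) * coefficient \<xi> (mult_i \<eta>) s)"
    by (rule Bochner_Integration.integrable_bound[OF int])
      (measurable, auto intro!: AE_I2 order_trans[OF bound] simp: abs_mult)
  have "\<bar>inner (L1_op f \<xi>) \<eta>\<bar> \<le> (LINT s|haar. 2 * cmod (f s) * norm \<xi> * norm \<eta>)"
    unfolding inner_L1_op[OF f]
    by (rule order_trans[OF integral_abs_bound integral_mono]) (use 1 int bound in auto)
  then show "\<bar>inner (L1_op f \<xi>) \<eta>\<bar> \<le> 2 * (LINT s|haar. cmod (f s)) * norm \<xi> * norm \<eta>"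
    by simp
qed

lemma norm_L1_op_le:
  fixes f :: "'a \<Rightarrow> complex"
  shows "integrable haar f \<Longrightarrow> norm (L1_op f) \<le> 2 * (LINT s|haar. cmod (f s))"
  by (intro norm_blinfun_le_inner integrable_L1_op_kernel) auto

text \<open>Positive parts are not additive in f, but the coefficient formula is linear in f, and
  coefficients determine the operator.\<close>

lemma L1_op_add:
  fixes f g :: "'a \<Rightarrow> complex"
  assumes "integrable haar f" "integrable haar g"
  shows "L1_op (\<lambda>x. f x + g x) = L1_op f + L1_op g"
proof (rule blinfun_eqI_inner)
  fix \<xi> \<eta>
  show "inner (L1_op (\<lambda>x. f x + g x) \<xi>) \<eta> = inner ((L1_op f + L1_op g) \<xi>) \<eta>"
    using assms by (simp add: blinfun.add_left inner_add_left inner_L1_op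
        Bochner_Integration.integral_add[symmetric] integrable_L1_op_kernel algebra_simps
        del: Bochner_Integration.integral_add)
qed

lemma L1_op_scaleR:
  fixes f :: "'a \<Rightarrow> complex"
  assumes "integrable haar f"
  shows "L1_op (\<lambda>x. c *\<^sub>R f x) = c *\<^sub>R L1_op f"
proof (rule blinfun_eqI_inner)
  fix \<xi> \<eta>
  show "inner (L1_op (\<lambda>x. c *\<^sub>R f x) \<xi>) \<eta> = inner ((c *\<^sub>R L1_op f) \<xi>) \<eta>"
    using assms by (simp add: blinfun.scaleR_left inner_L1_op algebra_simps
        Bochner_Integration.integral_mult_right_zero[symmetric] del: Bochner_Integration.integral_mult_right_zero)
qed

lemma L1_op_diff:
  fixes f g :: "'a \<Rightarrow> complex"
  assumes "integrable haar f" "integrable haar g"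
  shows "L1_op (\<lambda>x. f x - g x) = L1_op f - L1_op g"
  using L1_op_add[of f "\<lambda>x. (- 1) *\<^sub>R g x"] L1_op_scaleR[of g "- 1"] assms by simp

lemma reduced_group_algebra_eq: "(reduced_group_algebra :: ('a L2 \<Rightarrow>\<^sub>L 'a L2) set) = closure {L1_op f | f. integrable haar f}"
proof -
  have "f \<in> borel_measurable borel \<and> integrable haar f \<longleftrightarrow> integrable haar f" for f :: "'a \<Rightarrow> complex"
    using borel_measurable_integrable[of haar f] by (auto simp: borel_measurable_haar)
  then show ?thesis by (simp add: reduced_group_algebra_def L1_op_def)
qed

end

section \<open>A countable algebra generated by compact sets\<close>

text \<open>Terms stand in for the members of the algebra: they are countable by construction and
  can index the entries of a code. Different terms may denote the same set, which codes must
  respect.\<close>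

datatype bexp = Gen nat | Neg bexp | Join bexp bexp

instance bexp :: countable by countable_datatype

primrec beval :: "(nat \<Rightarrow> 'a set) \<Rightarrow> bexp \<Rightarrow> 'a set" where
  "beval g (Gen n) = g n"
| "beval g (Neg t) = - beval g t"
| "beval g (Join t u) = beval g t \<union> beval g u"

locale compact_generators =
  fixes g :: "nat \<Rightarrow> 'a::t2_space set"
  assumes compact_g: "compact (g n)"
    and open_union: "open U \<Longrightarrow> \<exists>I. U = (\<Union>i\<in>I. g i)"

text \<open>Compact closures of basic open sets suffice: a compact neighbourhood of x inside
  \<open>U\<close> contains the closure of some basic set around x.\<close>

lemma ex_compact_generators:
  assumes lc: "locally_compact_space (euclidean :: 'a::{t2_space, second_countable_topology} topology)"
  shows "\<exists>g :: nat \<Rightarrow> 'a set. compact_generators g"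
proof -
  obtain B :: "'a set set" where B: "countable B" "topological_basis B"
    using ex_countable_basis by blast
  \<comment> \<open>The added \<open>{}\<close> keeps \<open>G\<close> nonempty, as
    \<open>from_nat_into\<close> requires.\<close>
  define G where "G = insert {} (closure ` {b \<in> B. compact (closure b)})"
  have G: "countable G" "G \<noteq> {}" using B by (auto simp: G_def)
  have "compact_generators (from_nat_into G)"
  proof
    fix n
    have "from_nat_into G n \<in> G" using G by (simp add: from_nat_into)
    then show "compact (from_nat_into G n)" by (auto simp: G_def)
  next
    fix U :: "'a set" assume U: "open U"
    have "\<exists>K\<in>G. x \<in> K \<and> K \<subseteq> U" if "x \<in> U" for x
    proof -
      have "neighbourhood_base_of (compactin euclidean) (euclidean :: 'a topology)"
        using lc locally_compact_space_neighbourhood_base[of "euclidean :: 'a topology"]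
        by (simp add: Hausdorff_space_def disjnt_def separation_t2)
      then obtain V K where VK: "open V" "compact K" "x \<in> V" "V \<subseteq> K" "K \<subseteq> U"
        using U \<open>x \<in> U\<close> unfolding neighbourhood_base_of
        by (metis open_openin compactin_euclidean_iff)
      obtain b where b: "b \<in> B" "x \<in> b" "b \<subseteq> V"
        using topological_basisE[OF B(2) VK(1,3)] by blast
      have "closure b \<subseteq> K"
        using b VK by (intro closure_minimal compact_imp_closed) auto
      moreover from this have "compact (closure b)"
        using VK(2) compact_Int_closed[of K "closure b"] by (simp add: inf.absorb2)
      ultimately show ?thesis
        using b VK closure_subset[of b] by (intro bexI[of _ "closure b"]) (auto simp: G_def)
    qed
    then have "U = \<Union> {K \<in> G. K \<subseteq> U}" by blast
    also have "\<dots> = (\<Union>i\<in>{i. from_nat_into G i \<subseteq> U}. from_nat_into G i)"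
    proof -
      have "{K \<in> G. K \<subseteq> U} = from_nat_into G ` {i. from_nat_into G i \<subseteq> U}"
        by (subst range_from_nat_into[OF G(2,1), symmetric]) blast
      then show ?thesis by simp
    qed
    finally show "\<exists>I. U = (\<Union>i\<in>I. from_nat_into G i)" by blast
  qed
  then show ?thesis by blast
qed

context compact_generators
begin

lemma Union_g: "(\<Union>n. g n) = UNIV"
  using open_union[OF open_UNIV] by auto

lemma sets_beval [measurable, simp]: "beval g t \<in> sets borel"
  by (induction t) (auto intro: borel_compact compact_g)

lemma algebra_beval: "algebra UNIV (range (beval g))"
  unfolding algebra_iff_Un
proof (intro conjI ballI)
  have "- g 0 \<union> g 0 = beval g (Join (Neg (Gen 0)) (Gen 0))" by simp
  then have "{} = beval g (Neg (Join (Neg (Gen 0)) (Gen 0)))" by simp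
  then show "{} \<in> range (beval g)" by (rule range_eqI)
next
  fix A B assume "A \<in> range (beval g)" "B \<in> range (beval g)"
  then obtain t u where [simp]: "A = beval g t" "B = beval g u" by auto
  have "A \<union> B = beval g (Join t u)" by simp
  then show "A \<union> B \<in> range (beval g)" by (rule range_eqI)
  have "UNIV - A = beval g (Neg t)" by auto
  then show "UNIV - A \<in> range (beval g)" by (rule range_eqI)
qed auto

sublocale beval: algebra UNIV "range (beval g)" by (rule algebra_beval)

lemma sigma_sets_beval: "sigma_sets UNIV (range (beval g)) = sets borel"
proof
  show "sigma_sets UNIV (range (beval g)) \<subseteq> sets borel"
  proof -
    have "range (beval g) \<subseteq> sets borel" by auto
    then show ?thesis using sets.sigma_sets_subset[of "range (beval g)" "borel :: 'a measure"] by simp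
  qed
  have "{U. open U} \<subseteq> sigma_sets UNIV (range (beval g))"
  proof
    fix U :: "'a set" assume "U \<in> {U. open U}"
    then obtain I where I: "U = (\<Union>i\<in>I. g i)" using open_union by blast
    have "g i \<in> sigma_sets UNIV (range (beval g))" for i
      by (rule sigma_sets.Basic) (metis beval.simps(1) rangeI)
    then show "U \<in> sigma_sets UNIV (range (beval g))"
      unfolding I using sigma_algebra.countable_UN'[OF sigma_algebra_sigma_sets, of "range (beval g)" UNIV I g]
      by auto
  qed
  then have "sigma_sets UNIV {U. open U} \<subseteq> sigma_sets UNIV (range (beval g))"
    by (rule sigma_sets_mono)
  then show "sets borel \<subseteq> sigma_sets UNIV (range (beval g))"
    by (simp add: borel_def)
qed

lemma UN_lessThan_beval: "(\<Union>i<n. g i) \<in> range (beval g)"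
  by (rule beval.finite_UN) (auto intro: range_eqI[where x = "Gen _"])

text \<open>The sets approximable by the algebra up to small symmetric difference form a
  sigma-algebra containing it, hence include all Borel sets.\<close>

lemma approx_beval:
  assumes M: "finite_borel M" and A: "A \<in> sets borel" and "0 < \<epsilon>"
  shows "\<exists>B\<in>range (beval g). measure M ((A - B) \<union> (B - A)) < \<epsilon>"
proof -
  interpret finite_measure M using M by (simp add: finite_borel_def)
  have [simp]: "sets M = sets borel" and [simp]: "space M = UNIV"
    using M sets_eq_imp_space_eq[of M borel] by (auto simp: finite_borel_def)
  have ball: "B \<in> sets borel" if "B \<in> range (beval g)" for B
    using that by auto
  define S where "S A \<longleftrightarrow> A \<in> sets borel \<and> (\<forall>\<epsilon>>0. \<exists>B\<in>range (beval g). measure M ((A - B) \<union> (B - A)) < \<epsilon>)" for A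
  have S_Un: "S (A1 \<union> A2)" if A: "S A1" "S A2" for A1 A2
    unfolding S_def
  proof (intro conjI allI impI)
    show "A1 \<union> A2 \<in> sets borel" using A unfolding S_def by (blast intro: sets.Un)
    fix \<epsilon> :: real assume "0 < \<epsilon>"
    then obtain B1 B2 where B: "B1 \<in> range (beval g)" "B2 \<in> range (beval g)"
      "measure M ((A1 - B1) \<union> (B1 - A1)) < \<epsilon> / 2" "measure M ((A2 - B2) \<union> (B2 - A2)) < \<epsilon> / 2"
      using A by (meson S_def half_gt_zero)
    have "measure M ((A1 \<union> A2 - (B1 \<union> B2)) \<union> (B1 \<union> B2 - (A1 \<union> A2))) \<le>
        measure M (((A1 - B1) \<union> (B1 - A1)) \<union> ((A2 - B2) \<union> (B2 - A2)))"
      using A ball B by (intro finite_measure_mono) (auto simp: S_def)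
    also have "\<dots> \<le> measure M ((A1 - B1) \<union> (B1 - A1)) + measure M ((A2 - B2) \<union> (B2 - A2))"
      using A ball B by (intro measure_Un_le) (auto simp: S_def)
    also have "\<dots> < \<epsilon>" using B by simp
    finally show "\<exists>B\<in>range (beval g). measure M ((A1 \<union> A2 - B) \<union> (B - (A1 \<union> A2))) < \<epsilon>"
      using B by (intro bexI[of _ "B1 \<union> B2"] beval.Un)
  qed
  have S_Basic: "S B" if "B \<in> range (beval g)" for B
    unfolding S_def by (intro conjI allI impI bexI[of _ B]) (use that in auto)
  have "S A" if "A \<in> sigma_sets UNIV (range (beval g))" for A
    using that
  proof induction
    case (Basic B)
    then show ?case by (rule S_Basic)
  next
    case Empty
    show ?case using beval.empty_sets by (rule S_Basic)
  next
    case (Compl A)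
    show ?case unfolding S_def
    proof (intro conjI allI impI)
      show "UNIV - A \<in> sets borel" using Compl(2) by (auto simp: S_def)
      fix \<epsilon> :: real assume "0 < \<epsilon>"
      then obtain B where B: "B \<in> range (beval g)" "measure M ((A - B) \<union> (B - A)) < \<epsilon>"
        using Compl(2) by (meson S_def)
      have "(UNIV - A - (UNIV - B)) \<union> (UNIV - B - (UNIV - A)) = (A - B) \<union> (B - A)" by auto
      with B show "\<exists>B\<in>range (beval g). measure M ((UNIV - A - B) \<union> (B - (UNIV - A))) < \<epsilon>"
        by (intro bexI[of _ "UNIV - B"] beval.compl_sets) auto
    qed
  next
    case (Union A)
    have SU: "S (\<Union>i<n. A i)" for n
    proof (induction n)
      case 0 show ?case using S_Basic[OF beval.empty_sets] by simp
    next
      case (Suc n)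
      then show ?case using S_Un[OF Suc Union(2)[of n]] by (simp add: lessThan_Suc Un_commute)
    qed
    have Ab: "A i \<in> sets borel" for i using Union(2)[of i] by (simp add: S_def)
    show ?case unfolding S_def
    proof (intro conjI allI impI)
      show "(\<Union>i. A i) \<in> sets borel" using Ab by auto
      fix \<epsilon> :: real assume "0 < \<epsilon>"
      \<comment> \<open>The tail left out by the first n sets. Its mass tends to 0, so the countable
        union reduces to a finite one at the cost of \<epsilon> / 2.\<close>
      define D where "D n = (\<Union>i. A i) - (\<Union>i<n. A i)" for n
      have "(\<lambda>n. measure M (D n)) \<longlonglongrightarrow> measure M (\<Inter>n. D n)"
      proof (rule Lim_measure_decseq)
        show "range D \<subseteq> sets M" using Ab by (auto simp: D_def)
        show "decseq D" unfolding decseq_def D_def by fastforce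
      qed (simp add: emeasure_finite)
      moreover have "(\<Inter>n. D n) = {}" by (force simp: D_def)
      ultimately have "(\<lambda>n. measure M (D n)) \<longlonglongrightarrow> 0" by simp
      then have "\<forall>\<^sub>F n in sequentially. measure M (D n) < \<epsilon> / 2"
        using \<open>0 < \<epsilon>\<close> by (intro order_tendstoD) auto
      then obtain n where n: "measure M (D n) < \<epsilon> / 2" unfolding eventually_sequentially by blast
      obtain B where B: "B \<in> range (beval g)" "measure M (((\<Union>i<n. A i) - B) \<union> (B - (\<Union>i<n. A i))) < \<epsilon> / 2"
        using SU[of n] \<open>0 < \<epsilon>\<close> by (meson S_def half_gt_zero)
      have "measure M (((\<Union>i. A i) - B) \<union> (B - (\<Union>i. A i)))
        \<le> measure M (D n \<union> (((\<Union>i<n. A i) - B) \<union> (B - (\<Union>i<n. A i))))"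
        using Ab ball[OF B(1)] by (intro finite_measure_mono) (auto simp: D_def)
      also have "\<dots> \<le> measure M (D n) + measure M (((\<Union>i<n. A i) - B) \<union> (B - (\<Union>i<n. A i)))"
        using Ab ball[OF B(1)] by (intro measure_Un_le) (auto simp: D_def)
      also have "\<dots> < \<epsilon>" using n B by simp
      finally show "\<exists>B\<in>range (beval g). measure M (((\<Union>i. A i) - B) \<union> (B - (\<Union>i. A i))) < \<epsilon>"
        using B by blast
    qed
  qed
  then show ?thesis
    using A \<open>0 < \<epsilon>\<close> unfolding sigma_sets_beval S_def by blast
qed

text \<open>The sets with compact inner approximants from the algebra are stable under finite unions
  and intersections. They contain the generators themselves and, by finite subunions of generators,
  all open sets.\<close>

lemma inner_regular_beval:
  assumes M: "finite_borel M" and "0 < \<epsilon>"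
  shows "\<exists>u. compact (beval g u) \<and> beval g u \<subseteq> beval g t \<and> measure M (beval g t) - measure M (beval g u) < \<epsilon>"
proof -
  interpret finite_measure M using M by (simp add: finite_borel_def)
  have [simp]: "sets M = sets borel" and [simp]: "space M = UNIV"
    using M sets_eq_imp_space_eq[of M borel] by (auto simp: finite_borel_def)
  define R where "R A \<longleftrightarrow> A \<in> sets borel \<and>
    (\<forall>\<epsilon>>0. \<exists>K\<in>range (beval g). compact K \<and> K \<subseteq> A \<and> measure M (A - K) < \<epsilon>)" for A
  have ball: "B \<in> sets borel" if "B \<in> range (beval g)" for B
    using that by auto
  have R2: "R (A \<union> B) \<and> R (A \<inter> B)" if AB: "R A" "R B" for A B
  proof -
    have "\<exists>K\<in>range (beval g). compact K \<and> K \<subseteq> A \<union> B \<and> measure M ((A \<union> B) - K) < \<epsilon>"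
      "\<exists>K\<in>range (beval g). compact K \<and> K \<subseteq> A \<inter> B \<and> measure M ((A \<inter> B) - K) < \<epsilon>"
      if "0 < \<epsilon>" for \<epsilon> :: real
    proof -
      obtain K L where K: "K \<in> range (beval g)" "compact K" "K \<subseteq> A" "measure M (A - K) < \<epsilon> / 2"
        and L: "L \<in> range (beval g)" "compact L" "L \<subseteq> B" "measure M (B - L) < \<epsilon> / 2"
        using AB \<open>0 < \<epsilon>\<close> by (meson R_def half_gt_zero)
      have "measure M ((A - K) \<union> (B - L)) \<le> measure M (A - K) + measure M (B - L)"
        using AB ball K L by (intro measure_Un_le) (auto simp: R_def)
      also have "\<dots> < \<epsilon>" using K L by simp
      finally have *: "measure M ((A - K) \<union> (B - L)) < \<epsilon>" .
      have "measure M ((A \<union> B) - (K \<union> L)) \<le> measure M ((A - K) \<union> (B - L))"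
        "measure M ((A \<inter> B) - (K \<inter> L)) \<le> measure M ((A - K) \<union> (B - L))"
        using AB ball K L by (auto intro!: finite_measure_mono simp: R_def)
      show "\<exists>K\<in>range (beval g). compact K \<and> K \<subseteq> A \<union> B \<and> measure M ((A \<union> B) - K) < \<epsilon>"
        "\<exists>K\<in>range (beval g). compact K \<and> K \<subseteq> A \<inter> B \<and> measure M ((A \<inter> B) - K) < \<epsilon>"
      proof -
        have "K \<union> L \<in> range (beval g)" "K \<inter> L \<in> range (beval g)" "compact (K \<union> L)" "compact (K \<inter> L)"
          "K \<union> L \<subseteq> A \<union> B" "K \<inter> L \<subseteq> A \<inter> B"
          using K L by (auto simp del: image_iff intro: beval.Un beval.Int compact_Int)
        moreover have "measure M ((A \<union> B) - (K \<union> L)) < \<epsilon>" "measure M ((A \<inter> B) - (K \<inter> L)) < \<epsilon>"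
          using * \<open>measure M ((A \<union> B) - (K \<union> L)) \<le> _\<close> \<open>measure M ((A \<inter> B) - (K \<inter> L)) \<le> _\<close> by linarith+
        ultimately show "\<exists>K\<in>range (beval g). compact K \<and> K \<subseteq> A \<union> B \<and> measure M ((A \<union> B) - K) < \<epsilon>"
          "\<exists>K\<in>range (beval g). compact K \<and> K \<subseteq> A \<inter> B \<and> measure M ((A \<inter> B) - K) < \<epsilon>"
          by blast+
      qed
    qed
    moreover have "A \<in> sets borel" "B \<in> sets borel" using AB unfolding R_def by blast+
    ultimately show ?thesis by (simp add: R_def)
  qed
  have R_open: "R U" if U: "open U" for U
    unfolding R_def
  proof (intro conjI allI impI)
    fix \<epsilon> :: real assume "0 < \<epsilon>"
    obtain I where I: "U = (\<Union>i\<in>I. g i)" using U open_union by blast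
    define D where "D n = U - (\<Union>i\<in>I \<inter> {..<n}. g i)" for n
    have gb: "g i \<in> sets borel" for i by (rule borel_compact[OF compact_g])
    have "(\<lambda>n. measure M (D n)) \<longlonglongrightarrow> measure M (\<Inter>n. D n)"
    proof (rule Lim_measure_decseq)
      show "range D \<subseteq> sets M" using U gb by (auto simp: D_def)
      show "decseq D" unfolding decseq_def D_def by fastforce
    qed (simp add: emeasure_finite)
    moreover have "(\<Inter>n. D n) = {}" by (force simp: D_def I)
    ultimately have "(\<lambda>n. measure M (D n)) \<longlonglongrightarrow> 0" by simp
    then have "\<forall>\<^sub>F n in sequentially. measure M (D n) < \<epsilon>"
      using \<open>0 < \<epsilon>\<close> by (intro order_tendstoD) auto
    then obtain n where n: "measure M (D n) < \<epsilon>" unfolding eventually_sequentially by blast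
    show "\<exists>K\<in>range (beval g). compact K \<and> K \<subseteq> U \<and> measure M (U - K) < \<epsilon>"
    proof (intro bexI conjI)
      show "(\<Union>i\<in>I \<inter> {..<n}. g i) \<in> range (beval g)"
        by (rule beval.finite_UN) (auto intro: range_eqI[where x = "Gen _"])
    qed (use n in \<open>auto simp: D_def I intro!: compact_UN compact_g\<close>)
  qed (use U in auto)
  \<comment> \<open>Inner approximability does not pass to complements, so the induction carries
    both a set and its complement; the complement of a join is an intersection.\<close>
  have "R (beval g t) \<and> R (- beval g t)" for t
  proof (induction t)
    case (Gen n)
    have "R (g n)"
      unfolding R_def
    proof (intro conjI allI impI bexI[of _ "g n"])
      show "g n \<in> range (beval g)" by (rule range_eqI[where x = "Gen n"]) simp
    qed (auto intro: borel_compact compact_g)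
    moreover have "R (- g n)"
      using compact_g[of n] by (intro R_open open_Compl compact_imp_closed)
    ultimately show ?case by simp
  next
    case (Join t u)
    then show ?case using R2 by simp
  qed auto
  then have "\<exists>K\<in>range (beval g). compact K \<and> K \<subseteq> beval g t \<and> measure M (beval g t - K) < \<epsilon>"
    using \<open>0 < \<epsilon>\<close> unfolding R_def by blast
  then obtain u where u: "compact (beval g u)" "beval g u \<subseteq> beval g t" "measure M (beval g t - beval g u) < \<epsilon>"
    by auto
  then have "measure M (beval g t) - measure M (beval g u) < \<epsilon>"
    by (simp add: finite_measure_Diff)
  with u show ?thesis by blast
qed

end

lemma sigma_finite_haar:
  assumes "compact_generators (g :: nat \<Rightarrow> 'a::{haar_group, t2_space} set)"
  shows "sigma_finite_measure (haar :: 'a measure)"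
proof
  interpret compact_generators g by fact
  show "\<exists>A. countable A \<and> A \<subseteq> sets haar \<and> \<Union> A = space haar \<and> (\<forall>a\<in>A. emeasure (haar :: 'a measure) a \<noteq> \<infinity>)"
    using Union_g emeasure_haar_compact[OF compact_g]
    by (intro exI[of _ "range g"]) (auto intro!: borel_compact[OF compact_g] simp: less_top)
qed

text \<open>Haar measure may be infinite, so it is first restricted to a compact set
  \<open>C n\<close> carrying almost all of \<open>A\<close>. The finite case applies to the
  restriction, and intersecting with \<open>C n\<close> keeps the approximant in the algebra and of
  finite measure.\<close>

lemma haar_approx_beval:
  fixes A :: "'a::{haar_group, t2_space} set"
  assumes "compact_generators g" and A: "A \<in> sets borel" "emeasure haar A < \<infinity>" and "0 < \<epsilon>"
  shows "\<exists>B\<in>range (beval g). emeasure haar B < \<infinity> \<and> measure haar ((A - B) \<union> (B - A)) < \<epsilon>"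
proof -
  interpret compact_generators g by fact
  define C where "C n = (\<Union>i<n. g i)" for n
  have cC: "compact (C n)" for n
    unfolding C_def by (intro compact_UN compact_g) auto
  have Cb [measurable, simp]: "C n \<in> sets borel" for n
    by (rule borel_compact[OF cC])
  have fm: "A \<in> fmeasurable haar" using A by (simp add: fmeasurable_def)
  have "(\<lambda>n. measure haar (A - C n)) \<longlonglongrightarrow> measure haar (\<Inter>n. A - C n)"
  proof (rule Lim_measure_decseq)
    show "range (\<lambda>n. A - C n) \<subseteq> sets haar" using A by auto
    show "decseq (\<lambda>n. A - C n)"
      unfolding decseq_def C_def by fastforce
    show "emeasure haar (A - C n) \<noteq> \<infinity>" for n
      using A emeasure_mono[of "A - C n" A haar] by (auto simp: top_unique)
  qed
  moreover have "(\<Inter>n. A - C n) = {}"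
  proof -
    have "\<exists>n. x \<in> C n" for x
    proof -
      obtain i where "x \<in> g i" using Union_g by blast
      then have "x \<in> C (Suc i)" by (auto simp: C_def)
      then show ?thesis ..
    qed
    then show ?thesis by blast
  qed
  ultimately have "(\<lambda>n. measure haar (A - C n)) \<longlonglongrightarrow> 0" by (simp only: measure_empty)
  then have "\<forall>\<^sub>F n in sequentially. measure haar (A - C n) < \<epsilon> / 2"
    using \<open>0 < \<epsilon>\<close> by (intro order_tendstoD) auto
  then obtain n where n: "measure haar (A - C n) < \<epsilon> / 2" unfolding eventually_sequentially by blast
  define M where "M = density haar (indicator (C n))"
  have M: "emeasure M S = emeasure haar (C n \<inter> S)" if "S \<in> sets borel" for S
    unfolding M_def using that by (subst emeasure_restricted) auto
  then have M': "measure M S = measure haar (C n \<inter> S)" if "S \<in> sets borel" for S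
    using that by (simp add: measure_def)
  have "finite_borel M"
    unfolding finite_borel_def
  proof
    show "finite_measure M"
      using M[of UNIV] emeasure_haar_compact[OF cC[of n]]
      by (intro finite_measureI) (auto simp: M_def)
  qed (simp add: M_def)
  then obtain B where B: "B \<in> range (beval g)" "measure M ((A - B) \<union> (B - A)) < \<epsilon> / 2"
    using approx_beval[OF _ A(1), of M "\<epsilon> / 2"] \<open>0 < \<epsilon>\<close> by auto
  have Bb [simp]: "B \<in> sets borel" using B by auto
  have cfin: "C n \<inter> S \<in> fmeasurable haar" if "S \<in> sets borel" for S
  proof (rule fmeasurableI)
    have "emeasure haar (C n \<inter> S) \<le> emeasure haar (C n)"
      by (rule emeasure_mono) simp_all
    also have "\<dots> < \<infinity>" by (rule emeasure_haar_compact[OF cC])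
    finally show "emeasure haar (C n \<inter> S) < \<infinity>" .
  qed (use that in simp)
  \<comment> \<open>Outside \<open>C n\<close> only \<open>A - C n\<close> contributes; inside it
    the error is that of the restricted measure \<open>M\<close>.\<close>
  have "measure haar ((A - C n \<inter> B) \<union> (C n \<inter> B - A)) \<le> measure haar ((A - C n) \<union> (C n \<inter> ((A - B) \<union> (B - A))))"
  proof (intro measure_mono_fmeasurable fmeasurable.Un cfin)
    show "(A - C n \<inter> B) \<union> (C n \<inter> B - A) \<in> sets haar"
      unfolding sets_haar by (intro sets.Un sets.Diff sets.Int A(1) Bb Cb)
    show "A - C n \<in> fmeasurable haar" using fm by (rule fmeasurable_Diff) simp
    show "(A - B) \<union> (B - A) \<in> sets borel" by (intro sets.Un sets.Diff A(1) Bb)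
  qed auto
  also have "\<dots> \<le> measure haar (A - C n) + measure haar (C n \<inter> ((A - B) \<union> (B - A)))"
    using A Bb by (intro measure_Un_le) (simp_all only: sets_haar sets.Diff sets.Int sets.Un Cb)
  also have "\<dots> < \<epsilon>"
    using n B(2) M'[of "(A - B) \<union> (B - A)"] A(1) Bb by (simp only: sets.Diff sets.Un)
  finally have "measure haar ((A - C n \<inter> B) \<union> (C n \<inter> B - A)) < \<epsilon>" .
  moreover have "emeasure haar (C n \<inter> B) < \<infinity>" using cfin[of B] by (simp add: fmeasurable_def)
  moreover have "C n \<inter> B \<in> range (beval g)"
    unfolding C_def by (intro beval.Int B(1) UN_lessThan_beval)
  ultimately show ?thesis by blast
qed

section \<open>Countable dense families\<close>

text \<open>Rational combinations, coded by lists: appending adds and mapping scales. Their closure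
  is a real subspace since every real scalar is a limit of rationals.\<close>

lemma countable_dense_in_span:
  fixes e :: "nat \<Rightarrow> 'v::real_normed_vector"
  obtains d :: "nat \<Rightarrow> 'v"
  where "range d \<subseteq> span (range e)" "span (range e) \<subseteq> closure (range d)" "subspace (closure (range d))"
proof -
  define D where "D l = sum_list (map (\<lambda>(q, n). real_of_rat q *\<^sub>R e n) l)" for l :: "(rat \<times> nat) list"
  have D_append: "D (l @ l') = D l + D l'" for l l' by (simp add: D_def)
  have D_scale: "real_of_rat q *\<^sub>R D l = D (map (\<lambda>(p, n). (q * p, n)) l)" for q l
    by (induction l) (auto simp: D_def scaleR_add_right of_rat_mult)
  have "D l \<in> span (range e)" for l
    by (induction l) (auto simp: D_def intro!: span_add span_scale intro: span_base span_zero)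
  then have 1: "range D \<subseteq> span (range e)" by auto
  have seq: "\<exists>l. (\<lambda>n. D (l n)) \<longlonglongrightarrow> x" if x: "x \<in> closure (range D)" for x
  proof -
    obtain s where s: "\<And>n. s n \<in> range D" "s \<longlonglongrightarrow> x"
      using x unfolding closure_sequential by blast
    then have "\<forall>n. \<exists>l. s n = D l" by blast
    then obtain l where "\<And>n. s n = D (l n)" by metis
    then have "s = (\<lambda>n. D (l n))" by blast
    with s show ?thesis by blast
  qed
  have sub: "subspace (closure (range D))"
    unfolding subspace_def
  proof (intro conjI allI ballI)
    have "D [] = 0" by (simp add: D_def)
    then show "0 \<in> closure (range D)" by (metis closure_subset rangeI subsetD)
  next
    fix x y assume "x \<in> closure (range D)" "y \<in> closure (range D)"
    then obtain l m where lm: "(\<lambda>n. D (l n)) \<longlonglongrightarrow> x" "(\<lambda>n. D (m n)) \<longlonglongrightarrow> y"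
      using seq by blast
    then have "(\<lambda>n. D (l n @ m n)) \<longlonglongrightarrow> x + y"
      unfolding D_append by (rule tendsto_add)
    then show "x + y \<in> closure (range D)"
      unfolding closure_sequential by (intro exI[of _ "\<lambda>n. D (l n @ m n)"]) auto
  next
    fix c x assume "x \<in> closure (range D)"
    then obtain l where l: "(\<lambda>n. D (l n)) \<longlonglongrightarrow> x"
      using seq by blast
    have "\<exists>q. \<bar>c - real_of_rat q\<bar> < inverse (real (Suc n))" for n
    proof -
      obtain r where "r \<in> \<rat>" "c < r" "r < c + inverse (real (Suc n))"
        using Rats_dense_in_real[of c "c + inverse (real (Suc n))"] by auto
      then obtain p where "r = real_of_rat p" by (auto elim: Rats_cases)
      with \<open>c < r\<close> \<open>r < _\<close> show ?thesis by (intro exI[of _ p]) simp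
    qed
    then obtain q where q: "\<And>n. \<bar>c - real_of_rat (q n)\<bar> < inverse (real (Suc n))" by metis
    have "(\<lambda>n. c - real_of_rat (q n)) \<longlonglongrightarrow> 0"
      by (rule Lim_null_comparison[OF _ LIMSEQ_inverse_real_of_nat])
        (use q in \<open>auto intro!: always_eventually less_imp_le\<close>)
    then have "(\<lambda>n. real_of_rat (q n)) \<longlonglongrightarrow> c"
      using tendsto_diff[OF tendsto_const[of c], of "\<lambda>n. c - real_of_rat (q n)" 0 sequentially] by simp
    then have "(\<lambda>n. D (map (\<lambda>(p, i). (q n * p, i)) (l n))) \<longlonglongrightarrow> c *\<^sub>R x"
      using l unfolding D_scale[symmetric] by (intro tendsto_scaleR)
    then show "c *\<^sub>R x \<in> closure (range D)"
      unfolding closure_sequential by (intro exI[of _ "\<lambda>n. D (map (\<lambda>(p, i). (q n * p, i)) (l n))"]) auto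
  qed
  have "range e \<subseteq> closure (range D)"
  proof
    fix x assume "x \<in> range e"
    then obtain n where "x = e n" by auto
    then have "x = D [(1, n)]" by (simp add: D_def)
    then show "x \<in> closure (range D)" by (metis closure_subset rangeI subsetD)
  qed
  then have 2: "span (range e) \<subseteq> closure (range D)"
    using sub by (rule span_minimal)
  have "range (\<lambda>n. D (from_nat n)) = range D"
    using image_image[of D from_nat UNIV] by (simp add: surj_from_nat)
  with 1 2 sub show ?thesis by (intro that[of "\<lambda>n. D (from_nat n)"]) simp_all
qed

definition L2_indicator :: "'a::haar_group set \<Rightarrow> complex \<Rightarrow> 'a L2" where
  "L2_indicator A c = abs_L2 (\<lambda>x. indicator A x *\<^sub>R c)"

lemma square_integrable_indicator:
  assumes "A \<in> sets borel" "emeasure haar A < \<infinity>"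
  shows "square_integrable (\<lambda>x::'a::haar_group. indicator A x *\<^sub>R c)"
proof -
  have "(cmod (indicator A x *\<^sub>R c))\<^sup>2 = indicator A x * (cmod c)\<^sup>2" for x
    by (simp add: indicator_def)
  with assms show ?thesis by (simp add: square_integrable_def)
qed

lemma norm_abs_L2: "square_integrable f \<Longrightarrow> norm (abs_L2 f) = sqrt (LINT x|haar. (cmod (f x))\<^sup>2)"
  by (simp add: norm_L2.abs_eq L2_eq_refl)

lemma abs_L2_diff:
  "square_integrable f \<Longrightarrow> square_integrable g \<Longrightarrow> abs_L2 f - abs_L2 g = abs_L2 (\<lambda>x. f x - g x)"
  by (simp add: minus_L2.abs_eq L2_eq_refl)

lemma abs_L2_add:
  "square_integrable f \<Longrightarrow> square_integrable g \<Longrightarrow> abs_L2 f + abs_L2 g = abs_L2 (\<lambda>x. f x + g x)"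
  by (simp add: plus_L2.abs_eq L2_eq_refl)

lemma abs_L2_scaleR:
  "square_integrable f \<Longrightarrow> c *\<^sub>R abs_L2 f = abs_L2 (\<lambda>x. c *\<^sub>R f x)"
  by (simp add: scaleR_L2.abs_eq L2_eq_refl)

lemma norm_L2_indicator_diff:
  fixes A B :: "'a::haar_group set"
  assumes A: "A \<in> sets borel" "emeasure haar A < \<infinity>" and B: "B \<in> sets borel" "emeasure haar B < \<infinity>"
  shows "norm (L2_indicator A c - L2_indicator B c) = cmod c * sqrt (measure haar (sym_diff A B))"
proof -
  note si = square_integrable_indicator[OF A, of c] square_integrable_indicator[OF B, of c]
  have "(cmod (indicator A x *\<^sub>R c - indicator B x *\<^sub>R c))\<^sup>2 = indicator (sym_diff A B) x * (cmod c)\<^sup>2" for x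
    by (auto simp: indicator_def)
  then have "norm (L2_indicator A c - L2_indicator B c) = sqrt (measure haar (sym_diff A B) * (cmod c)\<^sup>2)"
    using A(1) B(1) by (simp add: L2_indicator_def abs_L2_diff si norm_abs_L2 square_integrable_diff)
  then show ?thesis by (simp add: real_sqrt_mult mult.commute)
qed

text \<open>The spans above are real, so complex multiples of an indicator need both values 1 and
  \<open>\<i>\<close> among the generators.\<close>

lemma L2_indicator_combination:
  assumes "A \<in> sets borel" "emeasure haar A < \<infinity>"
  shows "L2_indicator (A :: 'a::haar_group set) c = Re c *\<^sub>R L2_indicator A 1 + Im c *\<^sub>R L2_indicator A \<i>"
proof -
  have "c = Re c *\<^sub>R 1 + Im c *\<^sub>R \<i>" by (simp add: complex_eq_iff)
  then have "(\<lambda>x. indicator A x *\<^sub>R c) = (\<lambda>x. Re c *\<^sub>R (indicator A x *\<^sub>R 1) + Im c *\<^sub>R (indicator A x *\<^sub>R \<i>))"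
    by (auto simp: fun_eq_iff indicator_def)
  then show ?thesis
    unfolding L2_indicator_def using assms
    by (simp only: abs_L2_scaleR abs_L2_add square_integrable_indicator square_integrable_scaleR)
qed

text \<open>Dominated simple functions converge to a representative in L2, and each is a finite sum
  of indicators of sets of finite measure.\<close>

lemma L2_closed_subspace_UNIV:
  fixes V :: "'a::haar_group L2 set"
  assumes V: "closed V" "subspace V"
    and ind: "\<And>A c. A \<in> sets borel \<Longrightarrow> emeasure haar A < \<infinity> \<Longrightarrow> L2_indicator A c \<in> V"
  shows "\<xi> \<in> V"
proof -
  define f where "f = rep_L2 \<xi>"
  have f: "square_integrable f" and [measurable]: "f \<in> borel_measurable haar"
    by (simp_all add: f_def square_integrable_rep borel_measurable_haar)
  obtain F where F: "\<And>i. simple_function haar (F i)" "\<And>x. (\<lambda>i. F i x) \<longlonglongrightarrow> f x"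
      "\<And>i x. cmod (F i x) \<le> 2 * cmod (f x)"
    using borel_measurable_implies_sequence_metric[of f haar 0] by (auto simp: dist_norm)
  have Fm [measurable]: "F i \<in> borel_measurable haar" for i
    using F(1) by (rule borel_measurable_simple_function)
  have int_f: "integrable haar (\<lambda>x. (cmod (f x))\<^sup>2)" using f by (simp add: square_integrable_def)
  have F_le: "(cmod (F i x))\<^sup>2 \<le> 4 * (cmod (f x))\<^sup>2" for i x
    using power_mono[OF F(3)[of i x], of 2] by (simp add: power_mult_distrib)
  have Fsq: "square_integrable (F i)" for i
  proof -
    have "integrable haar (\<lambda>x. (cmod (F i x))\<^sup>2)"
    proof (rule Bochner_Integration.integrable_bound)
      show "integrable haar (\<lambda>x. 4 * (cmod (f x))\<^sup>2)" using int_f by simp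
      show "AE x in haar. norm ((cmod (F i x))\<^sup>2) \<le> norm (4 * (cmod (f x))\<^sup>2)"
        using F_le by simp
    qed measurable
    then show ?thesis using Fm[of i] by (simp add: square_integrable_def borel_measurable_haar)
  qed
  have "abs_L2 (F i) \<in> V" for i
  proof -
    have fin: "finite (range (F i))" and S: "F i -` {y} \<in> sets borel" for y
      using simple_functionD[OF F(1)[of i]] by simp_all
    \<comment> \<open>Chebyshev's inequality. The value 0 must be excluded, since its level set may
      have infinite measure.\<close>
    have Sfin: "emeasure haar (F i -` {y}) < \<infinity>" if "y \<noteq> 0" for y
    proof -
      have "ennreal ((cmod y)\<^sup>2) * emeasure haar (F i -` {y}) = (\<integral>\<^sup>+x. ennreal ((cmod y)\<^sup>2) * indicator (F i -` {y}) x \<partial>haar)"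
        using S by (simp add: nn_integral_cmult_indicator)
      also have "\<dots> \<le> (\<integral>\<^sup>+x. ennreal ((cmod (F i x))\<^sup>2) \<partial>haar)"
        by (intro nn_integral_mono) (auto simp: indicator_def)
      also have "\<dots> < \<infinity>" using Fsq[of i] by (simp add: square_integrable_iff_nn)
      finally show ?thesis using that by (auto simp: ennreal_mult_less_top)
    qed
    have sums: "square_integrable (\<lambda>x. \<Sum>y\<in>Y. indicator (F i -` {y}) x *\<^sub>R y) \<and>
        abs_L2 (\<lambda>x. \<Sum>y\<in>Y. indicator (F i -` {y}) x *\<^sub>R y) \<in> V" if "finite Y" for Y
      using that
    proof (induction Y)
      case empty
      have "abs_L2 (\<lambda>_. 0) = (0 :: 'a L2)" by (simp add: zero_L2_def)
      then show ?case using V by (simp add: square_integrable_zero subspace_0)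
    next
      case (insert y Y)
      have "square_integrable (\<lambda>x. indicator (F i -` {y}) x *\<^sub>R y) \<and> L2_indicator (F i -` {y}) y \<in> V"
      proof (cases "y = 0")
        case True
        have "abs_L2 (\<lambda>_. 0) = (0 :: 'a L2)" by (simp add: zero_L2_def)
        then show ?thesis using V True by (simp add: L2_indicator_def square_integrable_zero subspace_0)
      next
        case False
        then show ?thesis using square_integrable_indicator[OF S Sfin] ind[OF S Sfin] by blast
      qed
      with insert V(2) show ?case
        unfolding sum.insert[OF insert(1,2)]
        by (simp only: square_integrable_add abs_L2_add[symmetric] L2_indicator_def subspace_add simp_thms)
    qed
    have "F i = (\<lambda>x. \<Sum>y\<in>range (F i). indicator (F i -` {y}) x *\<^sub>R y)"
    proof
      fix x
      have "(\<Sum>y\<in>range (F i). indicator (F i -` {y}) x *\<^sub>R y) = (\<Sum>y\<in>range (F i). if y = F i x then y else 0)"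
        by (intro sum.cong) (auto simp: indicator_def)
      then show "F i x = (\<Sum>y\<in>range (F i). indicator (F i -` {y}) x *\<^sub>R y)"
        using fin by simp
    qed
    then have "abs_L2 (F i) = abs_L2 (\<lambda>x. \<Sum>y\<in>range (F i). indicator (F i -` {y}) x *\<^sub>R y)"
      by (rule arg_cong)
    then show ?thesis using sums[OF fin] by (simp only:)
  qed
  moreover have "(\<lambda>i. abs_L2 (F i)) \<longlonglongrightarrow> \<xi>"
  proof -
    have "(\<lambda>i. LINT x|haar. (cmod (F i x - f x))\<^sup>2) \<longlonglongrightarrow> (LINT x|haar. (cmod (f x - f x))\<^sup>2)"
    \<comment> \<open>The 9 is the square of 3, from |F - f| \<le> |F| + |f| \<le> 3 |f|.\<close>
    proof (rule integral_dominated_convergence[where w = "\<lambda>x. 9 * (cmod (f x))\<^sup>2"])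
      show "AE x in haar. (\<lambda>i. (cmod (F i x - f x))\<^sup>2) \<longlonglongrightarrow> (cmod (f x - f x))\<^sup>2"
        using F(2) by (intro AE_I2 tendsto_intros) auto
      show "AE x in haar. norm ((cmod (F i x - f x))\<^sup>2) \<le> 9 * (cmod (f x))\<^sup>2" for i
      proof (rule AE_I2)
        fix x
        have "cmod (F i x - f x) \<le> 3 * cmod (f x)"
          using norm_triangle_ineq4[of "F i x" "f x"] F(3)[of i x] by linarith
        from power_mono[OF this, of 2] show "norm ((cmod (F i x - f x))\<^sup>2) \<le> 9 * (cmod (f x))\<^sup>2"
          by (simp add: power_mult_distrib)
      qed
    qed (use int_f in auto)
    then have "(\<lambda>i. sqrt (LINT x|haar. (cmod (F i x - f x))\<^sup>2)) \<longlonglongrightarrow> sqrt 0"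
      by (intro tendsto_real_sqrt) simp
    moreover have "norm (abs_L2 (F i) - \<xi>) = sqrt (LINT x|haar. (cmod (F i x - f x))\<^sup>2)" for i
      using Fsq[of i] f by (subst abs_rep[of \<xi>, symmetric])
        (simp add: f_def[symmetric] abs_L2_diff norm_abs_L2 square_integrable_diff)
    ultimately have "(\<lambda>i. norm (abs_L2 (F i) - \<xi>)) \<longlonglongrightarrow> 0" by (simp only: real_sqrt_zero)
    then show ?thesis unfolding tendsto_norm_zero_iff by (rule LIM_zero_cancel)
  qed
  ultimately show ?thesis by (rule closed_sequentially[OF V(1)])
qed

lemma L2_countable_dense:
  fixes g :: "nat \<Rightarrow> 'a::{haar_group, t2_space} set"
  assumes g: "compact_generators g"
  shows "\<exists>d :: nat \<Rightarrow> 'a L2. closure (range d) = UNIV"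
proof -
  interpret compact_generators g by (rule g)
  define e :: "nat \<Rightarrow> 'a L2" where
    \<comment> \<open>Sets of infinite Haar measure are sent to 0, which makes the enumeration total
      without enlarging the span.\<close>
    "e n = (case from_nat n of (t, b) \<Rightarrow>
      if emeasure haar (beval g t) < \<infinity> then L2_indicator (beval g t) (if b then 1 else \<i>) else 0)" for n
  obtain d :: "nat \<Rightarrow> _" where d: "range d \<subseteq> span (range e)" "span (range e) \<subseteq> closure (range d)"
      "subspace (closure (range d))"
    by (rule countable_dense_in_span[of e])
  define V where "V = closure (range d)"
  have V: "closed V" "subspace V"
    using d(3) by (simp_all add: V_def)
  have gen: "L2_indicator (beval g t) c \<in> V" if "emeasure haar (beval g t) < \<infinity>" for t c
  proof -
    have "e (to_nat (t, True)) = L2_indicator (beval g t) 1" "e (to_nat (t, False)) = L2_indicator (beval g t) \<i>"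
      using that by (simp_all add: e_def)
    then have "L2_indicator (beval g t) 1 \<in> span (range e)" "L2_indicator (beval g t) \<i> \<in> span (range e)"
      by (metis rangeI span_base)+
    then have "L2_indicator (beval g t) c \<in> span (range e)"
      unfolding L2_indicator_combination[OF sets_beval that, of c] by (intro span_add span_scale)
    then show ?thesis using d(2) unfolding V_def by blast
  qed
  have "L2_indicator A c \<in> V" if A: "A \<in> sets borel" "emeasure haar A < \<infinity>" for A c
  proof -
    have "\<exists>v\<in>V. dist v (L2_indicator A c) < r" if "0 < r" for r
    proof -
      \<comment> \<open>The distance of the two indicators is |c| times the square root of this
        measure, hence the squared tolerance; the added 1 covers \<open>c = 0\<close>.\<close>
      obtain t where t: "emeasure haar (beval g t) < \<infinity>"
        "measure haar (sym_diff A (beval g t)) < (r / (cmod c + 1))\<^sup>2"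
        using haar_approx_beval[OF g A, of "(r / (cmod c + 1))\<^sup>2"] \<open>0 < r\<close>
        by (fastforce simp: add_nonneg_eq_0_iff)
      then have "sqrt (measure haar (sym_diff A (beval g t))) < r / (cmod c + 1)"
        using \<open>0 < r\<close> by (intro real_less_lsqrt) auto
      then have "(cmod c + 1) * sqrt (measure haar (sym_diff A (beval g t))) < r"
        by (simp add: field_simps add_pos_nonneg pos_less_divide_eq)
      then have "cmod c * sqrt (measure haar (sym_diff A (beval g t))) < r"
        by (simp add: distrib_right) (smt (verit) real_sqrt_ge_zero measure_nonneg)
      then show ?thesis
        using gen[OF t(1), of c] norm_L2_indicator_diff[OF A sets_beval t(1), of c]
        by (intro bexI[of _ "L2_indicator (beval g t) c"]) (simp_all add: dist_norm norm_minus_commute)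
    qed
    then have "L2_indicator A c \<in> closure V" by (simp add: closure_approachable)
    then show ?thesis using V(1) by simp
  qed
  then have "UNIV \<subseteq> V"
    using L2_closed_subspace_UNIV[OF V] by blast
  then show ?thesis unfolding V_def by blast
qed

text \<open>Indicators of finite-measure members of the algebra generate L1, and
  \<open>norm_L1_op_le\<close> carries density over to the operator norm. The subspace clause later
  allows a witness to be rescaled.\<close>

lemma reduced_group_algebra_countable_dense:
  fixes g :: "nat \<Rightarrow> 'a::{haar_group, t2_space, second_countable_topology} set"
  assumes g: "compact_generators g"
  obtains d :: "nat \<Rightarrow> 'a L2 \<Rightarrow>\<^sub>L 'a L2"
  where "closure (range d) = reduced_group_algebra" "subspace (closure (range d))"
proof -
  interpret compact_generators g by (rule g)
  note haar = sigma_finite_haar[OF g]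
  define W where "W = {L1_op f | f :: 'a \<Rightarrow> complex. integrable haar f}"
  define e :: "nat \<Rightarrow> 'a L2 \<Rightarrow>\<^sub>L 'a L2" where
    "e n = (case from_nat n of (t, b) \<Rightarrow> if emeasure haar (beval g t) < \<infinity>
      then L1_op (\<lambda>x. indicator (beval g t) x *\<^sub>R (if b then 1 else \<i>)) else 0)" for n
  obtain d :: "nat \<Rightarrow> _" where d: "range d \<subseteq> span (range e)" "span (range e) \<subseteq> closure (range d)"
      "subspace (closure (range d))"
    by (rule countable_dense_in_span[of e])
  have int: "integrable haar (\<lambda>x. indicator A x *\<^sub>R (c :: complex))"
    if "A \<in> sets borel" "emeasure haar A < \<infinity>" for A :: "'a set" and c
    using that by simp
  have "L1_op (\<lambda>_ :: 'a. 0) = 0"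
    using L1_op_scaleR[OF haar, of "\<lambda>_. 0" 0] by simp
  then have W: "subspace W" "0 \<in> W"
  proof -
    show "0 \<in> W" using \<open>L1_op (\<lambda>_ :: 'a. 0) = 0\<close> unfolding W_def
      by (intro CollectI exI[of _ "\<lambda>_. 0"]) simp
    then show "subspace W"
      unfolding subspace_def W_def
      by (auto simp: L1_op_add[OF haar, symmetric] L1_op_scaleR[OF haar, symmetric]
          intro: Bochner_Integration.integrable_add integrable_scaleR_right)
  qed
  have "e n \<in> W" for n
  proof -
    obtain t :: bexp and b :: bool where tb: "from_nat n = (t, b)" by (cases "from_nat n :: bexp \<times> bool") blast
    show ?thesis
    proof (cases "emeasure haar (beval g t) < \<infinity>")
      case True
      then have "e n = L1_op (\<lambda>x. indicator (beval g t) x *\<^sub>R (if b then 1 else \<i>))"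
        by (simp add: e_def tb)
      then show ?thesis using int[OF sets_beval True] unfolding W_def by blast
    qed (use W(2) in \<open>simp add: e_def tb\<close>)
  qed
  then have "range e \<subseteq> W" by blast
  then have "span (range e) \<subseteq> W" by (rule span_minimal[OF _ W(1)])
  then have 1: "closure (range d) \<subseteq> closure W" using d(1) by (intro closure_mono) blast
  define V where "V = closure (range d)"
  have V: "closed V" "subspace V"
    using d(3) by (simp_all add: V_def)
  have gen: "L1_op (\<lambda>x. indicator (beval g t) x *\<^sub>R c) \<in> V" if "emeasure haar (beval g t) < \<infinity>" for t c
  proof -
    have "e (to_nat (t, True)) = L1_op (\<lambda>x. indicator (beval g t) x *\<^sub>R 1)"
        "e (to_nat (t, False)) = L1_op (\<lambda>x. indicator (beval g t) x *\<^sub>R \<i>)"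
      using that by (simp_all add: e_def)
    then have "L1_op (\<lambda>x. indicator (beval g t) x *\<^sub>R 1) \<in> span (range e)"
        "L1_op (\<lambda>x. indicator (beval g t) x *\<^sub>R \<i>) \<in> span (range e)"
      by (metis rangeI span_base)+
    then have *: "Re c *\<^sub>R L1_op (\<lambda>x. indicator (beval g t) x *\<^sub>R 1) +
        Im c *\<^sub>R L1_op (\<lambda>x. indicator (beval g t) x *\<^sub>R \<i>) \<in> span (range e)"
      by (intro span_add span_scale)
    have "c = Re c *\<^sub>R 1 + Im c *\<^sub>R \<i>" by (simp add: complex_eq_iff)
    then have "(\<lambda>x. indicator (beval g t) x *\<^sub>R c) = (\<lambda>x. Re c *\<^sub>R (indicator (beval g t) x *\<^sub>R 1) +
        Im c *\<^sub>R (indicator (beval g t) x *\<^sub>R \<i>))"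
      by (auto simp: fun_eq_iff indicator_def)
    then have "L1_op (\<lambda>x. indicator (beval g t) x *\<^sub>R c) \<in> span (range e)"
      using * int[OF sets_beval that]
      by (simp only: L1_op_add[OF haar] L1_op_scaleR[OF haar] integrable_scaleR_right)
    then show ?thesis using d(2) unfolding V_def by blast
  qed
  \<comment> \<open>Closedness of \<open>V\<close> under L1 limits of the underlying functions; it
    serves both the indicator case and the limit case below.\<close>
  have approx: "L1_op f \<in> V"
    if f: "integrable haar f" and h: "\<And>r. 0 < r \<Longrightarrow> \<exists>h. integrable haar h \<and> L1_op h \<in> V \<and> (LINT x|haar. cmod (h x - f x)) < r"
    for f :: "'a \<Rightarrow> complex"
  proof -
    have "\<exists>v\<in>V. dist v (L1_op f) < r" if "0 < r" for r
    proof -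
      obtain h where h: "integrable haar h" "L1_op h \<in> V" "(LINT x|haar. cmod (h x - f x)) < r / 2"
        using h[of "r / 2"] \<open>0 < r\<close> by auto
      have "norm (L1_op h - L1_op f) \<le> 2 * (LINT x|haar. cmod (h x - f x))"
        unfolding L1_op_diff[OF haar h(1) f, symmetric] using h f by (intro norm_L1_op_le[OF haar]) simp
      also have "\<dots> < r" using h(3) by simp
      finally show ?thesis using h(2) by (intro bexI[of _ "L1_op h"]) (simp_all add: dist_norm)
    qed
    then have "L1_op f \<in> closure V" by (simp add: closure_approachable)
    then show ?thesis using V(1) by simp
  qed
  \<comment> \<open>Induction over integrable functions: scaled indicators, sums, and dominated
    pointwise limits.\<close>
  have "L1_op f \<in> V" if "integrable haar f" for f :: "'a \<Rightarrow> complex"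
    using that
  proof induction
    case (base A c)
    then have A: "A \<in> sets borel" "emeasure haar A < \<infinity>" by simp_all
    show ?case
    proof (rule approx)
      show "integrable haar (\<lambda>x. indicat_real A x *\<^sub>R c)" using int[OF A] .
      fix r :: real assume "0 < r"
      then obtain t where t: "emeasure haar (beval g t) < \<infinity>"
        "measure haar (sym_diff A (beval g t)) < r / (cmod c + 1)"
        using haar_approx_beval[OF g A, of "r / (cmod c + 1)"]
        by (fastforce simp: add_nonneg_eq_0_iff intro!: divide_pos_pos add_nonneg_pos)
      have "cmod (indicator (beval g t) x *\<^sub>R c - indicator A x *\<^sub>R c) = indicator (sym_diff A (beval g t)) x * cmod c" for x
        by (auto simp: indicator_def)
      then have "(LINT x|haar. cmod (indicator (beval g t) x *\<^sub>R c - indicator A x *\<^sub>R c)) =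
          measure haar (sym_diff A (beval g t)) * cmod c"
        using A(1) by simp
      also have "\<dots> \<le> measure haar (sym_diff A (beval g t)) * (cmod c + 1)"
        by (intro mult_left_mono) auto
      also have "\<dots> < r"
        using t(2) by (simp add: pos_less_divide_eq add_nonneg_pos)
      finally show "\<exists>h. integrable haar h \<and> L1_op h \<in> V \<and> (LINT x|haar. cmod (h x - indicat_real A x *\<^sub>R c)) < r"
        using gen[OF t(1)] int[OF sets_beval t(1)] by blast
    qed
  next
    case (add f h)
    then show ?case using V(2) by (simp add: L1_op_add[OF haar] subspace_add)
  next
    case (lim f s)
    show ?case
    proof (rule approx)
      fix r :: real assume "0 < r"
      have "(\<lambda>i. LINT x|haar. cmod (s i x - f x)) \<longlonglongrightarrow> (LINT x|haar. cmod (f x - f x))"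
      proof (rule integral_dominated_convergence[where w = "\<lambda>x. 3 * cmod (f x)"])
        show "AE x in haar. (\<lambda>i. cmod (s i x - f x)) \<longlonglongrightarrow> cmod (f x - f x)"
          using lim(2) by (intro AE_I2 tendsto_intros) auto
        show "AE x in haar. norm (cmod (s i x - f x)) \<le> 3 * cmod (f x)" for i
        proof (rule AE_I2)
          fix x
          show "norm (cmod (s i x - f x)) \<le> 3 * cmod (f x)"
            using norm_triangle_ineq4[of "s i x" "f x"] lim(3)[of x i] by simp
        qed
        show "(\<lambda>x. cmod (s i x - f x)) \<in> borel_measurable haar" for i
          using lim(1)[of i] lim(4) by (auto intro!: borel_measurable_norm borel_measurable_diff borel_measurable_integrable)
      qed (use lim in auto)
      then have "(\<lambda>i. LINT x|haar. cmod (s i x - f x)) \<longlonglongrightarrow> 0" by simp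
      then have "\<forall>\<^sub>F i in sequentially. (LINT x|haar. cmod (s i x - f x)) < r"
        using \<open>0 < r\<close> by (intro order_tendstoD) auto
      then obtain i where "(LINT x|haar. cmod (s i x - f x)) < r"
        unfolding eventually_sequentially by blast
      then show "\<exists>h. integrable haar h \<and> L1_op h \<in> V \<and> (LINT x|haar. cmod (h x - f x)) < r"
        using lim(1,5) by blast
    qed (rule lim(4))
  qed
  then have "W \<subseteq> V" by (auto simp: W_def)
  then have "closure W \<subseteq> closure (range d)" unfolding V_def by (rule closure_minimal) simp
  with 1 have "closure (range d) = closure W" by blast
  then have "closure (range d) = reduced_group_algebra"
    unfolding reduced_group_algebra_eq[OF haar] W_def .
  then show ?thesis using d(3) by (rule that)
qed

section \<open>Coding finite measures by real sequences\<close>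

context compact_generators
begin

text \<open>
  Inner regularity by compact members of the algebra is a countable condition that holds for every
  finite Borel measure and forces a finitely additive set function to be countably additive.
\<close>

definition valid_code :: "(bexp \<Rightarrow> real) \<Rightarrow> bool" where
  "valid_code y \<longleftrightarrow> (\<forall>t. 0 \<le> y t) \<and>
    (\<forall>t u v. beval g t \<inter> beval g u = {} \<longrightarrow> beval g v = beval g t \<union> beval g u \<longrightarrow> y v = y t + y u) \<and>
    (\<forall>t n. \<exists>u. (compact (beval g u) \<and> beval g u \<subseteq> beval g t) \<and> y t - y u \<le> 1 / real (Suc n)) \<and>
    (\<forall>t. beval g t = UNIV \<longrightarrow> y t \<le> 1)"

text \<open>A code assigns numbers to terms. Additivity gives a term for the empty set the value 0,
  and joining with that term shows that terms denoting the same set have the same value.\<close>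

lemma beval_set_function:
  assumes y: "valid_code y"
  obtains F :: "'a set \<Rightarrow> real" where "\<And>t. F (beval g t) = y t" "F {} = 0"
    "\<And>A. A \<in> range (beval g) \<Longrightarrow> 0 \<le> F A"
    "\<And>A B. A \<in> range (beval g) \<Longrightarrow> B \<in> range (beval g) \<Longrightarrow> A \<inter> B = {} \<Longrightarrow> F (A \<union> B) = F A + F B"
proof -
  have add: "y v = y t + y u" if "beval g t \<inter> beval g u = {}" "beval g v = beval g t \<union> beval g u" for t u v
    using y that unfolding valid_code_def by blast
  obtain z where z: "beval g z = {}" using beval.empty_sets by (metis imageE)
  have yz: "y z = 0" using add[of z z z] z by simp
  have cong: "y t = y u" if "beval g t = beval g u" for t u
  proof -
    have "y t = y z + y u" by (rule add) (simp_all only: z that Int_empty_left Un_empty_left)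
    then show ?thesis using yz by simp
  qed
  define F where "F A = y (SOME t. beval g t = A)" for A
  have F: "F (beval g t) = y t" for t
    unfolding F_def by (rule cong, rule someI[where P = "\<lambda>u. beval g u = beval g t"]) simp
  show ?thesis
  proof (rule that)
    show "F {} = 0" using F[of z] yz z by simp
    show "0 \<le> F A" if "A \<in> range (beval g)" for A
      using that y by (auto simp: F valid_code_def)
    show "F (A \<union> B) = F A + F B" if AB: "A \<in> range (beval g)" "B \<in> range (beval g)" "A \<inter> B = {}" for A B
    proof -
      obtain t u where tu: "A = beval g t" "B = beval g u" using AB by auto
      have "F (beval g (Join t u)) = y t + y u" unfolding F using AB tu by (intro add) auto
      then show ?thesis by (simp add: tu F)
    qed
  qed (rule F)
qed

text \<open>Caratheodory's theorem asks for continuity at the empty set. Each \<open>A i\<close> is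
  replaced by a compact subset with small loss; once finitely many of these have empty intersection,
  only the losses remain.\<close>

lemma ex_code_measure:
  assumes y: "valid_code y"
  shows "\<exists>m. finite_borel m \<and> emeasure m UNIV \<le> 1 \<and> (\<forall>t. measure m (beval g t) = y t)"
proof -
  obtain F where F: "\<And>t. F (beval g t) = y t" "F {} = 0"
    "\<And>A. A \<in> range (beval g) \<Longrightarrow> 0 \<le> F A"
    "\<And>A B. A \<in> range (beval g) \<Longrightarrow> B \<in> range (beval g) \<Longrightarrow> A \<inter> B = {} \<Longrightarrow> F (A \<union> B) = F A + F B"
    using beval_set_function[OF y] by metis
  have mono: "F A \<le> F B" if "A \<in> range (beval g)" "B \<in> range (beval g)" "A \<subseteq> B" for A B
  proof -
    have "B - A \<in> range (beval g)" using that by (intro beval.Diff)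
    then have "F (A \<union> (B - A)) = F A + F (B - A)" "0 \<le> F (B - A)"
      using F(4)[OF that(1), of "B - A"] F(3)[of "B - A"] by auto
    moreover have "A \<union> (B - A) = B" using that by auto
    ultimately show ?thesis by simp
  qed
  have subadd: "F (A \<union> B) \<le> F A + F B" if AB: "A \<in> range (beval g)" "B \<in> range (beval g)" for A B
  proof -
    have D: "B - A \<in> range (beval g)" using AB by (intro beval.Diff)
    have "F (A \<union> (B - A)) = F A + F (B - A)" using AB(1) D by (rule F) auto
    moreover have "F (B - A) \<le> F B" using D AB(2) by (rule mono) auto
    moreover have "A \<union> (B - A) = A \<union> B" by auto
    ultimately show ?thesis by simp
  qed
  have inner: "\<exists>K\<in>range (beval g). compact K \<and> K \<subseteq> A \<and> F (A - K) \<le> \<delta>"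
    if A: "A \<in> range (beval g)" and "0 < \<delta>" for A \<delta>
  proof -
    obtain t where t: "A = beval g t" using A by auto
    obtain n where n: "1 / real (Suc n) < \<delta>" using \<open>0 < \<delta>\<close> nat_approx_posE by blast
    obtain u where u: "compact (beval g u)" "beval g u \<subseteq> beval g t" "y t - y u \<le> 1 / real (Suc n)"
      using y unfolding valid_code_def by blast
    have "F (beval g u \<union> (A - beval g u)) = F (beval g u) + F (A - beval g u)"
      using A by (intro F beval.Diff) auto
    moreover have "beval g u \<union> (A - beval g u) = A" using u t by auto
    ultimately have "F (A - beval g u) \<le> \<delta>" using u(3) n by (simp add: t F(1))
    with u t show ?thesis by (intro bexI[of _ "beval g u"]) auto
  qed
  have "\<exists>\<mu>. (\<forall>S\<in>range (beval g). \<mu> S = ennreal (F S)) \<and> measure_space UNIV (sigma_sets UNIV (range (beval g))) \<mu>"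
  proof (rule beval.caratheodory_empty_continuous)
    show "positive (range (beval g)) (\<lambda>S. ennreal (F S))" by (simp add: positive_def F(2))
    show "additive (range (beval g)) (\<lambda>S. ennreal (F S))"
      unfolding additive_def
    proof (intro ballI impI)
      fix A B assume AB: "A \<in> range (beval g)" "B \<in> range (beval g)" "A \<inter> B = {}"
      show "ennreal (F (A \<union> B)) = ennreal (F A) + ennreal (F B)"
        unfolding F(4)[OF AB] using F(3) AB by (intro ennreal_plus) blast+
    qed
    show "ennreal (F A) \<noteq> \<infinity>" for A by simp
    fix A :: "nat \<Rightarrow> 'a set"
    assume A: "range A \<subseteq> range (beval g)" "decseq A" "(\<Inter>i. A i) = {}"
    have Ar: "A i \<in> range (beval g)" for i using A(1) by blast
    have "(\<lambda>i. F (A i)) \<longlonglongrightarrow> 0"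
    proof (rule LIMSEQ_I)
      fix \<epsilon> :: real assume "0 < \<epsilon>"
      \<comment> \<open>The weights sum to less than \<epsilon> / 2, so all losses together stay
        below \<epsilon>.\<close>
      have "\<forall>i. \<exists>K. K \<in> range (beval g) \<and> compact K \<and> K \<subseteq> A i \<and> F (A i - K) \<le> \<epsilon> / 4 * (1/2) ^ i"
      proof
        fix i
        have "0 < \<epsilon> / 4 * (1/2) ^ i" using \<open>0 < \<epsilon>\<close> by simp
        from inner[OF Ar this, of i] show "\<exists>K. K \<in> range (beval g) \<and> compact K \<and> K \<subseteq> A i \<and> F (A i - K) \<le> \<epsilon> / 4 * (1/2) ^ i"
          by blast
      qed
      from choice[OF this] obtain K where K: "\<And>i. K i \<in> range (beval g)" "\<And>i. compact (K i)"
        "\<And>i. K i \<subseteq> A i" "\<And>i. F (A i - K i) \<le> \<epsilon> / 4 * (1/2) ^ i" by blast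
      define L where "L n = (\<Inter>i\<le>n. K i)" for n
      have L0: "L 0 = K 0" and LSuc: "L (Suc n) = L n \<inter> K (Suc n)" for n
        by (auto simp: L_def atMost_Suc)
      have Lr: "L n \<in> range (beval g)" for n
        by (induction n) (simp_all only: L0 LSuc K beval.Int)
      have bound: "F (A n - L n) \<le> (\<Sum>i\<le>n. \<epsilon> / 4 * (1/2) ^ i)" for n
      proof (induction n)
        case 0 show ?case using K(4)[of 0] by (simp add: L0)
      next
        case (Suc n)
        have r: "A n - L n \<in> range (beval g)" "A (Suc n) - K (Suc n) \<in> range (beval g)"
          "A (Suc n) - L (Suc n) \<in> range (beval g)"
          by (intro beval.Diff Ar Lr K)+
        have "A (Suc n) - L (Suc n) \<subseteq> (A n - L n) \<union> (A (Suc n) - K (Suc n))"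
          using decseqD[OF A(2), of n "Suc n"] by (auto simp: LSuc)
        then have "F (A (Suc n) - L (Suc n)) \<le> F ((A n - L n) \<union> (A (Suc n) - K (Suc n)))"
          using r by (intro mono beval.Un)
        also have "\<dots> \<le> F (A n - L n) + F (A (Suc n) - K (Suc n))" using r by (intro subadd)
        finally show ?case using Suc K(4)[of "Suc n"] by simp
      qed
      have geom: "(\<Sum>i\<le>n. \<epsilon> / 4 * (1/2) ^ i) < \<epsilon>" for n
      proof -
        have "(\<Sum>i\<le>n. (1/2::real) ^ i) = 2 - (1/2) ^ n"
          by (induction n) auto
        then have "(\<Sum>i\<le>n. \<epsilon> / 4 * (1/2) ^ i) = \<epsilon> / 4 * (2 - (1/2) ^ n)"
          by (simp only: sum_distrib_left[symmetric])
        also have "\<dots> \<le> \<epsilon> / 4 * 2" using \<open>0 < \<epsilon>\<close> by (intro mult_left_mono) auto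
        also have "\<dots> < \<epsilon>" using \<open>0 < \<epsilon>\<close> by simp
        finally show ?thesis .
      qed
      \<comment> \<open>If all finite intersections were nonempty, compactness would give a point
        common to all \<open>K i\<close>, hence to all \<open>A i\<close>.\<close>
      have "\<exists>N. L N = {}"
      proof (rule ccontr)
        assume ne: "\<nexists>N. L N = {}"
        have "K 0 \<inter> (\<Inter>(range K)) \<noteq> {}"
        proof (rule compact_imp_fip[OF K(2)])
          show "closed T" if "T \<in> range K" for T
            using that K(2) by (auto intro: compact_imp_closed)
          show "K 0 \<inter> \<Inter> F' \<noteq> {}" if F': "finite F'" "F' \<subseteq> range K" for F'
          proof -
            obtain I where I: "finite I" "F' = K ` I"
              using finite_subset_image[OF F'] by blast
            have "L (Max (insert 0 I)) \<subseteq> K 0 \<inter> \<Inter> F'"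
              using I by (auto simp: L_def)
            with ne show ?thesis by blast
          qed
        qed
        then obtain x where "x \<in> \<Inter>(range K)" by blast
        then have "x \<in> A i" for i using K(3)[of i] by (simp add: INT_iff) blast
        then have "x \<in> (\<Inter>i. A i)" by blast
        then show False unfolding A(3) by simp
      qed
      then obtain N where N: "L N = {}" by blast
      have "norm (F (A n) - 0) < \<epsilon>" if "N \<le> n" for n
      proof -
        have "F (A n) \<le> F (A N)" using decseqD[OF A(2) that] by (intro mono Ar)
        also have "\<dots> < \<epsilon>" using bound[of N] geom[of N] by (simp add: N)
        finally show ?thesis using F(3)[OF Ar] by simp
      qed
      then show "\<exists>N. \<forall>n\<ge>N. norm (F (A n) - 0) < \<epsilon>" by blast
    qed
    then have "(\<lambda>i. ennreal (F (A i))) \<longlonglongrightarrow> ennreal 0" by (rule tendsto_ennrealI)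
    then show "(\<lambda>i. ennreal (F (A i))) \<longlonglongrightarrow> 0" by simp
  qed
  then obtain \<mu> where \<mu>: "\<And>S. S \<in> range (beval g) \<Longrightarrow> \<mu> S = ennreal (F S)" "measure_space UNIV (sets borel) \<mu>"
    unfolding sigma_sets_beval by blast
  define m where "m = measure_of UNIV (sets borel) \<mu>"
  have sets_m: "sets m = sets borel"
    using sets.sigma_sets_eq[of "borel :: 'a measure"] unfolding m_def by (subst sets_measure_of) auto
  have space_m: "space m = UNIV" using sets_eq_imp_space_eq[OF sets_m] by simp
  have em: "emeasure m S = \<mu> S" if "S \<in> sets borel" for S
    unfolding m_def using \<mu>(2) that by (subst emeasure_measure_of_sigma) (auto simp: measure_space_def)
  have emt: "emeasure m (beval g t) = ennreal (y t)" for t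
    using em[OF sets_beval] \<mu>(1)[of "beval g t"] by (simp add: F(1))
  obtain o' where o': "beval g o' = UNIV" using beval.top by (metis imageE)
  have o1: "emeasure m UNIV = ennreal (y o')" "y o' \<le> 1"
    using emt[of o'] y o' by (simp_all add: valid_code_def)
  show ?thesis
  proof (intro exI[of _ m] conjI allI)
    show "finite_borel m"
      unfolding finite_borel_def using o1 sets_m by (auto intro!: finite_measureI simp: space_m)
    show "emeasure m UNIV \<le> 1" using o1 by (simp add: ennreal_le_1)
    show "measure m (beval g t) = y t" for t
      using emt[of t] y by (simp add: measure_def valid_code_def)
  qed
qed

text \<open>The default null measure makes every sequence a code of some finite measure, so no
  validity condition has to accompany a code later.\<close>

definition code_measure :: "(bexp \<Rightarrow> real) \<Rightarrow> 'a measure" where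
  "code_measure y = (if valid_code y
     then SOME m. finite_borel m \<and> emeasure m UNIV \<le> 1 \<and> (\<forall>t. measure m (beval g t) = y t)
     else null_measure borel)"

lemma code_measure_valid:
  assumes "valid_code y"
  shows "finite_borel (code_measure y)" "emeasure (code_measure y) UNIV \<le> 1"
    "measure (code_measure y) (beval g t) = y t"
  using someI_ex[OF ex_code_measure[OF assms]] assms by (simp_all add: code_measure_def)

lemma code_measure_invalid: "\<not> valid_code y \<Longrightarrow> code_measure y = null_measure borel"
  by (simp add: code_measure_def)

lemma finite_borel_null: "finite_borel (null_measure borel)"
  unfolding finite_borel_def by (auto intro: finite_measureI)

lemma finite_borel_code_measure: "finite_borel (code_measure y)"
  using code_measure_valid code_measure_invalid finite_borel_null by metis

lemma sets_code_measure [simp, measurable_cong]: "sets (code_measure y) = sets borel"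
  using finite_borel_code_measure[of y] by (simp add: finite_borel_def)

lemma finite_borel_eqI:
  assumes m: "finite_borel m" "finite_borel m'" and eq: "\<And>t. measure m (beval g t) = measure m' (beval g t)"
  shows "m = m'"
proof (rule measure_eqI_generator_eq[where A = "\<lambda>_. UNIV" and E = "range (beval g)" and \<Omega> = UNIV])
  interpret m: finite_measure m using m by (simp add: finite_borel_def)
  interpret m': finite_measure m' using m by (simp add: finite_borel_def)
  show "Int_stable (range (beval g))" by (auto simp: Int_stable_def simp del: image_iff intro: beval.Int)
  show "emeasure m X = emeasure m' X" if "X \<in> range (beval g)" for X
    using that eq by (auto simp: m.emeasure_eq_measure m'.emeasure_eq_measure)
  show "sets m = sigma_sets UNIV (range (beval g))" "sets m' = sigma_sets UNIV (range (beval g))"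
    using m by (simp_all add: finite_borel_def sigma_sets_beval)
  show "emeasure m UNIV \<noteq> \<infinity>" by (rule m.emeasure_finite[unfolded infinity_ennreal_def[symmetric]])
  show "range (\<lambda>_. UNIV) \<subseteq> range (beval g)" using beval.top by blast
qed auto

text \<open>Surjectivity of the coding: inner regularity makes the family of masses a valid code,
  and a finite measure is determined by its values on the algebra.\<close>

lemma code_measure_code:
  assumes m: "finite_borel m" "emeasure m UNIV \<le> 1"
  shows "code_measure (\<lambda>t. measure m (beval g t)) = m"
proof -
  interpret finite_measure m using m by (simp add: finite_borel_def)
  have [simp]: "sets m = sets borel" using m by (simp add: finite_borel_def)
  have "valid_code (\<lambda>t. measure m (beval g t))"
    unfolding valid_code_def
  proof (intro conjI allI impI)
    fix t u v assume "beval g t \<inter> beval g u = {}" "beval g v = beval g t \<union> beval g u"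
    then show "measure m (beval g v) = measure m (beval g t) + measure m (beval g u)"
      by (simp add: finite_measure_Union)
  next
    fix t n
    show "\<exists>u. (compact (beval g u) \<and> beval g u \<subseteq> beval g t) \<and>
        measure m (beval g t) - measure m (beval g u) \<le> 1 / real (Suc n)"
      using inner_regular_beval[OF m(1), of "1 / real (Suc n)" t] by (auto intro: less_imp_le)
  next
    fix t assume "beval g t = UNIV"
    then show "measure m (beval g t) \<le> 1" using m(2) by (simp add: emeasure_eq_measure)
  qed simp
  then show ?thesis
    using m by (intro finite_borel_eqI finite_borel_code_measure) (simp_all add: code_measure_valid)
qed

text \<open>One real sequence carries a separate code for each i, interleaved through
  \<open>to_nat\<close>, so four measures fit into a single point of
  \<open>nat \<Rightarrow> real\<close>.\<close>

definition nth_measure :: "nat \<Rightarrow> (nat \<Rightarrow> real) \<Rightarrow> 'a measure" where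
  "nth_measure i z = code_measure (\<lambda>t. z (to_nat (i, t)))"

lemma finite_borel_nth_measure: "finite_borel (nth_measure i z)"
  by (simp add: nth_measure_def finite_borel_code_measure)

lemma coordinate_measurable [measurable]: "(\<lambda>z :: nat \<Rightarrow> real. z n) \<in> borel_measurable borel"
  by (intro borel_measurable_continuous_onI continuous_on_product_coordinates)

text \<open>Measurability into the Giry space is checked on the generating algebra, where the mass
  is a coordinate on the Borel set of valid codes and 0 elsewhere. It yields measurability in z of
  integrals of Borel functions.\<close>

lemma nth_measure_measurable: "nth_measure i \<in> borel \<rightarrow>\<^sub>M subprob_algebra borel"
proof (rule measurable_subprob_algebra_generated[where \<Omega> = UNIV and G = "range (beval g)"])
  show "sets (borel :: 'a measure) = sigma_sets UNIV (range (beval g))" by (simp add: sigma_sets_beval)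
  show "Int_stable (range (beval g))" by (auto simp: Int_stable_def simp del: image_iff intro: beval.Int)
  show "sets (nth_measure i z) = sets borel" for z by (simp add: nth_measure_def)
  show "subprob_space (nth_measure i z)" for z
  proof (rule subprob_spaceI)
    have "space (nth_measure i z) = UNIV"
      using finite_borel_nth_measure[of i z] sets_eq_imp_space_eq[of "nth_measure i z" borel]
      by (simp add: finite_borel_def)
    moreover have "emeasure (nth_measure i z) UNIV \<le> 1"
      unfolding nth_measure_def by (cases "valid_code (\<lambda>t. z (to_nat (i, t)))")
        (simp_all add: code_measure_valid code_measure_invalid)
    ultimately show "emeasure (nth_measure i z) (space (nth_measure i z)) \<le> 1"
      "space (nth_measure i z) \<noteq> {}" by simp_all
  qed
  have *: "(\<lambda>z. emeasure (nth_measure i z) (beval g t)) \<in> borel_measurable borel" for t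
  proof -
    have "emeasure (nth_measure i z) (beval g t) =
      (if valid_code (\<lambda>t. z (to_nat (i, t))) then ennreal (z (to_nat (i, t))) else 0)" for z
    proof (cases "valid_code (\<lambda>t. z (to_nat (i, t)))")
      case True
      then interpret finite_measure "nth_measure i z"
        using finite_borel_nth_measure by (simp add: finite_borel_def)
      show ?thesis using True
        by (simp add: emeasure_eq_measure) (simp add: nth_measure_def code_measure_valid)
    qed (simp add: nth_measure_def code_measure_invalid)
    moreover have eq [measurable]: "Measurable.pred borel (\<lambda>z :: nat \<Rightarrow> real. z k = z l + z n)" for k l n
      unfolding pred_def by (rule borel_measurable_eq) measurable
    have [measurable]: "Measurable.pred borel (\<lambda>z :: nat \<Rightarrow> real. valid_code (\<lambda>t. z (to_nat (i, t))))"
      unfolding valid_code_def by (intro pred_intros_logic pred_intros_countable eq) measurable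
    ultimately show ?thesis by simp
  qed
  then show "(\<lambda>z. emeasure (nth_measure i z) A) \<in> borel_measurable borel" if "A \<in> range (beval g)" for A
    using that by auto
  obtain o' where o': "beval g o' = UNIV" using beval.top by (metis imageE)
  then show "(\<lambda>z. emeasure (nth_measure i z) UNIV) \<in> borel_measurable borel"
    using *[of o'] by simp
qed simp

end

section \<open>Borel conditions, dense norm tests and supports\<close>

lemma borel_sets_of_snd:
  assumes "P \<in> sets (borel :: (nat \<Rightarrow> real) measure)"
  shows "topspace X \<times> P \<in> borel_sets_of (prod_topology X euclidean)"
proof -
  have "P \<in> sigma_sets UNIV {U. open U}" using assms by (simp add: borel_def)
  then show ?thesis
  proof induction
    case (Basic U)
    then show ?case unfolding borel_sets_of_def
      by (intro sigma_sets.Basic CollectI) (auto simp: openin_prod_Times_iff)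
  next
    case Empty
    show ?case by (simp add: borel_sets_of_def sigma_sets.Empty)
  next
    case (Compl U)
    have "topspace X \<times> (UNIV - U) = topspace (prod_topology X euclidean) - topspace X \<times> U"
      by auto
    with Compl show ?case unfolding borel_sets_of_def by (metis sigma_sets.Compl)
  next
    case (Union U)
    have "topspace X \<times> (\<Union>i. U i) = (\<Union>i. topspace X \<times> U i)" by auto
    with Union show ?case unfolding borel_sets_of_def by (metis sigma_sets.Union)
  qed
qed

lemma Polish_space_sequences: "Polish_space (euclidean :: (nat \<Rightarrow> real) topology)"
  unfolding Polish_space_def
proof
  show "completely_metrizable_space (euclidean :: (nat \<Rightarrow> real) topology)"
    unfolding euclidean_product_topology[symmetric]
    by (simp add: completely_metrizable_space_product_topology completely_metrizable_space_euclidean)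
  obtain D :: "(nat \<Rightarrow> real) set" where D: "countable D" "\<And>X. open X \<Longrightarrow> X \<noteq> {} \<Longrightarrow> \<exists>d\<in>D. d \<in> X"
    using countable_dense_exists[where 'a = "nat \<Rightarrow> real"] by auto
  have "closure D = UNIV"
    using D(2)[of "- closure D"] closure_subset[of D] by auto
  with D(1) show "separable_space (euclidean :: (nat \<Rightarrow> real) topology)"
    by (auto simp: separable_space_def)
qed

text \<open>The inequality is non-strict, so it survives limits in both arguments; a norm bound thus
  becomes countably many scalar conditions.\<close>

lemma norm_blinfun_le_dense_iff:
  fixes T :: "'b::real_inner \<Rightarrow>\<^sub>L 'b"
  assumes d: "closure (range d) = (UNIV :: 'b set)" and "0 \<le> K"
  shows "norm T \<le> K \<longleftrightarrow> (\<forall>p q. \<bar>inner (T (d p)) (d q)\<bar> \<le> K * norm (d p) * norm (d q))"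
proof
  assume T: "norm T \<le> K"
  show "\<forall>p q. \<bar>inner (T (d p)) (d q)\<bar> \<le> K * norm (d p) * norm (d q)"
  proof (intro allI)
    fix p q
    have "\<bar>inner (T (d p)) (d q)\<bar> \<le> norm (T (d p)) * norm (d q)" by (rule Cauchy_Schwarz_ineq2)
    also have "\<dots> \<le> (K * norm (d p)) * norm (d q)"
      using norm_blinfun[of T "d p"] T by (intro mult_right_mono order_trans[OF norm_blinfun]) auto
    finally show "\<bar>inner (T (d p)) (d q)\<bar> \<le> K * norm (d p) * norm (d q)" .
  qed
next
  assume le: "\<forall>p q. \<bar>inner (T (d p)) (d q)\<bar> \<le> K * norm (d p) * norm (d q)"
  have seq: "\<exists>s. (\<forall>n. s n \<in> range d) \<and> s \<longlonglongrightarrow> x" for x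
    using d closure_sequential[of x "range d"] by simp
  show "norm T \<le> K"
  proof (rule norm_blinfun_le_inner[OF \<open>0 \<le> K\<close>])
    fix x y
    obtain s t where s: "\<And>n. s n \<in> range d" "s \<longlonglongrightarrow> x" and t: "\<And>n. t n \<in> range d" "t \<longlonglongrightarrow> y"
      using seq by metis
    have "(\<lambda>n. \<bar>inner (T (s n)) (t n)\<bar>) \<longlonglongrightarrow> \<bar>inner (T x) y\<bar>"
      using s t by (intro tendsto_intros blinfun.tendsto) auto
    moreover have "(\<lambda>n. K * norm (s n) * norm (t n)) \<longlonglongrightarrow> K * norm x * norm y"
      using s t by (intro tendsto_intros)
    moreover have "\<bar>inner (T (s n)) (t n)\<bar> \<le> K * norm (s n) * norm (t n)" for n
      using s(1)[of n] t(1)[of n] le by auto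
    ultimately show "\<bar>inner (T x) y\<bar> \<le> K * norm x * norm y"
      by (meson LIMSEQ_le)
  qed
qed

text \<open>Non-strict bounds along 1/(k+1) describe the closure and fit the dense norm test
  directly.\<close>

lemma closure_range_iff:
  fixes S :: "nat \<Rightarrow> 'b::real_normed_vector"
  shows "x \<in> closure (range S) \<longleftrightarrow> (\<forall>k. \<exists>j. norm (x - S j) \<le> 1 / real (Suc k))"
proof
  assume x: "x \<in> closure (range S)"
  show "\<forall>k. \<exists>j. norm (x - S j) \<le> 1 / real (Suc k)"
  proof
    fix k
    have "0 < 1 / real (Suc k)" by simp
    with x obtain j where "dist (S j) x < 1 / real (Suc k)"
      unfolding closure_approachable by blast
    then show "\<exists>j. norm (x - S j) \<le> 1 / real (Suc k)"
      by (intro exI[of _ j]) (simp add: dist_norm norm_minus_commute)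
  qed
next
  assume *: "\<forall>k. \<exists>j. norm (x - S j) \<le> 1 / real (Suc k)"
  show "x \<in> closure (range S)"
    unfolding closure_approachable
  proof (intro allI impI)
    fix e :: real assume "0 < e"
    then obtain k where k: "1 / real (Suc k) < e" using nat_approx_posE by blast
    obtain j where "norm (x - S j) \<le> 1 / real (Suc k)" using * by blast
    with k have "dist (S j) x < e" by (simp add: dist_norm norm_minus_commute)
    then show "\<exists>y\<in>range S. dist y x < e" by blast
  qed
qed

text \<open>The complement of the support is a possibly uncountable union of null open sets;
  Lindelof's theorem extracts a countable subcover.\<close>

lemma complex_measure_null_outside_support:
  fixes \<mu> :: "'a::{second_countable_topology} set \<Rightarrow> complex"
  assumes \<mu>: "\<mu> \<in> complex_measures" and E: "measure_support \<mu> \<subseteq> E"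
    and B: "B \<in> sets borel" "B \<inter> E = {}"
  shows "\<mu> B = 0"
proof -
  define \<U> where "\<U> = {U. open U \<and> (\<forall>A\<in>sets borel. A \<subseteq> U \<longrightarrow> \<mu> A = 0)}"
  have BU: "B \<subseteq> \<Union>\<U>" using B(2) E by (auto simp: measure_support_def \<U>_def)
  obtain \<V> where \<V>: "\<V> \<subseteq> \<U>" "countable \<V>" "\<Union>\<V> = \<Union>\<U>"
  proof (rule Lindelof[of \<U>])
    show "open S" if "S \<in> \<U>" for S using that by (simp add: \<U>_def)
  qed
  \<comment> \<open>Allows \<open>{}\<close> to be added to \<V>, which may itself be empty, before
    enumerating it.\<close>
  have e: "{} \<in> \<U>" using finite_signed_measure.empty[OF finite_signed_measure_Re[OF \<mu>]]
      finite_signed_measure.empty[OF finite_signed_measure_Im[OF \<mu>]]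
    by (auto simp: \<U>_def complex_eq_iff)
  define V where "V = from_nat_into (insert {} \<V>)"
  have V: "range V = insert {} \<V>" unfolding V_def using \<V>(2) by (intro range_from_nat_into) auto
  have VU: "V n \<in> \<U>" for n
  proof -
    have "V n \<in> insert {} \<V>" unfolding V[symmetric] by (rule rangeI)
    then show ?thesis using \<V>(1) e by auto
  qed
  \<comment> \<open>Countable additivity concerns disjoint families; each disjointed piece still
    lies inside \<open>V n\<close>, all of whose Borel subsets are null.\<close>
  define D where "D n = B \<inter> disjointed V n" for n
  have "V n \<in> sets borel" for n using VU[of n] by (auto simp: \<U>_def)
  then have dV: "disjointed V n \<in> sets borel" for n
    using sets.range_disjointed_sets[of V borel] by blast
  have sums: "(\<lambda>n. \<mu> (D n)) sums \<mu> (\<Union>n. D n)"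
  proof -
    have "range D \<subseteq> sets borel" using dV B(1) by (auto simp: D_def)
    moreover have "disjoint_family D"
      using disjoint_family_disjointed[of V] unfolding D_def disjoint_family_on_def by blast
    ultimately show ?thesis using \<mu> by (simp add: complex_measures_def)
  qed
  have zero: "\<mu> (D n) = 0" for n
  proof -
    have "D n \<subseteq> V n" using disjointed_subset[of V n] by (auto simp: D_def)
    moreover have "D n \<in> sets borel" using dV B(1) by (simp add: D_def)
    ultimately show ?thesis using VU[of n] by (auto simp: \<U>_def)
  qed
  have "(\<Union>n. D n) = B"
  proof -
    have "(\<Union>n. D n) = B \<inter> (\<Union>n. disjointed V n)" unfolding D_def by blast
    also have "(\<Union>n. disjointed V n) = (\<Union>n. V n)" by (rule UN_disjointed_eq)
    also have "(\<Union>n. V n) = \<Union>\<U>" unfolding V using \<V>(3) by simp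
    finally show ?thesis unfolding Int_absorb2[OF BU] .
  qed
  with sums have "(\<lambda>n::nat. 0) sums \<mu> B" unfolding zero by (simp only:)
  from sums_unique2[OF this sums_zero] show ?thesis .
qed

lemma measure_support_complex_combination:
  assumes "closed E" and null: "\<And>m. m \<in> {m0, m1, m2, m3} \<Longrightarrow> sets m = sets borel \<and> emeasure m (- E) = 0"
  shows "measure_support (complex_combination m0 m1 m2 m3) \<subseteq> E"
proof -
  have "complex_combination m0 m1 m2 m3 A = 0" if A: "A \<in> sets borel" "A \<subseteq> - E" for A
  proof -
    have "measure m A = 0" if "m \<in> {m0, m1, m2, m3}" for m
    proof -
      have "- E \<in> sets m" using null[OF that] \<open>closed E\<close> by auto
      then have "emeasure m A \<le> emeasure m (- E)" using A(2) by (rule emeasure_mono[rotated])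
      then show ?thesis using null[OF that] by (simp add: measure_def)
    qed
    then show ?thesis by (simp add: complex_combination_def complex_eq_iff)
  qed
  then show ?thesis
    unfolding measure_support_def using \<open>closed E\<close> by (auto simp: open_Compl)
qed

lemma density_const:
  assumes "finite_borel m" "0 < c"
  shows "finite_borel (density m (\<lambda>_. ennreal c))"
    and "A \<in> sets borel \<Longrightarrow> emeasure (density m (\<lambda>_. ennreal c)) A = ennreal c * emeasure m A"
    and "\<phi> \<in> borel_measurable borel \<Longrightarrow>
      (LINT x|density m (\<lambda>_. ennreal c). \<phi> x) = c * (LINT x|m. (\<phi> x :: real))"
proof -
  interpret finite_measure m using assms by (simp add: finite_borel_def)
  have s: "sets m = sets borel" using assms by (simp add: finite_borel_def)
  show em: "emeasure (density m (\<lambda>_. ennreal c)) A = ennreal c * emeasure m A" if "A \<in> sets borel" for A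
    using that s by (simp add: emeasure_density nn_integral_cmult_indicator)
  have sp: "space m = UNIV" using sets_eq_imp_space_eq[OF s] by simp
  show "finite_borel (density m (\<lambda>_. ennreal c))"
    unfolding finite_borel_def using em[of UNIV] s
    by (auto intro!: finite_measureI simp: sp ennreal_mult_eq_top_iff emeasure_finite)
  assume "\<phi> \<in> borel_measurable borel"
  then have "\<phi> \<in> borel_measurable m" by (simp add: measurable_cong_sets[OF s refl])
  then show "(LINT x|density m (\<lambda>_. ennreal c). \<phi> x) = c * (LINT x|m. (\<phi> x :: real))"
    using assms(2) by (subst integral_density) auto
qed

section \<open>Coding the witnesses against extended uniqueness\<close>

definition coded_measure :: "(nat \<Rightarrow> 'a::t2_space set) \<Rightarrow> (nat \<Rightarrow> real) \<Rightarrow> 'a set \<Rightarrow> complex" where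
  "coded_measure g z = complex_combination
    (compact_generators.nth_measure g 0 z) (compact_generators.nth_measure g 1 z)
    (compact_generators.nth_measure g 2 z) (compact_generators.nth_measure g 3 z)"

text \<open>The condition is put on each part separately, so cancellation between parts is excluded.
  No witness is lost, since the Jordan parts vanish on any set all of whose Borel subsets are
  \<mu>-null.\<close>

definition null_outside :: "(nat \<Rightarrow> 'a::t2_space set) \<Rightarrow> nat \<Rightarrow> (nat \<Rightarrow> real) \<Rightarrow> bool" where
  "null_outside g n z \<longleftrightarrow> (\<forall>i<4. emeasure (compact_generators.nth_measure g i z) (g n) = 0)"

lemma zero_measure: "(\<lambda>_. 0) \<in> complex_measures"
  by (simp add: complex_measures_def)

text \<open>The zero measure always puts 0 into the intersection, so equality with
  \<open>{0}\<close> reduces to an inclusion.\<close>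

lemma extended_uniqueness_iff:
  fixes E :: "'a::{haar_group, second_countable_topology} set"
  assumes haar: "sigma_finite_measure (haar :: 'a measure)"
  shows "extended_uniqueness E \<longleftrightarrow> closed E \<and>
    (\<forall>\<mu>\<in>measures_on E. lambda_op \<mu> \<in> reduced_group_algebra \<longrightarrow> lambda_op \<mu> = 0)"
proof -
  have "(\<lambda>_. 0) \<in> measures_on E"
    using open_UNIV by (auto simp: measures_on_def zero_measure measure_support_def)
  moreover have *: "lambda_op (\<lambda>_ :: 'a set. 0) = 0"
  proof (rule blinfun_eqI_inner)
    fix \<xi> \<eta> :: "'a L2"
    show "inner (lambda_op (\<lambda>_. 0) \<xi>) \<eta> = inner ((0 :: 'a L2 \<Rightarrow>\<^sub>L 'a L2) \<xi>) \<eta>"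
      using inner_lambda_op_pos_part[OF haar zero_measure, of \<xi> \<eta>] by simp
  qed
  moreover have "0 \<in> (reduced_group_algebra :: ('a L2 \<Rightarrow>\<^sub>L 'a L2) set)"
  proof -
    have "L1_measure (\<lambda>_ :: 'a. 0) = (\<lambda>_. 0)"
      by (auto simp: L1_measure_def fun_eq_iff set_lebesgue_integral_def)
    then have "L1_op (\<lambda>_ :: 'a. 0) = 0" by (simp add: L1_op_def *)
    moreover have "integrable haar (\<lambda>_ :: 'a. 0 :: complex)" by simp
    ultimately show ?thesis
      unfolding reduced_group_algebra_eq[OF haar]
      by (intro subsetD[OF closure_subset]) (metis (mono_tags, lifting) mem_Collect_eq)
  qed
  ultimately have "0 \<in> lambda_op ` measures_on E \<inter> reduced_group_algebra"
    by (metis IntI imageI)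
  then show ?thesis unfolding extended_uniqueness_def by blast
qed

text \<open>A code yields a measure on \<open>E\<close>. Conversely, a witness is replaced by a
  positive multiple whose four parts have mass at most 1 and hence possess codes.\<close>

lemma not_extended_uniqueness_iff_code:
  fixes E :: "'a::{haar_group, t2_space, second_countable_topology} set"
  assumes g: "compact_generators g" and E: "closed E"
  shows "\<not> extended_uniqueness E \<longleftrightarrow> (\<exists>z. (\<forall>n. E \<inter> g n = {} \<longrightarrow> null_outside g n z) \<and>
    lambda_op (coded_measure g z) \<in> reduced_group_algebra \<and> lambda_op (coded_measure g z) \<noteq> 0)"
    (is "_ \<longleftrightarrow> (\<exists>z. ?code z)")
proof -
  interpret compact_generators g by (rule g)
  note haar = sigma_finite_haar[OF g]
  show ?thesis
  proof
    assume "\<exists>z. ?code z"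
    then obtain z where z: "\<And>n. E \<inter> g n = {} \<Longrightarrow> null_outside g n z"
      "lambda_op (coded_measure g z) \<in> reduced_group_algebra" "lambda_op (coded_measure g z) \<noteq> 0"
      by blast
    \<comment> \<open>The complement of a closed set is a countable union of generators, each
      disjoint from \<open>E\<close> and hence null for every part.\<close>
    obtain I where I: "- E = (\<Union>i\<in>I. g i)" using open_union[of "- E"] E by auto
    have null: "emeasure (nth_measure i z) (- E) = 0" if "i < 4" for i
    proof -
      have "g n \<in> null_sets (nth_measure i z)" if "n \<in> I" for n
        using z(1)[of n] I that \<open>i < 4\<close> borel_compact[OF compact_g, of n]
          finite_borel_nth_measure[of i z]
        by (auto simp: null_outside_def null_sets_def finite_borel_def)
      then have "(\<Union>i\<in>I. g i) \<in> null_sets (nth_measure i z)"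
        by (intro null_sets_UN') auto
      then show ?thesis using I by auto
    qed
    have "measure_support (coded_measure g z) \<subseteq> E"
      unfolding coded_measure_def
      by (rule measure_support_complex_combination[OF E])
        (use null finite_borel_nth_measure in \<open>auto simp: finite_borel_def\<close>)
    moreover have "coded_measure g z \<in> complex_measures"
      unfolding coded_measure_def by (intro complex_combination_measure finite_borel_nth_measure)
    ultimately have "coded_measure g z \<in> measures_on E" by (simp add: measures_on_def)
    then show "\<not> extended_uniqueness E"
      using z(2,3) extended_uniqueness_iff[OF haar] by blast
  next
    assume "\<not> extended_uniqueness E"
    then obtain \<mu> where \<mu>: "\<mu> \<in> complex_measures" "measure_support \<mu> \<subseteq> E"
      "lambda_op \<mu> \<in> reduced_group_algebra" "lambda_op \<mu> \<noteq> 0"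
      using extended_uniqueness_iff[OF haar] E by (auto simp: measures_on_def)
    define \<nu> where "\<nu> i A = (if i = 0 then Re (\<mu> A) else if i = 1 then - Re (\<mu> A)
        else if i = 2 then Im (\<mu> A) else - Im (\<mu> A))" for i :: nat and A
    define p where "p i = pos_part (\<nu> i)" for i
    have \<nu>: "finite_signed_measure (\<nu> i)" for i
      using finite_signed_measure_Re[OF \<mu>(1)] finite_signed_measure_Im[OF \<mu>(1)]
        finite_signed_measure_uminus[OF finite_signed_measure_Re[OF \<mu>(1)]]
        finite_signed_measure_uminus[OF finite_signed_measure_Im[OF \<mu>(1)]]
      unfolding \<nu>_def[abs_def] by (cases "i = 0"; cases "i = 1"; cases "i = 2") simp_all
    have p: "finite_borel (p i)" for i
      unfolding p_def using \<nu> by (rule finite_borel_pos_part)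
    \<comment> \<open>One common factor for all four parts, so that the operator is merely
      multiplied by c; the 1 keeps the denominator positive.\<close>
    define c where "c = 1 / (1 + (\<Sum>i<4. measure (p i) UNIV))"
    have S: "0 \<le> (\<Sum>i<4. measure (p i) UNIV)" by (intro sum_nonneg) simp
    have c: "0 < c" using S by (simp add: c_def add_pos_nonneg)
    define m where "m i = density (p i) (\<lambda>_. ennreal c)" for i
    have m: "finite_borel (m i)" for i unfolding m_def by (rule density_const(1)[OF p c])
    have m1: "emeasure (m i) UNIV \<le> 1" if "i < 4" for i
    proof -
      interpret finite_measure "p i" using p by (simp add: finite_borel_def)
      have "measure (p i) UNIV \<le> (\<Sum>i<4. measure (p i) UNIV)"
        using that by (intro member_le_sum) auto
      then have "c * measure (p i) UNIV \<le> 1" using S by (simp add: c_def divide_le_eq)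
      moreover have "emeasure (m i) UNIV = ennreal (c * measure (p i) UNIV)"
        unfolding m_def using c by (simp add: density_const(2)[OF p c] emeasure_eq_measure ennreal_mult)
      ultimately show ?thesis by (simp add: ennreal_le_1)
    qed
    define z where "z k = (case from_nat k of (i, t) \<Rightarrow> measure (m i) (beval g t))" for k
    have nth: "nth_measure i z = m i" if "i < 4" for i
      using code_measure_code[OF m m1[OF that]] by (simp add: nth_measure_def z_def)
    have coded: "coded_measure g z = complex_combination (m 0) (m 1) (m 2) (m 3)"
      by (simp add: coded_measure_def nth)
    have "lambda_op (coded_measure g z) = c *\<^sub>R lambda_op \<mu>"
    proof (rule blinfun_eqI_inner)
      fix \<xi> \<eta> :: "'a L2"
      have [simp]: "p 0 = pos_part (\<lambda>A. Re (\<mu> A))" "p (Suc 0) = pos_part (\<lambda>A. - Re (\<mu> A))"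
        "p 2 = pos_part (\<lambda>A. Im (\<mu> A))" "p 3 = pos_part (\<lambda>A. - Im (\<mu> A))"
        by (simp_all add: p_def \<nu>_def[abs_def])
      have "(LINT s|m i. coefficient \<xi> \<eta> s) = c * (LINT s|p i. coefficient \<xi> \<eta> s)" for i \<eta>
        unfolding m_def by (rule density_const(3)[OF p c coefficient_measurable[OF haar p]])
      then show "inner (lambda_op (coded_measure g z) \<xi>) \<eta> = inner ((c *\<^sub>R lambda_op \<mu>) \<xi>) \<eta>"
        unfolding coded inner_lambda_op[OF haar m m m m]
        by (simp add: blinfun.scaleR_left inner_lambda_op_pos_part[OF haar \<mu>(1)] algebra_simps)
    qed
    \<comment> \<open>Invoked for the subspace clause, by which the multiple by c stays in the
      reduced algebra.\<close>
    moreover obtain d :: "nat \<Rightarrow> 'a L2 \<Rightarrow>\<^sub>L 'a L2"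
      where "closure (range d) = reduced_group_algebra" "subspace (closure (range d))"
      by (rule reduced_group_algebra_countable_dense[OF g])
    ultimately have "lambda_op (coded_measure g z) \<in> reduced_group_algebra" "lambda_op (coded_measure g z) \<noteq> 0"
      using \<mu>(3,4) c by (auto intro: subspace_scale)
    moreover have "null_outside g n z" if "E \<inter> g n = {}" for n
      unfolding null_outside_def
    proof (intro allI impI)
      fix i :: nat assume "i < 4"
      have gn: "g n \<in> sets borel" by (rule borel_compact[OF compact_g])
      have "\<nu> i B = 0" if "B \<in> sets borel" "B \<subseteq> g n" for B
      proof -
        have "\<mu> B = 0"
          using that \<open>E \<inter> g n = {}\<close> by (intro complex_measure_null_outside_support[OF \<mu>(1,2)]) auto
        then show ?thesis by (simp add: \<nu>_def)
      qed
      then have "emeasure (p i) (g n) = 0"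
        unfolding p_def using \<nu> gn by (intro pos_part_null) auto
      then show "emeasure (nth_measure i z) (g n) = 0"
        unfolding nth[OF \<open>i < 4\<close>] m_def by (simp add: density_const(2)[OF p c gn])
    qed
    ultimately show "\<exists>z. ?code z" by blast
  qed
qed

text \<open>No measurability of z to T(z) as an operator-valued map is claimed: both conditions are
  countable combinations of inequalities between coefficients, each measurable in z.\<close>

lemma coded_operator_measurable:
  fixes g :: "nat \<Rightarrow> 'a::{haar_group, t2_space, second_countable_topology} set"
  assumes g: "compact_generators g"
  shows "{z. lambda_op (coded_measure g z) \<in> reduced_group_algebra \<and> lambda_op (coded_measure g z) \<noteq> 0}
    \<in> sets borel"
proof -
  interpret compact_generators g by (rule g)
  note haar = sigma_finite_haar[OF g]
  obtain d :: "nat \<Rightarrow> 'a L2" where d: "closure (range d) = UNIV"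
    using L2_countable_dense[OF g] by blast
  obtain S :: "nat \<Rightarrow> 'a L2 \<Rightarrow>\<^sub>L 'a L2" where S: "closure (range S) = reduced_group_algebra"
    by (rule reduced_group_algebra_countable_dense[OF g])
  define T where "T z = lambda_op (coded_measure g z)" for z
  have I: "(\<lambda>z. LINT s|nth_measure i z. coefficient \<xi> \<eta> s) \<in> borel_measurable borel" for i \<xi> \<eta>
    by (rule measurable_compose[OF nth_measure_measurable integral_measurable_subprob_algebra])
      (rule coefficient_measurable[OF haar finite_borel_nth_measure])
  have [measurable]: "(\<lambda>z. inner (T z \<xi>) \<eta>) \<in> borel_measurable borel" for \<xi> \<eta>
    unfolding T_def coded_measure_def
      inner_lambda_op[OF haar finite_borel_nth_measure finite_borel_nth_measure finite_borel_nth_measure finite_borel_nth_measure]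
    by (intro borel_measurable_diff I)
  have le: "norm R \<le> K \<longleftrightarrow> (\<forall>p q. \<bar>inner (R (d p)) (d q)\<bar> \<le> K * norm (d p) * norm (d q))"
    if "0 \<le> K" for R :: "'a L2 \<Rightarrow>\<^sub>L 'a L2" and K
    by (rule norm_blinfun_le_dense_iff[OF d that])
  have "T z \<in> reduced_group_algebra \<longleftrightarrow> (\<forall>k. \<exists>j. \<forall>p q.
      \<bar>inner (T z (d p)) (d q) - inner (S j (d p)) (d q)\<bar> \<le> 1 / real (Suc k) * norm (d p) * norm (d q))" for z
    unfolding S[symmetric] closure_range_iff by (simp add: le blinfun.diff_left inner_diff_left)
  \<comment> \<open>The dense norm test with bound 0, where the right-hand sides vanish.\<close>
  moreover have "T z \<noteq> 0 \<longleftrightarrow> \<not> (\<forall>p q. \<bar>inner (T z (d p)) (d q)\<bar> \<le> 0)" for z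
    using le[of 0 "T z"] by simp
  ultimately have "{z. T z \<in> reduced_group_algebra \<and> T z \<noteq> 0} = {z \<in> space borel. (\<forall>k. \<exists>j. \<forall>p q.
      \<bar>inner (T z (d p)) (d q) - inner (S j (d p)) (d q)\<bar> \<le> 1 / real (Suc k) * norm (d p) * norm (d q)) \<and>
      \<not> (\<forall>p q. \<bar>inner (T z (d p)) (d q)\<bar> \<le> 0)}"
    by simp
  also have "\<dots> \<in> sets borel" by measurable
  finally show ?thesis by (simp add: T_def)
qed

lemma null_outside_measurable:
  fixes g :: "nat \<Rightarrow> 'a::{t2_space, second_countable_topology} set"
  assumes g: "compact_generators g"
  shows "{z. null_outside g n z} \<in> sets borel"
proof -
  interpret compact_generators g by (rule g)
  have gn: "g n \<in> sets borel" by (rule borel_compact[OF compact_g])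
  have [measurable]: "(\<lambda>z. emeasure (nth_measure i z) (g n)) \<in> borel_measurable borel" for i
    by (rule measurable_compose[OF nth_measure_measurable measurable_emeasure_subprob_algebra[OF gn]])
  have "{z \<in> space borel. \<forall>i<4. emeasure (nth_measure i z) (g n) = 0} \<in> sets borel"
    by measurable
  then show ?thesis by (simp add: null_outside_def)
qed

text \<open>Missing a compact set is a subbasic open condition of the Fell topology, so hitting it
  is closed.\<close>

lemma hits_compact_borel:
  assumes "compact (K :: 'a::topological_space set)"
  shows "{F. closed F \<and> F \<inter> K \<noteq> {}} \<times> UNIV \<in>
    borel_sets_of (prod_topology fell_topology (euclidean :: 'b::topological_space topology))"
proof -
  define X where "X = prod_topology (fell_topology :: 'a set topology) (euclidean :: 'b topology)"
  have "openin (fell_topology :: 'a set topology) {F. closed F \<and> F \<inter> K = {}}"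
    unfolding fell_topology_def using assms by (intro topology_generated_by_Basis) blast
  then have "openin X ({F. closed F \<and> F \<inter> K = {}} \<times> UNIV)"
    unfolding X_def by (simp add: openin_prod_Times_iff)
  then have "topspace X - {F. closed F \<and> F \<inter> K = {}} \<times> UNIV \<in> borel_sets_of X"
    unfolding borel_sets_of_def by (intro sigma_sets.Compl sigma_sets.Basic) simp
  moreover have "topspace X - {F. closed F \<and> F \<inter> K = {}} \<times> UNIV = {F. closed F \<and> F \<inter> K \<noteq> {}} \<times> UNIV"
    by (auto simp: X_def topspace_fell_topology)
  ultimately show ?thesis by (simp add: X_def)
qed

theorem theorem4p8:
  assumes "locally_compact_space (euclidean :: 'a::{haar_group, t2_space, second_countable_topology} topology)"
  shows "coanalytic_in fell_topology (U0 :: 'a set set)"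
proof -
  obtain g :: "nat \<Rightarrow> 'a set" where g: "compact_generators g"
    using ex_compact_generators[OF assms] by blast
  interpret compact_generators g by (rule g)
  define X where "X = prod_topology (fell_topology :: 'a set topology) (euclidean :: (nat \<Rightarrow> real) topology)"
  \<comment> \<open>The implication from disjointness with \<open>g n\<close> to nullity on
    \<open>g n\<close>, written as a union: either \<open>F\<close> hits \<open>g n\<close> or the
    code is null there.\<close>
  define C where "C n = {F. closed F \<and> F \<inter> g n \<noteq> {}} \<times> UNIV \<union>
    topspace (fell_topology :: 'a set topology) \<times> {z. null_outside g n z}" for n
  define P where "P = topspace (fell_topology :: 'a set topology) \<times>
    {z. lambda_op (coded_measure g z) \<in> reduced_group_algebra \<and> lambda_op (coded_measure g z) \<noteq> 0}"
  interpret X: sigma_algebra "topspace X" "borel_sets_of X"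
    unfolding borel_sets_of_def by (rule sigma_algebra_sigma_sets) (auto dest: openin_subset)
  have "C n \<in> borel_sets_of X" for n
    unfolding C_def X_def using X.Un[unfolded X_def] hits_compact_borel[OF compact_g]
      borel_sets_of_snd[OF null_outside_measurable[OF g]] by blast
  moreover have "P \<in> borel_sets_of X"
    unfolding P_def X_def by (rule borel_sets_of_snd[OF coded_operator_measurable[OF g]])
  ultimately have "(\<Inter>n. C n) \<inter> P \<in> borel_sets_of X"
    by (intro X.Int X.countable_INT') auto
  moreover have "topspace fell_topology - U0 = fst ` ((\<Inter>n. C n) \<inter> P)"
  proof -
    have mem: "(E, z) \<in> (\<Inter>n. C n) \<inter> P \<longleftrightarrow> closed E \<and> (\<forall>n. E \<inter> g n = {} \<longrightarrow> null_outside g n z) \<and>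
      lambda_op (coded_measure g z) \<in> reduced_group_algebra \<and> lambda_op (coded_measure g z) \<noteq> 0" for E z
      by (auto simp: C_def P_def topspace_fell_topology)
    have "E \<in> fst ` ((\<Inter>n. C n) \<inter> P) \<longleftrightarrow> (\<exists>z. (E, z) \<in> (\<Inter>n. C n) \<inter> P)" for E
      unfolding Domain_fst[symmetric] Domain_iff ..
    also have "(\<exists>z. (E, z) \<in> (\<Inter>n. C n) \<inter> P) \<longleftrightarrow> closed E \<and> \<not> extended_uniqueness E" for E
      unfolding mem using not_extended_uniqueness_iff_code[OF g, of E] by blast
    finally show ?thesis
      by (auto simp: U0_def topspace_fell_topology)
  qed
  ultimately have "analytic_in fell_topology (topspace fell_topology - (U0 :: 'a set set))"
    unfolding analytic_in_def X_def using Polish_space_sequences by blast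
  moreover have "(U0 :: 'a set set) \<subseteq> topspace fell_topology"
    by (auto simp: U0_def extended_uniqueness_def topspace_fell_topology)
  ultimately show ?thesis by (simp add: coanalytic_in_def)
qed

end
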